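(* Let $n\ge1$, $f\in L^2(\mathbb C^n)$ and $k\in\mathbb Z_+$. Then $Q_k=f\times\varphi_k^{n-1}$ is real analytic on $\mathbb C^n$, and there exist $P_{p,q}^k\in H_{p,q}$ ($0\le p\le k$, $q\in\mathbb Z_+$) such that $Q_k$ has the real analytic expansion $$Q_k(z)=\sum_{p=0}^{k}\sum_{q=0}^\infty P_{p,q}^{k}(z)\,\varphi_{k-p}^{n+p+q-1}(z),\qquad z\in\mathbb C^n.$$
   Context: $\mathbb Z_+=\{0,1,2,\dots\}$. Real analytic on $\mathbb C^n$ means real analytic on $\mathbb R^{2n}$. The twisted convolution on $\mathbb C^n$ is $f\times g(z)=\int_{\mathbb C^n}f(z-w)g(w)e^{\frac i2\mathrm{Im}(z\cdot\bar w)}\,dw$, where $z\cdot\bar w=\sum_j z_j\bar w_j$. $H_{p,q}$ is the space of polynomials $P(z)=\sum_{|\alpha|=p}\sum_{|\beta|=q}c_{\alpha\beta}z^\alpha\bar z^\beta$ on $\mathbb C^n$ with $\Delta P=0$. For an integer $m\ge1$ and $k\in\mathbb Z_+$, the Laguerre function is $\varphi_k^{m-1}(z)=L_k^{m-1}(\tfrac12|z|^2)e^{-\frac14|z|^2}$, a function of $|z|$, where $L_k^{\alpha}(x)=\sum_{i=0}^k(-1)^i\binom{\alpha+k}{k-i}\frac{x^i}{i!}$; in particular $\varphi_{k-p}^{n+p+q-1}(z)$ for $z\in\mathbb C^n$ means $L_{k-p}^{n+p+q-1}(\tfrac12|z|^2)e^{-\frac14|z|^2}$. *)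

theory Defs
  imports "HOL-Analysis.Analysis"
begin

text \<open>
  Complex \<open>n\<close>-space is the type \<open>complex^'n\<close>, with \<open>n = CARD('n)\<close>. As a Euclidean space it is real
  \<open>2n\<close>-space: its \<open>Basis\<close> consists of the vectors with a single nonzero entry \<open>1\<close> or \<open>\<i>\<close>, its norm is
  the usual Euclidean norm, and \<open>lebesgue\<close> is the usual Lebesgue measure.
\<close>

subsection \<open>Real analytic functions\<close>

definition multi_indices :: "('a::euclidean_space \<Rightarrow> nat) set" where
  "multi_indices = {\<alpha>. \<forall>b. b \<notin> Basis \<longrightarrow> \<alpha> b = 0}"

text \<open>
  \<open>has_sum\<close> is unconditional summation, which here amounts to absolute convergence
  of the multivariate power series.
\<close>

definition real_analytic :: "('a::euclidean_space \<Rightarrow> complex) \<Rightarrow> bool" where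
  "real_analytic f \<longleftrightarrow>
     (\<forall>x. \<exists>r>0. \<exists>c. \<forall>y\<in>ball x r.
        ((\<lambda>\<alpha>. c \<alpha> * of_real (\<Prod>b\<in>Basis. ((y - x) \<bullet> b) ^ \<alpha> b)) has_sum f y) multi_indices)"

subsection \<open>Twisted convolution\<close>

definition herm :: "complex^'n \<Rightarrow> complex^'n \<Rightarrow> complex" where
  "herm z w = (\<Sum>j\<in>UNIV. z $ j * cnj (w $ j))"

definition twisted_conv ::
  "(complex^'n \<Rightarrow> complex) \<Rightarrow> (complex^'n \<Rightarrow> complex) \<Rightarrow> complex^'n \<Rightarrow> complex" where
  "twisted_conv f g z =
     (LINT w|lebesgue. f (z - w) * g w * exp (\<i> / 2 * of_real (Im (herm z w))))"

subsection \<open>Bigraded solid harmonics\<close>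

definition partial_deriv ::
  "'a::euclidean_space \<Rightarrow> ('a \<Rightarrow> complex) \<Rightarrow> 'a \<Rightarrow> complex" where
  "partial_deriv b f z = vector_derivative (\<lambda>t. f (z + t *\<^sub>R b)) (at 0)"

definition laplacian :: "('a::euclidean_space \<Rightarrow> complex) \<Rightarrow> 'a \<Rightarrow> complex" where
  "laplacian f z = (\<Sum>b\<in>Basis. partial_deriv b (partial_deriv b f) z)"

definition exponents_of_degree :: "nat \<Rightarrow> ('n::finite \<Rightarrow> nat) set" where
  "exponents_of_degree p = {\<alpha>. (\<Sum>j\<in>UNIV. \<alpha> j) = p}"

definition bigraded_harmonics :: "nat \<Rightarrow> nat \<Rightarrow> (complex^'n \<Rightarrow> complex) set" where
  "bigraded_harmonics p q =
     {P. (\<exists>c. P = (\<lambda>z. \<Sum>\<alpha>\<in>exponents_of_degree p. \<Sum>\<beta>\<in>exponents_of_degree q.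
              c \<alpha> \<beta> * (\<Prod>j\<in>UNIV. (z $ j) ^ \<alpha> j) * (\<Prod>j\<in>UNIV. cnj (z $ j) ^ \<beta> j)))
         \<and> (\<forall>z. laplacian P z = 0)}"

subsection \<open>Laguerre functions\<close>

definition laguerre :: "nat \<Rightarrow> nat \<Rightarrow> real \<Rightarrow> real" where
  "laguerre a k x = (\<Sum>i\<le>k. (-1) ^ i * real ((a + k) choose (k - i)) * x ^ i / fact i)"

text \<open>
  The first argument \<open>a\<close> is the upper index \<open>m - 1\<close> of \<open>\<phi>\<^sub>k\<^bsup>m-1\<^esup>\<close>; it is independent of the dimension
  of the underlying space.
\<close>

definition laguerre_fun :: "nat \<Rightarrow> nat \<Rightarrow> complex^'n \<Rightarrow> complex" where
  "laguerre_fun a k z =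
     of_real (laguerre a k ((norm z)\<^sup>2 / 2) * exp (- (norm z)\<^sup>2 / 4))"

end

theory Submission
  imports Defs
begin

text \<open>
  Write \<open>n\<close> for the dimension, \<open>u = herm z w\<close>, \<open>v = herm w z\<close>, \<open>\<rho> = herm z z = |z|\<^sup>2\<close>, \<open>\<sigma> = herm w w\<close>,
  and \<open>Q\<close> for the twisted convolution. Reflecting the variable of integration, the phase of the twisted
  convolution and the mixed terms of the Gaussian combine to the factor \<open>exp (v/2)\<close>, which is
  antiholomorphic in \<open>z\<close> (\<open>twisted_conv_laguerre\<close>):
  \<open>exp (\<rho>/4) Q z = \<integral> f w exp (-\<sigma>/4) exp (v/2) L ((\<rho> + \<sigma> - u - v)/2) dw\<close>,
  where \<open>L\<close> is the Laguerre polynomial of degree \<open>k\<close> and index \<open>n - 1\<close>. Positive powers of the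
  coordinates of \<open>z\<close> come from \<open>L\<close> only, so their degree \<open>p\<close> is at most \<open>k\<close>; this is why \<open>p\<close> ranges
  over a finite set while the degree \<open>q\<close> in the conjugate coordinates does not. Two identities for
  Laguerre polynomials, a Taylor formula and \<open>exp y L (x - y) = \<Sum>b. y^b/b! L' x\<close> with the index of
  \<open>L'\<close> raised by \<open>b\<close>, give the part of bidegree \<open>(p, q)\<close> of the integrand in closed form
  (\<open>laguerre_kernel\<close>). Integration in \<open>w\<close> yields polynomials \<open>G p q\<close> of bidegree \<open>(p, q)\<close> that sum to
  \<open>exp (\<rho>/4) Q\<close>.

  The decisive property is \<open>\<Delta> (G p q) = -2 (k - p + 1) G (p-1) (q-1)\<close>. It says that \<open>Q\<close> is an
  eigenfunction of the special Hermite operator, read off degree by degree; here it follows from a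
  contiguity relation for Laguerre polynomials (\<open>laplacian_laguerre_kernel\<close>). The harmonic projection of
  \<open>G p q\<close> is a combination of \<open>\<rho>^j \<Delta>^j (G p q)\<close>, hence of \<open>\<rho>^j G (p-j) (q-j)\<close> with \<open>j \<le> p \<le> k\<close>: a sum
  whose length does not grow with \<open>q\<close>. A multiple of it is the required polynomial of the theorem. If
  these polynomials are inserted into the right-hand side and the coefficient of \<open>\<rho>^m G a b\<close> is collected,
  there remains a hypergeometric sum which telescopes to \<open>1\<close> for \<open>m = 0\<close> and to \<open>0\<close> otherwise
  (\<open>sum_expansion_coeff\<close>). The coefficients that occur are bounded uniformly in \<open>q\<close>, so the rearrangement
  only uses \<open>\<Sum>q. |G p q z| < \<infinity>\<close>.

  All convergence rests on one estimate (\<open>bihom_laguerre_kernel\<close>): for every \<open>R \<ge> 1\<close>, the sum of the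
  moduli of the coefficients of the kernel of bidegree \<open>(p, q)\<close> is at most
  \<open>C exp (c |w|) (1/2)^q / R^(p+q)\<close>, and \<open>f w exp (-\<sigma>/4) exp (c |w|)\<close> is integrable since
  \<open>|f|\<^sup>2\<close> and \<open>exp (-\<sigma>/2 + 2 c |w|)\<close> are. The estimate passes to the coefficients of
  \<open>G p q\<close>. It gives the interchange of sum and integral, and also analyticity: expanding a polynomial
  around another point multiplies the weighted sum of the moduli of its coefficients by at most
  \<open>R^(p+q)\<close> for a suitable \<open>R\<close>, and power series are complete for such weighted sums
  (\<open>majorized_suminf\<close>).
\<close>

section \<open>Laguerre polynomials of a complex argument\<close>

lemma sum_triangle_flip:
  fixes g :: "nat \<Rightarrow> nat \<Rightarrow> 'a::comm_monoid_add"
  shows "(\<Sum>i\<le>k. \<Sum>p\<le>i. g i p) = (\<Sum>p\<le>k. \<Sum>j\<le>k - p. g (p + j) p)"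
proof -
  have "(\<Sum>i\<le>k. \<Sum>p\<le>i. g i p) = (\<Sum>(i,p)\<in>Sigma {..k} (\<lambda>i. {..i}). g i p)"
    by (simp add: sum.Sigma)
  also have "\<dots> = (\<Sum>(p,j)\<in>Sigma {..k} (\<lambda>p. {..k - p}). g (p + j) p)"
    by (rule sum.reindex_bij_witness[where j="\<lambda>(i,p). (p, i - p)" and i="\<lambda>(p,j). (p + j, p)"]) auto
  also have "\<dots> = (\<Sum>p\<le>k. \<Sum>j\<le>k - p. g (p + j) p)"
    by (simp add: sum.Sigma)
  finally show ?thesis .
qed

text \<open>
  The same polynomial as \<open>laguerre\<close>, but evaluated at complex points: the argument
  \<open>(\<rho> + \<sigma> - u - v)/2\<close> is real only as a whole, and it has to be split into complex summands.
\<close>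
definition complex_laguerre :: "nat \<Rightarrow> nat \<Rightarrow> complex \<Rightarrow> complex" where
  "complex_laguerre a k x = (\<Sum>i\<le>k. (-1) ^ i * of_nat ((a + k) choose (k - i)) * x ^ i / fact i)"

lemma complex_laguerre_of_real: "complex_laguerre a k (of_real x) = of_real (laguerre a k x)"
  by (simp add: complex_laguerre_def laguerre_def)

text \<open>
  Taylor's formula: the \<open>p\<close>-th derivative of a Laguerre polynomial is \<open>(-1)^p\<close> times the one with the
  degree lowered and the index raised by \<open>p\<close>.
\<close>
lemma complex_laguerre_add:
  "complex_laguerre a k (x + y) = (\<Sum>p\<le>k. (- y) ^ p / fact p * complex_laguerre (a + p) (k - p) x)"
proof -
  have bin: "(x + y) ^ i / fact i = (\<Sum>p\<le>i. y ^ p / fact p * (x ^ (i - p) / fact (i - p)))" for i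
  proof -
    have "(x + y) ^ i = (\<Sum>p\<le>i. of_nat (i choose p) * y ^ p * x ^ (i - p))"
      by (subst add.commute) (rule binomial_ring)
    then show ?thesis
      by (auto simp: sum_divide_distrib binomial_fact intro!: sum.cong)
  qed
  have "complex_laguerre a k (x + y) = (\<Sum>i\<le>k. (-1) ^ i * of_nat ((a + k) choose (k - i)) * ((x + y) ^ i / fact i))"
    by (simp add: complex_laguerre_def)
  also have "\<dots> = (\<Sum>i\<le>k. \<Sum>p\<le>i. (-1) ^ i * of_nat ((a + k) choose (k - i)) *
                       (y ^ p / fact p * (x ^ (i - p) / fact (i - p))))"
    by (simp add: bin sum_distrib_left)
  also have "\<dots> = (\<Sum>p\<le>k. \<Sum>j\<le>k - p. (-1) ^ (p + j) * of_nat ((a + k) choose (k - (p + j))) *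
                       (y ^ p / fact p * (x ^ j / fact j)))"
    by (simp add: sum_triangle_flip)
  also have "\<dots> = (\<Sum>p\<le>k. (- y) ^ p / fact p * complex_laguerre (a + p) (k - p) x)"
  proof (rule sum.cong[OF refl])
    fix p assume "p \<in> {..k}"
    then have "a + p + (k - p) = a + k" by simp
    then show "(\<Sum>j\<le>k - p. (-1) ^ (p + j) * of_nat ((a + k) choose (k - (p + j))) *
                       (y ^ p / fact p * (x ^ j / fact j))) = (- y) ^ p / fact p * complex_laguerre (a + p) (k - p) x"
      unfolding complex_laguerre_def sum_distrib_left
      by (intro sum.cong refl) (simp add: power_add power_minus[of y])
  qed
  finally show ?thesis .
qed

text \<open>
  Vandermonde's identity, coefficient by coefficient.
\<close>
lemma complex_laguerre_shift_index:
  "(\<Sum>i\<le>m. of_nat (b choose i) * complex_laguerre (a + i) (m - i) x) = complex_laguerre (a + b) m x"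
proof -
  have "(\<Sum>i\<le>m. of_nat (b choose i) * complex_laguerre (a + i) (m - i) x)
      = (\<Sum>i\<le>m. \<Sum>l\<le>m - i. of_nat (b choose i) * of_nat ((a + m) choose (m - (i + l))) * ((-1) ^ l * x ^ l / fact l))"
    unfolding complex_laguerre_def sum_distrib_left
    by (intro sum.cong refl) (simp add: field_simps)
  also have "\<dots> = (\<Sum>s\<le>m. \<Sum>i\<le>s. of_nat (b choose i) * of_nat ((a + m) choose (m - s)) * ((-1) ^ (s - i) * x ^ (s - i) / fact (s - i)))"
    by (simp add: sum_triangle_flip)
  also have "\<dots> = (\<Sum>s\<le>m. \<Sum>l\<le>s. of_nat (b choose (s - l)) * of_nat ((a + m) choose (m - s)) * ((-1) ^ l * x ^ l / fact l))"
  proof (rule sum.cong[OF refl])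
    fix s
    show "(\<Sum>i\<le>s. of_nat (b choose i) * of_nat ((a + m) choose (m - s)) * ((-1) ^ (s - i) * x ^ (s - i) / fact (s - i)))
        = (\<Sum>l\<le>s. of_nat (b choose (s - l)) * of_nat ((a + m) choose (m - s)) * ((-1) ^ l * x ^ l / fact l))"
      by (rule sum.reindex_bij_witness[where i="\<lambda>l. s - l" and j="\<lambda>l. s - l"]) auto
  qed
  also have "\<dots> = (\<Sum>l\<le>m. \<Sum>i\<le>m - l. of_nat (b choose i) * of_nat ((a + m) choose (m - l - i)) * ((-1) ^ l * x ^ l / fact l))"
    by (simp add: sum_triangle_flip)
  also have "\<dots> = (\<Sum>l\<le>m. of_nat (\<Sum>i\<le>m - l. (b choose i) * ((a + m) choose (m - l - i))) * ((-1) ^ l * x ^ l / fact l))"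
    by (simp only: sum_distrib_right of_nat_sum of_nat_mult)
  also have "\<dots> = complex_laguerre (a + b) m x"
    unfolding complex_laguerre_def vandermonde by (intro sum.cong refl) (simp add: add_ac mult_ac)
  finally show ?thesis .
qed

text \<open>
  Multiplying by the exponential turns the shift of the argument into a sum over all indices: by Taylor's
  formula the left-hand side is a Cauchy product, and its coefficients are collected by
  \<open>complex_laguerre_shift_index\<close>.
\<close>
lemma complex_laguerre_exp_sums:
  "(\<lambda>b. y ^ b / fact b * complex_laguerre (a + b) m x) sums (exp y * complex_laguerre a m (x - y))"
proof -
  have one: "(\<lambda>b. of_nat (b choose i) * y ^ b / fact b) sums (exp y * (y ^ i / fact i))" for i
  proof -
    have "(\<lambda>b. y ^ b / fact b) sums exp y"
      using exp_converges[of y] by (simp add: scaleR_conv_of_real field_simps)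
    then have "(\<lambda>b. y ^ b / fact b * (y ^ i / fact i)) sums (exp y * (y ^ i / fact i))"
      by (rule sums_mult2)
    moreover have "of_nat ((b + i) choose i) * y ^ (b + i) / fact (b + i) = y ^ b / fact b * (y ^ i / fact i)" for b
      by (simp add: binomial_fact power_add)
    ultimately have "(\<lambda>b. of_nat ((b + i) choose i) * y ^ (b + i) / fact (b + i)) sums (exp y * (y ^ i / fact i))"
      by simp
    then show ?thesis
      using sums_zero_iff_shift[of i "\<lambda>b. of_nat (b choose i) * y ^ b / fact b"] by simp
  qed
  have "(\<lambda>b. \<Sum>i\<le>m. of_nat (b choose i) * y ^ b / fact b * complex_laguerre (a + i) (m - i) x) sums
        (\<Sum>i\<le>m. exp y * (y ^ i / fact i) * complex_laguerre (a + i) (m - i) x)"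
    by (intro sums_sum sums_mult2 one)
  moreover have "(\<Sum>i\<le>m. of_nat (b choose i) * y ^ b / fact b * complex_laguerre (a + i) (m - i) x)
      = y ^ b / fact b * complex_laguerre (a + b) m x" for b
    unfolding arg_cong[OF complex_laguerre_shift_index[symmetric, of a b m x], of "(*) (y ^ b / fact b)"] sum_distrib_left
    by (intro sum.cong refl) simp
  moreover have "(\<Sum>i\<le>m. exp y * (y ^ i / fact i) * complex_laguerre (a + i) (m - i) x) = exp y * complex_laguerre a m (x - y)"
    using complex_laguerre_add[of a m x "- y"] by (simp add: sum_distrib_left algebra_simps)
  ultimately show ?thesis by simp
qed

text \<open>
  The growth \<open>2^a\<close> is harmless: in the kernel, the part of the index that grows with \<open>q\<close> comes
  with the same power of \<open>1/2\<close>. An exponential in \<open>norm x\<close> in place of the polynomial would not be, as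
  \<open>x\<close> will be \<open>|w|\<^sup>2/2\<close> and has to be dominated by the Gaussian.
\<close>
lemma norm_complex_laguerre_le: "norm (complex_laguerre a m x) \<le> 2 ^ (a + m) * (1 + norm x) ^ m"
proof -
  have "norm (complex_laguerre a m x) \<le> (\<Sum>i\<le>m. real ((a + m) choose (m - i)) * (1 + norm x) ^ m)"
    unfolding complex_laguerre_def
  proof (rule sum_norm_le)
    fix i assume i: "i \<in> {..m}"
    have "norm x ^ i \<le> (1 + norm x) ^ i" by (intro power_mono) auto
    also have "\<dots> \<le> (1 + norm x) ^ m" using i by (intro power_increasing) auto
    finally have "norm x ^ i \<le> (1 + norm x) ^ m" .
    moreover have "norm x ^ i / fact i \<le> norm x ^ i"
      using fact_ge_1[of i, where 'a=real] by (simp add: divide_le_eq mult_le_cancel_left1)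
    ultimately have "norm x ^ i / fact i \<le> (1 + norm x) ^ m" by linarith
    then have "real ((a + m) choose (m - i)) * (norm x ^ i / fact i) \<le> real ((a + m) choose (m - i)) * (1 + norm x) ^ m"
      by (rule mult_left_mono) simp
    then show "norm ((-1) ^ i * of_nat ((a + m) choose (m - i)) * x ^ i / fact i :: complex)
         \<le> real ((a + m) choose (m - i)) * (1 + norm x) ^ m"
      by (simp add: norm_mult norm_divide norm_power)
  qed
  also have "\<dots> = (\<Sum>i\<le>m. real ((a + m) choose i)) * (1 + norm x) ^ m"
    unfolding sum_distrib_right
    by (rule sum.reindex_bij_witness[where i="\<lambda>l. m - l" and j="\<lambda>l. m - l"]) auto
  also have "\<dots> \<le> (\<Sum>i\<le>a + m. real ((a + m) choose i)) * (1 + norm x) ^ m"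
    by (intro mult_right_mono sum_mono2) auto
  also have "(\<Sum>i\<le>a + m. real ((a + m) choose i)) = 2 ^ (a + m)"
    unfolding of_nat_sum[symmetric] choose_row_sum by simp
  finally show ?thesis .
qed

text \<open>
  The Laguerre differential equation, with derivatives expressed through neighbouring indices.
  It is the only property of Laguerre polynomials behind the Laplacian of the kernel.
\<close>
lemma complex_laguerre_recurrence:
  "of_nat (Suc m) * complex_laguerre a (Suc m) x = of_nat (Suc a) * complex_laguerre (Suc a) m x - x * complex_laguerre (a + 2) m x"
proof -
  define N where "N = a + Suc m"
  have coeff: "Suc m * (N choose (Suc m - i))
     = Suc a * (if i \<le> m then N choose (m - i) else 0) + i * (Suc N choose (Suc m - i))" if "i \<le> Suc m" for i
  proof (cases "i = Suc m")
    case False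
    then have i: "i \<le> m" using that by simp
    have r: "Suc m - i = Suc (m - i)" using i by simp
    have "Suc (m - i) * (N choose Suc (m - i)) = (N - (m - i)) * (N choose (m - i))"
      unfolding binomial_absorb_comp binomial_absorption ..
    moreover have "N - (m - i) = Suc a + i" using i by (simp add: N_def)
    moreover have "Suc m = Suc (m - i) + i" using i by simp
    ultimately show ?thesis using i unfolding r
      by (simp only: binomial_Suc_Suc add_mult_distrib add_mult_distrib2 if_True)
  qed simp
  have A: "of_nat (Suc m) * complex_laguerre a (Suc m) x
     = (\<Sum>i\<le>Suc m. (-1) ^ i * x ^ i / fact i * of_nat (Suc m * (N choose (Suc m - i))))"
    unfolding complex_laguerre_def sum_distrib_left N_def
    by (intro sum.cong refl) (simp only: of_nat_mult divide_inverse mult_ac)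
  have "(\<Sum>i\<le>Suc m. (-1) ^ i * x ^ i / fact i * of_nat (Suc a * (if i \<le> m then N choose (m - i) else 0)))
      = (\<Sum>i\<le>m. (-1) ^ i * x ^ i / fact i * of_nat (Suc a * (N choose (m - i))))"
    by (simp del: of_nat_Suc)
  also have "\<dots> = of_nat (Suc a) * complex_laguerre (Suc a) m x"
    unfolding complex_laguerre_def sum_distrib_left N_def add_Suc add_Suc_right
    by (intro sum.cong refl) (simp only: of_nat_mult divide_inverse mult_ac)
  finally have B: "of_nat (Suc a) * complex_laguerre (Suc a) m x
     = (\<Sum>i\<le>Suc m. (-1) ^ i * x ^ i / fact i * of_nat (Suc a * (if i \<le> m then N choose (m - i) else 0)))" ..
  have "(\<Sum>i\<le>Suc m. (-1) ^ i * x ^ i / fact i * of_nat (i * (Suc N choose (Suc m - i))))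
      = (\<Sum>i\<le>m. (-1) ^ Suc i * x ^ Suc i / fact (Suc i) * of_nat (Suc i * (Suc N choose (m - i))))"
    unfolding sum.atMost_Suc_shift by simp
  also have "\<dots> = (\<Sum>i\<le>m. - (x * ((-1) ^ i * of_nat (Suc N choose (m - i)) * x ^ i / fact i)))"
  proof (rule sum.cong[OF refl])
    fix i
    have "(-1) ^ Suc i * x ^ Suc i / fact (Suc i) * of_nat (Suc i * (Suc N choose (m - i)))
        = (-1) ^ Suc i * x ^ Suc i * of_nat (Suc N choose (m - i)) * (of_nat (Suc i) / (of_nat (Suc i) * fact i))"
      by (simp only: of_nat_mult divide_inverse mult_ac fact_Suc)
    also have "of_nat (Suc i) / (of_nat (Suc i) * fact i) = (1 / fact i :: complex)"
      using of_nat_neq_0[of i, where 'a=complex] by (simp del: of_nat_Suc)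
    finally show "(-1) ^ Suc i * x ^ Suc i / fact (Suc i) * of_nat (Suc i * (Suc N choose (m - i)))
        = - (x * ((-1) ^ i * of_nat (Suc N choose (m - i)) * x ^ i / fact i))"
      by simp
  qed
  also have "\<dots> = - (x * complex_laguerre (a + 2) m x)"
    unfolding complex_laguerre_def sum_distrib_left N_def sum_negf by simp
  finally have C: "- (x * complex_laguerre (a + 2) m x)
     = (\<Sum>i\<le>Suc m. (-1) ^ i * x ^ i / fact i * of_nat (i * (Suc N choose (Suc m - i))))" ..
  have "of_nat (Suc m) * complex_laguerre a (Suc m) x = of_nat (Suc a) * complex_laguerre (Suc a) m x + - (x * complex_laguerre (a + 2) m x)"
    unfolding A B C sum.distrib[symmetric]
  proof (rule sum.cong[OF refl])
    fix i assume "i \<in> {..Suc m}"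
    then have "Suc m * (N choose (Suc m - i))
      = Suc a * (if i \<le> m then N choose (m - i) else 0) + i * (Suc N choose (Suc m - i))"
      by (intro coeff) simp
    then show "(-1) ^ i * x ^ i / fact i * of_nat (Suc m * (N choose (Suc m - i)))
       = (-1) ^ i * x ^ i / fact i * of_nat (Suc a * (if i \<le> m then N choose (m - i) else 0))
       + (-1) ^ i * x ^ i / fact i * of_nat (i * (Suc N choose (Suc m - i)))"
      by (simp only: of_nat_add distrib_left)
  qed
  then show ?thesis by simp
qed

section \<open>The Laplacian on polynomials in the coordinates and their conjugates\<close>

lemma sum_Basis_cvec:
  fixes g :: "complex^'n \<Rightarrow> 'b::comm_monoid_add"
  shows "(\<Sum>b\<in>Basis. g b) = (\<Sum>j\<in>UNIV. g (axis j 1) + g (axis j \<i>))"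
proof -
  have B: "(Basis :: (complex^'n) set) = (\<Union>j\<in>UNIV. {axis j 1, axis j \<i>})"
    by (auto simp: Basis_vec_def Basis_complex_def)
  show ?thesis
    unfolding B by (subst sum.UNION_disjoint) (auto simp: axis_eq_axis)
qed

lemma herm_axis [simp]:
  "herm (axis j c) w = c * cnj (w $ j)" "herm w (axis j c) = w $ j * cnj c"
  by (simp_all add: herm_def axis_def if_distrib if_distribR cong: if_cong)

lemma cnj_herm: "cnj (herm z w) = herm w z"
  by (simp add: herm_def mult.commute)

lemma herm_self: "herm z z = of_real ((norm z)\<^sup>2)"
proof -
  have "(norm z)\<^sup>2 = (\<Sum>j\<in>UNIV. (norm (z $ j))\<^sup>2)"
    by (simp add: power2_norm_eq_inner inner_vec_def)
  then show ?thesis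
    unfolding herm_def by (simp add: complex_norm_square[symmetric])
qed

lemma herm_add_left: "herm (x + y) w = herm x w + herm y w"
  by (simp add: herm_def algebra_simps sum.distrib)

lemma herm_add_right: "herm w (x + y) = herm w x + herm w y"
  by (simp add: herm_def algebra_simps sum.distrib)

lemma herm_scaleR_left: "herm (t *\<^sub>R x) w = of_real t * herm x w"
  by (simp add: herm_def sum_distrib_left scaleR_conv_of_real[where 'a=complex] mult_ac)

lemma herm_scaleR_right: "herm w (t *\<^sub>R x) = of_real t * herm w x"
  by (simp add: herm_def sum_distrib_left scaleR_conv_of_real[where 'a=complex] mult_ac)

text \<open>
  Polynomials in the coordinates and their conjugates, described only by their closure properties. On
  this class \<open>partial_deriv\<close> is an honest derivative and can be iterated, so that the usual rules hold
  for it and for the Laplacian.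
\<close>
inductive cpoly :: "(complex^'n \<Rightarrow> complex) \<Rightarrow> bool" where
  cpoly_const: "cpoly (\<lambda>z. c)"
| cpoly_coord: "cpoly (\<lambda>z. z $ j)"
| cpoly_cnj_coord: "cpoly (\<lambda>z. cnj (z $ j))"
| cpoly_add: "cpoly f \<Longrightarrow> cpoly g \<Longrightarrow> cpoly (\<lambda>z. f z + g z)"
| cpoly_mult: "cpoly f \<Longrightarrow> cpoly g \<Longrightarrow> cpoly (\<lambda>z. f z * g z)"

lemma cpoly_sum: "(\<And>i. i \<in> I \<Longrightarrow> cpoly (f i)) \<Longrightarrow> cpoly (\<lambda>z. \<Sum>i\<in>I. f i z)"
  by (induction I rule: infinite_finite_induct) (auto intro: cpoly.intros)

lemma cpoly_prod: "(\<And>i. i \<in> I \<Longrightarrow> cpoly (f i)) \<Longrightarrow> cpoly (\<lambda>z. \<Prod>i\<in>I. f i z)"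
  by (induction I rule: infinite_finite_induct) (auto intro: cpoly.intros)

lemma cpoly_power: "cpoly f \<Longrightarrow> cpoly (\<lambda>z. f z ^ k)"
  by (induction k) (auto intro: cpoly.intros)

lemma cpoly_herm: "cpoly (\<lambda>z. herm z w)" "cpoly (\<lambda>z. herm w z)" "cpoly (\<lambda>z. herm z z)"
  unfolding herm_def by (intro cpoly_sum cpoly.intros)+

lemmas cpoly_intros = cpoly.intros cpoly_sum cpoly_prod cpoly_power cpoly_herm

lemma partial_deriv_eqI:
  "((\<lambda>t. f (z + t *\<^sub>R b)) has_vector_derivative D) (at 0) \<Longrightarrow> partial_deriv b f z = D"
  unfolding partial_deriv_def by (rule vector_derivative_at)

lemma cpoly_has_derivative_ex:
  assumes "cpoly f"
  shows "\<exists>f'. cpoly f' \<and> (\<forall>z. ((\<lambda>t. f (z + t *\<^sub>R b)) has_vector_derivative f' z) (at 0))"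
  using assms
proof induction
  case (cpoly_const c)
  show ?case by (intro exI[of _ "\<lambda>z. 0"]) (auto intro: cpoly.intros)
next
  case (cpoly_coord j)
  show ?case
    by (intro exI[of _ "\<lambda>z. b $ j"] conjI cpoly.intros allI)
       (auto intro!: derivative_eq_intros)
next
  case (cpoly_cnj_coord j)
  show ?case
    by (intro exI[of _ "\<lambda>z. cnj (b $ j)"] conjI cpoly.intros allI)
       (auto intro!: derivative_eq_intros)
next
  case (cpoly_add f g)
  then obtain f' g' where "cpoly f'" "cpoly g'"
    "\<And>z. ((\<lambda>t. f (z + t *\<^sub>R b)) has_vector_derivative f' z) (at 0)"
    "\<And>z. ((\<lambda>t. g (z + t *\<^sub>R b)) has_vector_derivative g' z) (at 0)" by blast
  then show ?case
    by (intro exI[of _ "\<lambda>z. f' z + g' z"] conjI cpoly.intros allI has_vector_derivative_add) auto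
next
  case (cpoly_mult f g)
  then obtain f' g' where "cpoly f'" "cpoly g'"
    and d: "\<And>z. ((\<lambda>t. f (z + t *\<^sub>R b)) has_vector_derivative f' z) (at 0)"
    "\<And>z. ((\<lambda>t. g (z + t *\<^sub>R b)) has_vector_derivative g' z) (at 0)" by blast
  then show ?case
    using cpoly_mult.hyps has_vector_derivative_mult[OF d]
    by (intro exI[of _ "\<lambda>z. f z * g' z + f' z * g z"] conjI cpoly.intros allI) auto
qed

lemma has_partial_deriv:
  "cpoly f \<Longrightarrow> ((\<lambda>t. f (z + t *\<^sub>R b)) has_vector_derivative partial_deriv b f z) (at 0)"
  using cpoly_has_derivative_ex[of f b] partial_deriv_eqI by metis

lemma cpoly_partial_deriv: "cpoly f \<Longrightarrow> cpoly (partial_deriv b f)"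
proof -
  assume "cpoly f"
  then obtain f' where "cpoly f'" "\<And>z. ((\<lambda>t. f (z + t *\<^sub>R b)) has_vector_derivative f' z) (at 0)"
    using cpoly_has_derivative_ex by blast
  moreover from this have "partial_deriv b f = f'" by (intro ext partial_deriv_eqI)
  ultimately show ?thesis by simp
qed

lemma partial_deriv_const [simp]: "partial_deriv b (\<lambda>z. c) = (\<lambda>z. 0)"
  by (intro ext partial_deriv_eqI) auto

lemma partial_deriv_coord [simp]: "partial_deriv b (\<lambda>z. z $ j) = (\<lambda>z. b $ j)"
  by (intro ext partial_deriv_eqI) (auto intro!: derivative_eq_intros)

lemma partial_deriv_cnj_coord [simp]: "partial_deriv b (\<lambda>z. cnj (z $ j)) = (\<lambda>z. cnj (b $ j))"
  by (intro ext partial_deriv_eqI) (auto intro!: derivative_eq_intros)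

lemma partial_deriv_add:
  "cpoly f \<Longrightarrow> cpoly g \<Longrightarrow> partial_deriv b (\<lambda>z. f z + g z) = (\<lambda>z. partial_deriv b f z + partial_deriv b g z)"
  by (intro ext partial_deriv_eqI has_vector_derivative_add has_partial_deriv)

lemma partial_deriv_mult:
  "cpoly f \<Longrightarrow> cpoly g \<Longrightarrow>
     partial_deriv b (\<lambda>z. f z * g z) = (\<lambda>z. f z * partial_deriv b g z + partial_deriv b f z * g z)"
  using has_vector_derivative_mult[OF has_partial_deriv has_partial_deriv, of f g]
  by (intro ext partial_deriv_eqI) auto

lemma partial_deriv_herm:
  "partial_deriv b (\<lambda>z. herm z w) = (\<lambda>z. herm b w)"
  "partial_deriv b (\<lambda>z. herm w z) = (\<lambda>z. herm w b)"
  "partial_deriv b (\<lambda>z. herm z z) = (\<lambda>z. herm b z + herm z b)"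
proof -
  have o: "((\<lambda>t. of_real t :: complex) has_vector_derivative 1) (at 0)"
    using has_vector_derivative_of_real[OF DERIV_ident] by simp
  show "partial_deriv b (\<lambda>z. herm z w) = (\<lambda>z. herm b w)"
    unfolding herm_add_left herm_scaleR_left
    by (intro ext partial_deriv_eqI) (auto simp: herm_add_left herm_scaleR_left intro!: derivative_eq_intros o)
  show "partial_deriv b (\<lambda>z. herm w z) = (\<lambda>z. herm w b)"
    by (intro ext partial_deriv_eqI) (auto simp: herm_add_right herm_scaleR_right intro!: derivative_eq_intros o)
  show "partial_deriv b (\<lambda>z. herm z z) = (\<lambda>z. herm b z + herm z b)"
    by (intro ext partial_deriv_eqI)
       (auto simp: herm_add_right herm_scaleR_right herm_add_left herm_scaleR_left intro!: derivative_eq_intros o)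
qed

text \<open>
  The bilinear form measuring by how much the Laplacian fails to be a derivation; it is a derivation
  in each argument, so Laplacians of products reduce to its values on a few generators.
\<close>
definition grad_prod :: "(complex^'n \<Rightarrow> complex) \<Rightarrow> (complex^'n \<Rightarrow> complex) \<Rightarrow> complex^'n \<Rightarrow> complex" where
  "grad_prod f g z = (\<Sum>b\<in>Basis. partial_deriv b f z * partial_deriv b g z)"

lemma grad_prod_commute: "grad_prod f g z = grad_prod g f z"
  by (simp add: grad_prod_def mult.commute)

lemma grad_prod_const_right [simp]: "grad_prod f (\<lambda>z. c) z = 0"
  by (simp add: grad_prod_def)

lemma grad_prod_add_right:
  "cpoly g \<Longrightarrow> cpoly h \<Longrightarrow> grad_prod f (\<lambda>z. g z + h z) z = grad_prod f g z + grad_prod f h z"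
  by (simp add: grad_prod_def partial_deriv_add algebra_simps sum.distrib)

lemma grad_prod_mult_right:
  "cpoly g \<Longrightarrow> cpoly h \<Longrightarrow>
     grad_prod f (\<lambda>z. g z * h z) z = g z * grad_prod f h z + grad_prod f g z * h z"
  by (simp add: grad_prod_def partial_deriv_mult algebra_simps sum.distrib sum_distrib_left sum_distrib_right)

lemma grad_prod_power_right:
  "cpoly g \<Longrightarrow> grad_prod f (\<lambda>z. g z ^ k) z = of_nat k * g z ^ (k - 1) * grad_prod f g z"
proof (induction k)
  case (Suc k)
  have "grad_prod f (\<lambda>z. g z ^ Suc k) z = g z * grad_prod f (\<lambda>z. g z ^ k) z + grad_prod f g z * g z ^ k"
    using Suc.prems by (simp add: grad_prod_mult_right cpoly_power)
  then show ?case
    unfolding Suc.IH[OF Suc.prems] by (cases k) (simp_all add: algebra_simps)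
qed simp

lemma grad_prod_power_left:
  "cpoly f \<Longrightarrow> grad_prod (\<lambda>z. f z ^ k) g z = of_nat k * f z ^ (k - 1) * grad_prod f g z"
  using grad_prod_power_right[of f g k z] by (simp add: grad_prod_commute)

lemma laplacian_const [simp]: "laplacian (\<lambda>z::complex^'n. c) z = 0"
  by (simp add: laplacian_def)

lemma laplacian_add:
  "cpoly f \<Longrightarrow> cpoly g \<Longrightarrow> laplacian (\<lambda>z. f z + g z) z = laplacian f z + laplacian g z"
  by (simp add: laplacian_def partial_deriv_add cpoly_partial_deriv sum.distrib)

lemma laplacian_mult:
  "cpoly f \<Longrightarrow> cpoly g \<Longrightarrow>
     laplacian (\<lambda>z. f z * g z) z = f z * laplacian g z + laplacian f z * g z + 2 * grad_prod f g z"
  by (simp add: laplacian_def grad_prod_def partial_deriv_mult partial_deriv_add cpoly_partial_deriv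
      cpoly_mult algebra_simps sum.distrib sum_distrib_left sum_distrib_right)

lemma laplacian_cmult: "cpoly f \<Longrightarrow> laplacian (\<lambda>z. c * f z) z = c * laplacian f z"
  using laplacian_mult[of "\<lambda>z. c" f z] by (simp add: cpoly_const grad_prod_commute)

lemma laplacian_sum:
  assumes "\<And>i. i \<in> I \<Longrightarrow> cpoly (f i)"
  shows "laplacian (\<lambda>z. \<Sum>i\<in>I. f i z) z = (\<Sum>i\<in>I. laplacian (f i) z)"
  using assms
  by (induction I rule: infinite_finite_induct) (simp_all add: laplacian_add cpoly_sum)

lemma laplacian_power:
  assumes "cpoly f"
  shows "laplacian (\<lambda>z. f z ^ k) z
    = of_nat k * f z ^ (k - 1) * laplacian f z + of_nat (k * (k - 1)) * f z ^ (k - 2) * grad_prod f f z"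
proof (induction k)
  case (Suc k)
  have "laplacian (\<lambda>z. f z ^ Suc k) z
      = f z * laplacian (\<lambda>z. f z ^ k) z + laplacian f z * f z ^ k + 2 * grad_prod f (\<lambda>z. f z ^ k) z"
    using assms by (simp add: laplacian_mult cpoly_power)
  also have "\<dots> = of_nat (Suc k) * f z ^ (Suc k - 1) * laplacian f z
      + of_nat (Suc k * (Suc k - 1)) * f z ^ (Suc k - 2) * grad_prod f f z"
    unfolding Suc.IH grad_prod_power_right[OF assms]
    by (cases k; cases "k - 1") (simp_all add: algebra_simps)
  finally show ?case .
qed simp

lemma laplacian_herm [simp]:
  "laplacian (\<lambda>z. herm z w) z = 0" "laplacian (\<lambda>z. herm w z) z = 0"
  by (simp_all add: laplacian_def partial_deriv_herm)

lemma laplacian_herm_self: "laplacian (\<lambda>z::complex^'n. herm z z) z = of_nat (4 * CARD('n))"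
proof -
  have "partial_deriv b (\<lambda>z. herm b z + herm z b) z = 2 * herm b b" for b :: "complex^'n"
    by (subst partial_deriv_add) (auto simp: partial_deriv_herm cpoly_intros)
  then show ?thesis
    by (simp add: laplacian_def partial_deriv_herm sum_Basis_cvec sum.distrib)
qed

lemma grad_prod_herm:
  "grad_prod (\<lambda>z. herm z w) (\<lambda>z. herm z w) z = 0"
  "grad_prod (\<lambda>z. herm w z) (\<lambda>z. herm w z) z = 0"
  "grad_prod (\<lambda>z. herm z w) (\<lambda>z. herm w z) z = 2 * herm w w"
  by (simp_all add: grad_prod_def partial_deriv_herm sum_Basis_cvec)
     (simp_all add: herm_def sum_distrib_left algebra_simps)

text \<open>
  Homogeneity in the form in which it enters the Laplacian of \<open>\<rho>^j * g\<close>: the form \<open>grad_prod\<close> with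
  \<open>\<rho> = |z|\<^sup>2\<close> is twice the Euler vector field.
\<close>
definition euler_hom :: "nat \<Rightarrow> (complex^'n \<Rightarrow> complex) \<Rightarrow> bool" where
  "euler_hom d g \<longleftrightarrow> cpoly g \<and> (\<forall>z. grad_prod (\<lambda>z. herm z z) g z = of_nat (2 * d) * g z)"

lemma euler_hom_coord: "euler_hom 1 (\<lambda>z. z $ j)" "euler_hom 1 (\<lambda>z. cnj (z $ j))"
proof -
  have ax: "axis i c $ j = (if i = j then c else 0)" for i and c :: complex
    by (simp add: axis_def)
  show "euler_hom 1 (\<lambda>z. z $ j)" "euler_hom 1 (\<lambda>z. cnj (z $ j))"
    by (simp_all add: euler_hom_def cpoly.intros grad_prod_def partial_deriv_herm sum_Basis_cvec ax
        if_distrib if_distribR algebra_simps sum.distrib sum_subtractf cong: if_cong)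
qed

lemma euler_hom_const: "euler_hom 0 (\<lambda>z. c)"
  by (simp add: euler_hom_def cpoly.intros)

lemma euler_hom_mult: "euler_hom d f \<Longrightarrow> euler_hom e g \<Longrightarrow> euler_hom (d + e) (\<lambda>z. f z * g z)"
  by (simp add: euler_hom_def cpoly.intros grad_prod_mult_right algebra_simps)

lemma euler_hom_cmult: "euler_hom d f \<Longrightarrow> euler_hom d (\<lambda>z. c * f z)"
  using euler_hom_mult[OF euler_hom_const] by fastforce

lemma euler_hom_add: "euler_hom d f \<Longrightarrow> euler_hom d g \<Longrightarrow> euler_hom d (\<lambda>z. f z + g z)"
  by (simp add: euler_hom_def cpoly.intros grad_prod_add_right algebra_simps)

lemma euler_hom_zero: "euler_hom d (\<lambda>z. 0)"
  by (simp add: euler_hom_def cpoly.intros)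

lemma euler_hom_sum: "(\<And>i. i \<in> I \<Longrightarrow> euler_hom d (f i)) \<Longrightarrow> euler_hom d (\<lambda>z. \<Sum>i\<in>I. f i z)"
  by (induction I rule: infinite_finite_induct) (auto intro: euler_hom_zero euler_hom_add)

lemma euler_hom_prod:
  "finite I \<Longrightarrow> (\<And>i. i \<in> I \<Longrightarrow> euler_hom (d i) (f i)) \<Longrightarrow> euler_hom (\<Sum>i\<in>I. d i) (\<lambda>z. \<Prod>i\<in>I. f i z)"
  by (induction I rule: finite_induct) (auto intro: euler_hom_const euler_hom_mult)

lemma euler_hom_power: "euler_hom d f \<Longrightarrow> euler_hom (k * d) (\<lambda>z. f z ^ k)"
  by (induction k) (auto intro: euler_hom_const euler_hom_mult)

lemma euler_hom_herm: "euler_hom 1 (\<lambda>z. herm z w)" "euler_hom 1 (\<lambda>z. herm w z)"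
  unfolding herm_def
  by (intro euler_hom_sum euler_hom_cmult euler_hom_coord,
      subst mult.commute, intro euler_hom_cmult euler_hom_coord)
     (intro euler_hom_sum euler_hom_cmult euler_hom_coord)

text \<open>
  The factor in \<open>u\<close> is holomorphic and the factor in \<open>v\<close> is antiholomorphic, so only the mixed term of the
  Laplacian survives.
\<close>
lemma laplacian_herm_powers:
  "laplacian (\<lambda>z. herm z w ^ a * herm w z ^ b) z
     = 4 * of_nat (a * b) * herm w w * herm z w ^ (a - 1) * herm w z ^ (b - 1)"
  by (subst laplacian_mult)
     (simp_all add: cpoly_intros laplacian_power grad_prod_herm grad_prod_power_left grad_prod_power_right)

lemma laplacian_norm_power_mult:
  fixes g :: "complex^'n \<Rightarrow> complex"
  assumes "euler_hom d g"
  shows "laplacian (\<lambda>z. herm z z ^ j * g z) z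
     = 4 * of_nat (j * (CARD('n) + d + j - 1)) * herm z z ^ (j - 1) * g z + herm z z ^ j * laplacian g z"
proof -
  have g: "cpoly g" and e: "grad_prod (\<lambda>z. herm z z) g z = of_nat (2 * d) * g z"
    using assms by (auto simp: euler_hom_def)
  have ee: "grad_prod (\<lambda>z::complex^'n. herm z z) (\<lambda>z. herm z z) z = 4 * herm z z"
  proof -
    have "(cnj x + x) * (cnj x + x) + (\<i> * cnj x - x * \<i>) * (\<i> * cnj x - x * \<i>) = 4 * (x * cnj x)" for x
      by (simp add: complex_eq_iff)
    then show ?thesis
      unfolding grad_prod_def partial_deriv_herm sum_Basis_cvec herm_axis
      by (simp add: herm_def sum_distrib_left)
  qed
  define R where "R = herm z z"
  have "laplacian (\<lambda>z. herm z z ^ j * g z) z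
      = R ^ j * laplacian g z + laplacian (\<lambda>z. herm z z ^ j) z * g z
        + 2 * grad_prod (\<lambda>z. herm z z ^ j) g z"
    unfolding R_def by (rule laplacian_mult) (intro cpoly_intros g)+
  also have "laplacian (\<lambda>z. herm z z ^ j) z
      = of_nat j * R ^ (j - 1) * of_nat (4 * CARD('n)) + of_nat (j * (j - 1)) * R ^ (j - 2) * (4 * R)"
    unfolding R_def laplacian_power[OF cpoly_herm(3)] laplacian_herm_self ee ..
  also have "grad_prod (\<lambda>z. herm z z ^ j) g z = of_nat j * R ^ (j - 1) * (of_nat (2 * d) * g z)"
    unfolding R_def grad_prod_power_left[OF cpoly_herm(3)] e ..
  finally have L: "laplacian (\<lambda>z. herm z z ^ j * g z) z = R ^ j * laplacian g z
      + (of_nat j * R ^ (j - 1) * of_nat (4 * CARD('n)) + of_nat (j * (j - 1)) * R ^ (j - 2) * (4 * R)) * g z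
      + 2 * (of_nat j * R ^ (j - 1) * (of_nat (2 * d) * g z))" .
  show ?thesis
  proof (cases j)
    case (Suc i)
    then show ?thesis
      unfolding L R_def[symmetric] by (cases i) (simp_all add: algebra_simps)
  qed simp
qed

section \<open>Bihomogeneous polynomials depending on a parameter\<close>

definition bi_exponents :: "nat \<Rightarrow> nat \<Rightarrow> (('n::finite \<Rightarrow> nat) \<times> ('n \<Rightarrow> nat)) set" where
  "bi_exponents p q = exponents_of_degree p \<times> exponents_of_degree q"

definition bi_monomial :: "('n::finite \<Rightarrow> nat) \<times> ('n \<Rightarrow> nat) \<Rightarrow> complex^'n \<Rightarrow> complex" where
  "bi_monomial x z = (\<Prod>j\<in>UNIV. (z $ j) ^ fst x j) * (\<Prod>j\<in>UNIV. cnj (z $ j) ^ snd x j)"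

lemma finite_exponents_of_degree [simp]: "finite (exponents_of_degree p :: ('n::finite \<Rightarrow> nat) set)"
proof (rule finite_subset)
  show "(exponents_of_degree p :: ('n \<Rightarrow> nat) set) \<subseteq> PiE UNIV (\<lambda>_. {..p})"
    unfolding exponents_of_degree_def by (auto intro!: member_le_sum)
qed (auto intro: finite_PiE)

lemma finite_bi_exponents [simp]: "finite (bi_exponents p q)"
  by (simp add: bi_exponents_def)

lemma bi_monomial_mult:
  "bi_monomial x z * bi_monomial y z = bi_monomial (\<lambda>j. fst x j + fst y j, \<lambda>j. snd x j + snd y j) z"
  by (simp add: bi_monomial_def power_add prod.distrib)

lemma cpoly_bi_monomial: "cpoly (bi_monomial x)"
  unfolding bi_monomial_def by (intro cpoly_intros)

lemma euler_hom_bi_monomial: "x \<in> bi_exponents p q \<Longrightarrow> euler_hom (p + q) (bi_monomial x)"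
proof -
  assume "x \<in> bi_exponents p q"
  then have x: "(\<Sum>j\<in>UNIV. fst x j * 1) = p" "(\<Sum>j\<in>UNIV. snd x j * 1) = q"
    by (auto simp: bi_exponents_def exponents_of_degree_def)
  show ?thesis
    unfolding bi_monomial_def x[symmetric]
    by (intro euler_hom_mult euler_hom_prod euler_hom_power euler_hom_coord) auto
qed

lemma norm_bi_monomial_le:
  assumes "x \<in> bi_exponents p q" and "\<And>j. norm (z $ j) \<le> R"
  shows "norm (bi_monomial x z) \<le> R ^ (p + q)"
proof -
  have x: "(\<Sum>j\<in>UNIV. fst x j) = p" "(\<Sum>j\<in>UNIV. snd x j) = q"
    using assms(1) by (auto simp: bi_exponents_def exponents_of_degree_def)
  have "(\<Prod>j\<in>UNIV. norm (z $ j) ^ e j) \<le> R ^ (\<Sum>j\<in>UNIV. e j)" for e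
    unfolding power_sum by (intro prod_mono conjI power_mono assms zero_le_power norm_ge_zero)
  note b = this
  have "0 \<le> R" using assms(2) norm_ge_zero order_trans by blast
  then show ?thesis
    unfolding bi_monomial_def norm_mult prod_norm[symmetric] norm_power complex_mod_cnj power_add
    using b[of "fst x"] b[of "snd x"] by (intro mult_mono) (auto simp: x intro!: prod_nonneg)
qed

text \<open>
  A function of \<open>z\<close> that is a polynomial of bidegree \<open>(p, q)\<close> for every value of the parameter \<open>w\<close>, with
  coefficients measurable in \<open>w\<close> and bounded by \<open>N w\<close> in the sum norm. The bound is part of the notion
  because it is what controls integration in \<open>w\<close>, summation over \<open>q\<close> and re-expansion at other points.
\<close>
definition bihom_kernel ::
  "nat \<Rightarrow> nat \<Rightarrow> (complex^'n \<Rightarrow> 'b::topological_space \<Rightarrow> complex) \<Rightarrow> ('b \<Rightarrow> real) \<Rightarrow> bool" where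
  "bihom_kernel p q H N \<longleftrightarrow> (\<exists>c. (\<forall>x. c x \<in> borel_measurable borel)
     \<and> (\<forall>w. (\<Sum>x\<in>bi_exponents p q. norm (c x w)) \<le> N w)
     \<and> (\<forall>z w. H z w = (\<Sum>x\<in>bi_exponents p q. c x w * bi_monomial x z)))"

text \<open>
  A single polynomial is a kernel that is constant in a dummy parameter, so that it inherits the
  closure properties below.
\<close>
abbreviation bihom :: "nat \<Rightarrow> nat \<Rightarrow> (complex^'n \<Rightarrow> complex) \<Rightarrow> real \<Rightarrow> bool" where
  "bihom p q P M \<equiv> bihom_kernel p q (\<lambda>z (_::real). P z) (\<lambda>_. M)"

lemma bihom_kernelE:
  assumes "bihom_kernel p q H N"
  obtains c where "\<And>x. c x \<in> borel_measurable borel"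
    and "\<And>w. (\<Sum>x\<in>bi_exponents p q. norm (c x w)) \<le> N w"
    and "\<And>z w. H z w = (\<Sum>x\<in>bi_exponents p q. c x w * bi_monomial x z)"
  using assms unfolding bihom_kernel_def by auto

lemma bihom_kernel_nonneg:
  assumes "bihom_kernel p q H N" shows "0 \<le> N w"
proof -
  obtain c where "\<And>x. c x \<in> borel_measurable borel"
    and n: "\<And>w. (\<Sum>x\<in>bi_exponents p q. norm (c x w)) \<le> N w"
    and "\<And>z w. H z w = (\<Sum>x\<in>bi_exponents p q. c x w * bi_monomial x z)"
    by (rule bihom_kernelE[OF assms]) blast
  show ?thesis by (rule order_trans[OF _ n]) (intro sum_nonneg norm_ge_zero)
qed

lemma bihom_kernel_mono:
  assumes "bihom_kernel p q H N" "\<And>w. N w \<le> N' w" shows "bihom_kernel p q H N'"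
proof -
  from assms(1) obtain c where "\<And>x. c x \<in> borel_measurable borel"
    and "\<And>w. (\<Sum>x\<in>bi_exponents p q. norm (c x w)) \<le> N w"
    and "\<And>z w. H z w = (\<Sum>x\<in>bi_exponents p q. c x w * bi_monomial x z)"
    by (rule bihom_kernelE) blast
  then show ?thesis
    unfolding bihom_kernel_def by (intro exI[of _ c] conjI allI order_trans[OF _ assms(2)]) auto
qed

lemma bihom_kernel_add:
  assumes "bihom_kernel p q H N" "bihom_kernel p q H' N'"
  shows "bihom_kernel p q (\<lambda>z w. H z w + H' z w) (\<lambda>w. N w + N' w)"
proof -
  obtain c where [measurable]: "\<And>x. c x \<in> borel_measurable borel"
    and n: "\<And>w. (\<Sum>x\<in>bi_exponents p q. norm (c x w)) \<le> N w"
    and e: "\<And>z w. H z w = (\<Sum>x\<in>bi_exponents p q. c x w * bi_monomial x z)"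
    by (rule bihom_kernelE[OF assms(1)]) blast
  obtain c' where [measurable]: "\<And>x. c' x \<in> borel_measurable borel"
    and n': "\<And>w. (\<Sum>x\<in>bi_exponents p q. norm (c' x w)) \<le> N' w"
    and e': "\<And>z w. H' z w = (\<Sum>x\<in>bi_exponents p q. c' x w * bi_monomial x z)"
    by (rule bihom_kernelE[OF assms(2)]) blast
  have "(\<Sum>x\<in>bi_exponents p q. norm (c x w + c' x w)) \<le> N w + N' w" for w
  proof -
    have "(\<Sum>x\<in>bi_exponents p q. norm (c x w + c' x w)) \<le> (\<Sum>x\<in>bi_exponents p q. norm (c x w) + norm (c' x w))"
      by (intro sum_mono norm_triangle_ineq)
    then show ?thesis using n[of w] n'[of w] by (simp add: sum.distrib)
  qed
  then show ?thesis
    unfolding bihom_kernel_def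
    by (intro exI[of _ "\<lambda>x w. c x w + c' x w"]) (auto simp: e e' sum.distrib algebra_simps)
qed

lemma bihom_kernel_cmult:
  assumes "bihom_kernel p q H N" "g \<in> borel_measurable borel"
  shows "bihom_kernel p q (\<lambda>z w. g w * H z w) (\<lambda>w. norm (g w) * N w)"
proof -
  obtain c where [measurable]: "\<And>x. c x \<in> borel_measurable borel"
    and n: "\<And>w. (\<Sum>x\<in>bi_exponents p q. norm (c x w)) \<le> N w"
    and e: "\<And>z w. H z w = (\<Sum>x\<in>bi_exponents p q. c x w * bi_monomial x z)"
    by (rule bihom_kernelE[OF assms(1)]) blast
  note [measurable] = assms(2)
  show ?thesis
    unfolding bihom_kernel_def
  proof (intro exI[of _ "\<lambda>x w. g w * c x w"] conjI allI)
    show "(\<Sum>x\<in>bi_exponents p q. norm (g w * c x w)) \<le> norm (g w) * N w" for w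
      unfolding norm_mult sum_distrib_left[symmetric] by (intro mult_left_mono n) auto
  qed (simp_all add: e sum_distrib_left mult.assoc)
qed

lemma bihom_kernel_zero: "bihom_kernel p q (\<lambda>z w. 0) (\<lambda>w. 0)"
  unfolding bihom_kernel_def by (intro exI[of _ "\<lambda>x w. 0"]) auto

lemma bihom_kernel_sum:
  "(\<And>i. i \<in> I \<Longrightarrow> bihom_kernel p q (H i) (N i)) \<Longrightarrow>
     bihom_kernel p q (\<lambda>z w. \<Sum>i\<in>I. H i z w) (\<lambda>w. \<Sum>i\<in>I. N i w)"
  by (induction I rule: infinite_finite_induct) (auto intro: bihom_kernel_zero bihom_kernel_add)

text \<open>
  The coefficients of a product are finite convolutions, and the sum norm is submultiplicative
  under convolution.
\<close>
lemma bihom_kernel_mult: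
  assumes "bihom_kernel p q H N" "bihom_kernel p' q' H' N'"
  shows "bihom_kernel (p + p') (q + q') (\<lambda>z w. H z w * H' z w) (\<lambda>w. N w * N' w)"
proof -
  let ?E = "bi_exponents p q :: (('a \<Rightarrow> nat) \<times> ('a \<Rightarrow> nat)) set"
  let ?E' = "bi_exponents p' q' :: (('a \<Rightarrow> nat) \<times> ('a \<Rightarrow> nat)) set"
  let ?T = "bi_exponents (p + p') (q + q') :: (('a \<Rightarrow> nat) \<times> ('a \<Rightarrow> nat)) set"
  define S where "S = ?E \<times> ?E'"
  define g :: "(('a \<Rightarrow> nat) \<times> ('a \<Rightarrow> nat)) \<times> (('a \<Rightarrow> nat) \<times> ('a \<Rightarrow> nat)) \<Rightarrow> _"
    where "g = (\<lambda>(x, y). (\<lambda>j. fst x j + fst y j, \<lambda>j. snd x j + snd y j))"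
  obtain c where [measurable]: "\<And>x. c x \<in> borel_measurable borel"
    and n: "\<And>w. (\<Sum>x\<in>?E. norm (c x w)) \<le> N w"
    and e: "\<And>z w. H z w = (\<Sum>x\<in>?E. c x w * bi_monomial x z)"
    by (rule bihom_kernelE[OF assms(1)]) blast
  obtain c' where [measurable]: "\<And>x. c' x \<in> borel_measurable borel"
    and n': "\<And>w. (\<Sum>x\<in>?E'. norm (c' x w)) \<le> N' w"
    and e': "\<And>z w. H' z w = (\<Sum>x\<in>?E'. c' x w * bi_monomial x z)"
    by (rule bihom_kernelE[OF assms(2)]) blast
  have fin: "finite S" "finite ?T" "g ` S \<subseteq> ?T"
    by (simp add: S_def, simp) (auto simp: S_def g_def bi_exponents_def exponents_of_degree_def sum.distrib)
  define d where "d = (\<lambda>y w. \<Sum>s\<in>{s\<in>S. g s = y}. c (fst s) w * c' (snd s) w)"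
  have "(\<Sum>y\<in>?T. norm (d y w)) \<le> N w * N' w" for w
  proof -
    have "(\<Sum>y\<in>?T. norm (d y w)) \<le> (\<Sum>y\<in>?T. \<Sum>s\<in>{s\<in>S. g s = y}. norm (c (fst s) w * c' (snd s) w))"
      unfolding d_def by (intro sum_mono norm_sum)
    also have "\<dots> = (\<Sum>s\<in>S. norm (c (fst s) w * c' (snd s) w))"
      by (rule sum.group[OF fin])
    also have "\<dots> = (\<Sum>x\<in>?E. norm (c x w)) * (\<Sum>x\<in>?E'. norm (c' x w))"
      by (simp add: S_def sum_product sum.cartesian_product norm_mult case_prod_beta)
    also have "\<dots> \<le> N w * N' w"
      using bihom_kernel_nonneg[OF assms(1), of w] by (intro mult_mono n n' sum_nonneg) auto
    finally show ?thesis .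
  qed
  moreover have "H z w * H' z w = (\<Sum>y\<in>?T. d y w * bi_monomial y z)" for z w
  proof -
    have "H z w * H' z w = (\<Sum>s\<in>S. c (fst s) w * c' (snd s) w * bi_monomial (g s) z)"
      unfolding e e' sum_product S_def sum.cartesian_product
      by (intro sum.cong refl) (auto simp: g_def bi_monomial_mult)
    also have "\<dots> = (\<Sum>y\<in>?T. \<Sum>s\<in>{s\<in>S. g s = y}. c (fst s) w * c' (snd s) w * bi_monomial (g s) z)"
      by (rule sum.group[OF fin, symmetric])
    also have "\<dots> = (\<Sum>y\<in>?T. d y w * bi_monomial y z)"
      unfolding d_def sum_distrib_right by (intro sum.cong refl) auto
    finally show ?thesis .
  qed
  moreover have "d y \<in> borel_measurable borel" for y
    unfolding d_def by measurable
  ultimately show ?thesis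
    unfolding bihom_kernel_def by blast
qed

lemma bihom_kernel_one: "bihom_kernel 0 0 (\<lambda>z w. 1) (\<lambda>w. 1)"
proof -
  have "bi_exponents 0 0 = {(\<lambda>_. 0, \<lambda>_::'a::finite. 0)}"
    by (auto simp: bi_exponents_def exponents_of_degree_def fun_eq_iff)
  then show ?thesis
    unfolding bihom_kernel_def by (intro exI[of _ "\<lambda>x w. 1"]) (auto simp: bi_monomial_def)
qed

lemma bihom_kernel_power:
  "bihom_kernel p q H N \<Longrightarrow> bihom_kernel (p * k) (q * k) (\<lambda>z w. H z w ^ k) (\<lambda>w. N w ^ k)"
proof (induction k)
  case (Suc k)
  then show ?case using bihom_kernel_mult[of p q H N "p * k" "q * k"] by simp
qed (simp add: bihom_kernel_one)

lemma bihom_kernel_coord: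
  "bihom_kernel 1 0 (\<lambda>z w. z $ j) (\<lambda>w. 1)" "bihom_kernel 0 1 (\<lambda>z w. cnj (z $ j)) (\<lambda>w. 1)"
proof -
  let ?e = "\<lambda>i. if i = j then 1 else 0 :: nat"
  have mem: "(?e, \<lambda>_. 0) \<in> bi_exponents 1 0" "(\<lambda>_. 0, ?e) \<in> bi_exponents 0 1"
    by (auto simp: bi_exponents_def exponents_of_degree_def)
  have pw: "(\<Prod>i\<in>UNIV. x i ^ ?e i) = x j" for x :: "'a \<Rightarrow> complex"
    by (simp add: if_distrib cong: if_cong)
  show "bihom_kernel 1 0 (\<lambda>z w. z $ j) (\<lambda>w. 1)"
    unfolding bihom_kernel_def using mem(1)
    by (intro exI[of _ "\<lambda>x w. if x = (?e, \<lambda>_. 0) then 1 else 0"])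
       (auto simp: if_distrib if_distribR bi_monomial_def pw cong: if_cong)
  show "bihom_kernel 0 1 (\<lambda>z w. cnj (z $ j)) (\<lambda>w. 1)"
    unfolding bihom_kernel_def using mem(2)
    by (intro exI[of _ "\<lambda>x w. if x = (\<lambda>_. 0, ?e) then 1 else 0"])
       (auto simp: if_distrib if_distribR bi_monomial_def pw cong: if_cong)
qed

lemma bihom_kernel_herm:
  shows "bihom_kernel 1 0 (\<lambda>z w::complex^'n. herm z w) (\<lambda>w. of_nat CARD('n) * norm w)"
    and "bihom_kernel 0 1 (\<lambda>z w::complex^'n. herm w z) (\<lambda>w. of_nat CARD('n) * norm w)"
    and "bihom_kernel 1 1 (\<lambda>z (w::'b::topological_space). herm z (z::complex^'n)) (\<lambda>w. of_nat CARD('n))"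
proof -
  have m: "(\<lambda>w::complex^'n. w $ j) \<in> borel_measurable borel" "(\<lambda>w::complex^'n. cnj (w $ j)) \<in> borel_measurable borel" for j
    by (auto intro!: borel_measurable_continuous_onI continuous_intros)
  have le: "(\<Sum>j\<in>UNIV. norm ((w::complex^'n) $ j)) \<le> of_nat CARD('n) * norm w" for w
    using sum_bounded_above[of UNIV "\<lambda>j. norm (w $ j)" "norm w", OF Finite_Cartesian_Product.norm_nth_le] by simp
  have "bihom_kernel 1 0 (\<lambda>z w::complex^'n. \<Sum>j\<in>UNIV. cnj (w $ j) * z $ j) (\<lambda>w. \<Sum>j\<in>UNIV. norm (cnj (w $ j)) * 1)"
    by (intro bihom_kernel_sum bihom_kernel_cmult bihom_kernel_coord m)
  moreover have "herm = (\<lambda>z w::complex^'n. \<Sum>j\<in>UNIV. cnj (w $ j) * z $ j)"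
    by (simp add: fun_eq_iff herm_def mult.commute)
  ultimately have "bihom_kernel 1 0 (\<lambda>z w::complex^'n. herm z w) (\<lambda>w. \<Sum>j\<in>UNIV. norm (cnj (w $ j)) * 1)"
    by simp
  then show "bihom_kernel 1 0 (\<lambda>z w::complex^'n. herm z w) (\<lambda>w. of_nat CARD('n) * norm w)"
    by (rule bihom_kernel_mono) (auto simp: le)
  have "bihom_kernel 0 1 (\<lambda>z w::complex^'n. \<Sum>j\<in>UNIV. w $ j * cnj (z $ j)) (\<lambda>w. \<Sum>j\<in>UNIV. norm (w $ j) * 1)"
    by (intro bihom_kernel_sum bihom_kernel_cmult bihom_kernel_coord m)
  then show "bihom_kernel 0 1 (\<lambda>z w::complex^'n. herm w z) (\<lambda>w. of_nat CARD('n) * norm w)"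
    unfolding herm_def by (rule bihom_kernel_mono) (auto simp: le)
  have "bihom_kernel (1 + 0) (0 + 1) (\<lambda>z (w::'b). \<Sum>j\<in>UNIV. (z::complex^'n) $ j * cnj (z $ j)) (\<lambda>w. \<Sum>j\<in>(UNIV::'n set). 1 * 1)"
    by (intro bihom_kernel_sum bihom_kernel_mult bihom_kernel_coord)
  then show "bihom_kernel 1 1 (\<lambda>z (w::'b). herm z (z::complex^'n)) (\<lambda>w. of_nat CARD('n))"
    by (simp add: herm_def)
qed

lemma bihom_kernel_norm_le:
  assumes "bihom_kernel p q H N" "\<And>j. norm (z $ j) \<le> R"
  shows "norm (H z w) \<le> N w * R ^ (p + q)"
proof -
  obtain c where "\<And>x. c x \<in> borel_measurable borel"
    and n: "\<And>w. (\<Sum>x\<in>bi_exponents p q. norm (c x w)) \<le> N w"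
    and e: "\<And>z w. H z w = (\<Sum>x\<in>bi_exponents p q. c x w * bi_monomial x z)"
    by (rule bihom_kernelE[OF assms(1)]) blast
  have R: "0 \<le> R" using assms(2) norm_ge_zero order_trans by blast
  have "norm (H z w) \<le> (\<Sum>x\<in>bi_exponents p q. norm (c x w) * R ^ (p + q))"
    unfolding e by (rule sum_norm_le) (auto simp: norm_mult intro!: mult_left_mono norm_bi_monomial_le assms(2))
  also have "\<dots> \<le> N w * R ^ (p + q)"
    unfolding sum_distrib_right[symmetric] using R by (intro mult_right_mono n) auto
  finally show ?thesis .
qed

lemma bihom_kernel_euler: "bihom_kernel p q H N \<Longrightarrow> euler_hom (p + q) (\<lambda>z. H z w)"
  unfolding bihom_kernel_def
  by (auto simp: intro!: euler_hom_sum euler_hom_cmult euler_hom_bi_monomial)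

lemma bihom_kernel_measurable:
  assumes "bihom_kernel p q H N" shows "H z \<in> borel_measurable borel"
proof -
  obtain c where [measurable]: "\<And>x. c x \<in> borel_measurable borel"
    and "\<And>w. (\<Sum>x\<in>bi_exponents p q. norm (c x w)) \<le> N w"
    and e: "\<And>z w. H z w = (\<Sum>x\<in>bi_exponents p q. c x w * bi_monomial x z)"
    by (rule bihom_kernelE[OF assms]) blast
  have "H z = (\<lambda>w. \<Sum>x\<in>bi_exponents p q. c x w * bi_monomial x z)" using e by auto
  then show ?thesis by simp
qed

text \<open>
  Integration in the parameter acts on the finitely many coefficients. Hence it preserves the bidegree
  and commutes with the Laplacian.
\<close>
lemma bihom_kernel_integral:
  fixes F :: "'b::euclidean_space \<Rightarrow> complex"
  assumes H: "bihom_kernel p q H N" and F: "F \<in> borel_measurable lebesgue"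
    and FN: "integrable lebesgue (\<lambda>w. norm (F w) * N w)"
  shows "bihom p q (\<lambda>z. LINT w|lebesgue. F w * H z w) (LINT w|lebesgue. norm (F w) * N w)"
    and "laplacian (\<lambda>z. LINT w|lebesgue. F w * H z w) z = (LINT w|lebesgue. F w * laplacian (\<lambda>z. H z w) z)"
proof -
  let ?E = "bi_exponents p q :: (('a \<Rightarrow> nat) \<times> ('a \<Rightarrow> nat)) set"
  obtain c where c: "\<And>x. c x \<in> borel_measurable borel"
    and n: "\<And>w. (\<Sum>x\<in>?E. norm (c x w)) \<le> N w"
    and e: "\<And>z w. H z w = (\<Sum>x\<in>?E. c x w * bi_monomial x z)"
    by (rule bihom_kernelE[OF H]) blast
  have [measurable]: "c x \<in> borel_measurable lebesgue" for x
    using c[of x] by (intro measurable_completion) simp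
  note [measurable] = F
  have int: "integrable lebesgue (\<lambda>w. F w * c x w)" if "x \<in> ?E" for x
  proof (rule Bochner_Integration.integrable_bound[OF FN])
    have "norm (c x w) \<le> N w" for w
      using order_trans[OF member_le_sum[OF that] n] by auto
    moreover have "0 \<le> N w" for w using bihom_kernel_nonneg[OF H] .
    ultimately show "AE w in lebesgue. norm (F w * c x w) \<le> norm (norm (F w) * N w)"
      by (auto simp: norm_mult intro!: mult_left_mono always_eventually)
  qed measurable
  define d where "d = (\<lambda>x. LINT w|lebesgue. F w * c x w)"
  have val: "(LINT w|lebesgue. F w * (\<Sum>x\<in>?E. c x w * g x)) = (\<Sum>x\<in>?E. d x * g x)" for g :: "_ \<Rightarrow> complex"
  proof -
    have "(LINT w|lebesgue. F w * (\<Sum>x\<in>?E. c x w * g x)) = (LINT w|lebesgue. (\<Sum>x\<in>?E. F w * c x w * g x))"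
      by (simp add: sum_distrib_left mult_ac)
    also have "\<dots> = (\<Sum>x\<in>?E. LINT w|lebesgue. F w * c x w * g x)"
      by (rule Bochner_Integration.integral_sum) (auto intro: int)
    also have "\<dots> = (\<Sum>x\<in>?E. d x * g x)"
      unfolding d_def by simp
    finally show ?thesis .
  qed
  have G: "(\<lambda>z. LINT w|lebesgue. F w * H z w) = (\<lambda>z. \<Sum>x\<in>?E. d x * bi_monomial x z)"
    unfolding e val ..
  have "(\<Sum>x\<in>?E. norm (d x)) \<le> (\<Sum>x\<in>?E. LINT w|lebesgue. norm (F w * c x w))"
    unfolding d_def by (intro sum_mono integral_norm_bound)
  also have "\<dots> = (LINT w|lebesgue. (\<Sum>x\<in>?E. norm (F w * c x w)))"
    by (rule Bochner_Integration.integral_sum[symmetric]) (auto intro: int)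
  also have "\<dots> \<le> (LINT w|lebesgue. norm (F w) * N w)"
  proof (rule integral_mono)
    show "integrable lebesgue (\<lambda>w. \<Sum>x\<in>?E. norm (F w * c x w))"
      using int by (intro Bochner_Integration.integrable_sum integrable_norm)
  qed (use n in \<open>auto simp: norm_mult simp flip: sum_distrib_left intro!: mult_left_mono FN\<close>)
  finally show "bihom p q (\<lambda>z. LINT w|lebesgue. F w * H z w) (LINT w|lebesgue. norm (F w) * N w)"
    unfolding bihom_kernel_def
    by (intro exI[of _ "\<lambda>x _. d x"] conjI allI) (simp_all add: fun_cong[OF G])
  have L: "laplacian (\<lambda>z. \<Sum>x\<in>?E. a x * bi_monomial x z) z = (\<Sum>x\<in>?E. a x * laplacian (bi_monomial x) z)" for a
    by (simp add: laplacian_sum laplacian_cmult cpoly_bi_monomial cpoly_mult cpoly_const)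
  show "laplacian (\<lambda>z. LINT w|lebesgue. F w * H z w) z = (LINT w|lebesgue. F w * laplacian (\<lambda>z. H z w) z)"
    unfolding G L e val ..
qed

lemma bihom_in_bigraded_harmonics:
  assumes "bihom p q P M" "\<And>z. laplacian P z = 0"
  shows "P \<in> bigraded_harmonics p q"
proof -
  obtain c where "\<And>x. c x \<in> borel_measurable borel"
    and "\<And>w::real. (\<Sum>x\<in>bi_exponents p q. norm (c x w)) \<le> M"
    and "\<And>z w. P z = (\<Sum>x\<in>bi_exponents p q. c x w * bi_monomial x z)"
    by (rule bihom_kernelE[OF assms(1)]) blast
  note e = this(3)[of _ 0]
  have "P = (\<lambda>z. \<Sum>\<alpha>\<in>exponents_of_degree p. \<Sum>\<beta>\<in>exponents_of_degree q.
              c (\<alpha>, \<beta>) 0 * (\<Prod>j\<in>UNIV. (z $ j) ^ \<alpha> j) * (\<Prod>j\<in>UNIV. cnj (z $ j) ^ \<beta> j))"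
    by (rule ext) (simp add: e bi_exponents_def sum.cartesian_product bi_monomial_def case_prod_beta mult_ac)
  then show ?thesis
    unfolding bigraded_harmonics_def using assms(2)
    by (intro CollectI conjI exI[of _ "\<lambda>\<alpha> \<beta>. c (\<alpha>, \<beta>) 0"]) auto
qed

section \<open>Coefficients of the harmonic projection\<close>

text \<open>
  If \<open>g\<close> has bidegree \<open>(p, q)\<close> and \<open>s = n + p + q\<close>, its harmonic projection is
  \<open>\<Sum>j. harm_coeff s j * \<rho>^j * (\<Delta>/4)^j g\<close>.
\<close>
definition harm_coeff :: "nat \<Rightarrow> nat \<Rightarrow> complex" where
  "harm_coeff s j = (-1) ^ j / (fact j * pochhammer (of_nat s - 1 - of_nat j) j)"

text \<open>
  This is the condition that consecutive terms cancel in the Laplacian of the projection, because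
  \<open>\<Delta>/4\<close> maps \<open>\<rho>^(j+1) g\<close> with \<open>g\<close> of bidegree \<open>(p-j-1, q-j-1)\<close> to
  \<open>(j+1) (s-j-2) \<rho>^j g + \<rho>^(j+1) (\<Delta>/4) g\<close>.
\<close>
lemma harm_coeff_Suc:
  assumes "j + 2 < s"
  shows "harm_coeff s (Suc j) * of_nat (Suc j * (s - j - 2)) = - harm_coeff s j"
proof -
  have s: "of_nat s - 1 - of_nat (Suc j) = (of_nat (s - j - 2) :: complex)"
    using assms by (simp add: of_nat_diff)
  have s': "of_nat s - 1 - of_nat j = (of_nat (s - j - 2) + 1 :: complex)"
    using assms by (simp add: of_nat_diff)
  have nz: "of_nat (s - j - 2) \<noteq> (0::complex)" "of_nat (Suc j) \<noteq> (0::complex)"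
    using assms by (simp_all del: of_nat_Suc)
  show ?thesis
    unfolding harm_coeff_def s s' pochhammer_rec fact_Suc of_nat_mult
    using nz by (simp add: divide_simps del: of_nat_Suc)
qed

text \<open>
  With \<open>B = n + a + b\<close>, this is, up to a factor depending on \<open>k\<close>, \<open>a\<close> and \<open>m\<close> only, the contribution of
  the harmonic polynomial of bidegree \<open>(a+j, b+j)\<close> to the coefficient of \<open>\<rho>^m G a b\<close>: the \<open>j\<close>-th
  coefficient of the projection times the coefficient of degree \<open>m - j\<close> of the Laguerre polynomial.
\<close>
definition expansion_coeff :: "nat \<Rightarrow> nat \<Rightarrow> nat \<Rightarrow> complex" where
  "expansion_coeff B j m = harm_coeff (B + 2 * j) j / (fact (m - j) * pochhammer (of_nat (B + 2 * j)) (m - j))"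

lemma harm_base: "of_nat (B + 2 * j) - 1 - of_nat j = (of_nat B + of_nat j - 1 :: complex)"
  by simp

lemma norm_expansion_coeff_le:
  assumes "B \<ge> 1"
  shows "norm (expansion_coeff B j m) \<le> 1"
proof -
  have p1: "norm (pochhammer (of_nat x :: complex) i) \<ge> 1" if "x \<ge> 1 \<or> i = 0" for x i
  proof -
    have "pochhammer x i \<ge> 1" using that by (cases "i = 0") (auto intro!: Suc_leI pochhammer_pos simp: pochhammer_pos)
    then show ?thesis
      unfolding pochhammer_of_nat norm_of_nat by linarith
  qed
  have "of_nat B + of_nat j - 1 = (of_nat (B + j - 1) :: complex)"
    using assms by (simp add: of_nat_diff)
  then have "norm (pochhammer (of_nat B + of_nat j - 1 :: complex) j) \<ge> 1"
    using p1[of "B + j - 1" j] assms by (cases "j = 0") auto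
  moreover have "norm (pochhammer (of_nat (B + 2 * j) :: complex) (m - j)) \<ge> 1"
    using assms by (intro p1) auto
  moreover have "(1::real) \<le> fact j" "(1::real) \<le> fact (m - j)" by (rule fact_ge_1)+
  moreover have "norm (expansion_coeff B j m) = 1 / (fact j * norm (pochhammer (of_nat B + of_nat j - 1 :: complex) j) *
      (fact (m - j) * norm (pochhammer (of_nat (B + 2 * j) :: complex) (m - j))))"
    unfolding expansion_coeff_def harm_coeff_def harm_base
    by (simp add: norm_divide norm_mult norm_power del: of_nat_add of_nat_mult)
  moreover have "1 / (a * b * (c * d)) \<le> 1" if "1 \<le> a" "1 \<le> b" "1 \<le> c" "1 \<le> d" for a b c d :: real
  proof -
    have "1 * 1 * (1 * 1) \<le> a * b * (c * d)"
      using that by (intro mult_mono mult_nonneg_nonneg) auto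
    then show ?thesis by simp
  qed
  ultimately show ?thesis by (simp only:)
qed

text \<open>
  Gosper summation. With the closed form for the partial sums known, the induction step is the
  identity \<open>(m choose j) (B + 2j - 1) = (m-1 choose j) (B+j-1) + (m-1 choose j-1) (B+j-1+m)\<close>. The closed form
  vanishes at \<open>r = m\<close>.
\<close>
lemma expansion_coeff_partial_sum:
  assumes "B \<ge> 1" "m \<ge> 1" "r \<le> m"
  shows "fact m * (\<Sum>j\<le>r. expansion_coeff B j m)
    = (-1) ^ r * of_nat ((m - 1) choose r) / pochhammer (of_nat (B + r)) m"
  using assms(3)
proof (induction r)
  case 0
  then show ?case by (simp add: expansion_coeff_def harm_coeff_def)
next
  case (Suc r)
  obtain m' where m: "m = Suc m'" using assms(2) by (cases m) auto
  define a :: complex where "a = of_nat (B + r)"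
  have a: "a \<noteq> 0" using assms(1) unfolding a_def of_nat_eq_0_iff by simp
  \<comment> \<open>the common denominator of the new summand and of the two partial sums\<close>
  define D where "D = pochhammer a (Suc m)"
  have D: "D \<noteq> 0"
    unfolding D_def a_def pochhammer_of_nat of_nat_eq_0_iff using assms(1) pochhammer_pos[of "B + r" "Suc m"] by simp
  have D1: "D = a * pochhammer (a + 1) m" unfolding D_def by (simp add: pochhammer_rec)
  have D2: "D = pochhammer a m * (a + of_nat m)" unfolding D_def by (simp add: pochhammer_Suc)
  have D3: "D = pochhammer a (Suc r) * ((a + of_nat (Suc r)) * pochhammer (a + of_nat (Suc r) + 1) (m - Suc r))"
  proof -
    have "Suc m = Suc r + Suc (m - Suc r)" using Suc.prems by simp
    then show ?thesis unfolding D_def using pochhammer_product'[of a "Suc r" "Suc (m - Suc r)"]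
      by (simp only: pochhammer_rec)
  qed
  have base: "of_nat (B + 2 * Suc r) - 1 - of_nat (Suc r) = a"
    "of_nat (B + 2 * Suc r) = a + of_nat (Suc r) + 1" "of_nat (B + Suc r) = a + 1"
    by (simp_all add: a_def)
  have bin: "of_nat (m choose Suc r) * (a + of_nat (Suc r)) =
      of_nat (m' choose Suc r) * a + of_nat (m' choose r) * (a + of_nat m)"
  proof -
    have "of_nat (Suc r * (m choose Suc r)) = (of_nat (m * (m' choose r)) :: complex)"
      unfolding m using Suc_times_binomial_eq[of m' r] by (simp add: mult.commute)
    then show ?thesis unfolding m binomial_Suc_Suc of_nat_add of_nat_mult
      by (simp add: algebra_simps)
  qed
  have "fact m * expansion_coeff B (Suc r) m
     = (-1) ^ Suc r * (fact m / (fact (Suc r) * fact (m - Suc r))) / (pochhammer a (Suc r) * pochhammer (a + of_nat (Suc r) + 1) (m - Suc r))"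
    unfolding expansion_coeff_def harm_coeff_def base by (simp add: divide_simps del: fact_Suc of_nat_Suc)
  also have "fact m / (fact (Suc r) * fact (m - Suc r)) = (of_nat (m choose Suc r) :: complex)"
    using Suc.prems by (simp only: binomial_fact)
  also have "(-1) ^ Suc r * of_nat (m choose Suc r) / (pochhammer a (Suc r) * pochhammer (a + of_nat (Suc r) + 1) (m - Suc r))
      = (-1) ^ Suc r * (of_nat (m choose Suc r) * (a + of_nat (Suc r))) / D"
    using D unfolding D3 by (simp add: divide_simps del: of_nat_Suc)
  finally have summand: "fact m * expansion_coeff B (Suc r) m
     = (-1) ^ Suc r * (of_nat (m' choose Suc r) * a + of_nat (m' choose r) * (a + of_nat m)) / D"
    unfolding bin .
  have IH: "fact m * (\<Sum>j\<le>r. expansion_coeff B j m) = (-1) ^ r * of_nat (m' choose r) / pochhammer a m"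
    using Suc by (simp add: m a_def)
  have e1: "(-1) ^ r * of_nat (m' choose r) / pochhammer a m = (-1) ^ r * (of_nat (m' choose r) * (a + of_nat m)) / D"
    using D unfolding D2 by (simp add: divide_simps)
  have e2: "(-1) ^ Suc r * of_nat (m' choose Suc r) / pochhammer (a + 1) m = (-1) ^ Suc r * (of_nat (m' choose Suc r) * a) / D"
    using D unfolding D1 by (simp add: divide_simps)
  have cancel: "(-1) ^ r * X / D + (-1) ^ Suc r * (Y + X) / D = (-1) ^ Suc r * Y / D" for X Y
    by (simp add: add_divide_distrib[symmetric] algebra_simps)
  have m1: "m - 1 = m'" by (simp add: m)
  have "fact m * (\<Sum>j\<le>Suc r. expansion_coeff B j m)
      = fact m * (\<Sum>j\<le>r. expansion_coeff B j m) + fact m * expansion_coeff B (Suc r) m"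
    by (simp add: distrib_left)
  then show ?case
    unfolding IH summand e1 cancel base m1 e2 .
qed

lemma sum_expansion_coeff:
  assumes "B \<ge> 1"
  shows "(\<Sum>j\<le>m. expansion_coeff B j m) = (if m = 0 then 1 else 0)"
proof (cases "m = 0")
  case True
  then show ?thesis by (simp add: expansion_coeff_def harm_coeff_def)
next
  case False
  then have "fact m * (\<Sum>j\<le>m. expansion_coeff B j m) = 0"
    using expansion_coeff_partial_sum[of B m m] assms by simp
  then show ?thesis using False by simp
qed

text \<open>
  The coefficients of a Laguerre polynomial of degree \<open>K\<close> and index \<open>s - 1\<close>, up to \<open>(-1)^i / i!\<close>,
  after division by its value at \<open>0\<close>.
\<close>
lemma binomial_ratio_pochhammer:
  assumes "i \<le> K" "s \<ge> 1"
  shows "of_nat ((s - 1 + K) choose (K - i)) / of_nat ((s - 1 + K) choose K)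
    = (fact K / (fact (K - i) * pochhammer (of_nat s) i) :: complex)"
proof -
  have p: "fact (s - 1 + i) = (fact (s - 1) * pochhammer (of_nat s) i :: complex)"
    using assms(2) pochhammer_product'[of "1::complex" "s - 1" i]
    by (simp add: pochhammer_fact of_nat_diff)
  have "pochhammer s i > 0" using assms(2) by (intro pochhammer_pos) auto
  then have nz: "pochhammer (of_nat s) i \<noteq> (0::complex)"
    unfolding pochhammer_of_nat of_nat_eq_0_iff by simp
  have "s - 1 + K - (K - i) = s - 1 + i" using assms(1) by simp
  then show ?thesis
    using assms(1) nz by (simp add: binomial_fact p[unfolded One_nat_def] divide_simps)
qed

section \<open>From homogeneous components to the harmonic expansion\<close>

lemma ratio_regroup:
  fixes K Ki po fi :: complex
  assumes "K \<noteq> 0" "Ki \<noteq> 0" "po \<noteq> 0" "fi \<noteq> 0"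
  shows "h * A * (KJ / K) * (Rj * g) * (K / (Ki * po) * (A' * Ri) / fi)
    = A * A' * (KJ / Ki) * (h / (fi * po)) * (Rj * Ri) * g"
  using assms by (simp add: divide_simps)

text \<open>
  Homogeneous components of \<open>exp (\<rho>/4) Q\<close> for an eigenfunction \<open>Q\<close> of the special Hermite operator.
  This section is purely algebraic apart from the absolute convergence of \<open>\<Sum>q. G p q z\<close>.
\<close>
locale bigraded_eigenfunction =
  fixes k :: nat and G :: "nat \<Rightarrow> nat \<Rightarrow> complex^'n \<Rightarrow> complex"
  assumes hom: "p \<le> k \<Longrightarrow> \<exists>M. bihom p q (G p q) M"
    and lap: "p \<le> k \<Longrightarrow> laplacian (G p q) z
      = (if p = 0 \<or> q = 0 then 0 else - 2 * of_nat (Suc k - p) * G (p - 1) (q - 1) z)"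
    and smbl: "p \<le> k \<Longrightarrow> summable (\<lambda>q. norm (G p q z))"
begin

text \<open>
  \<open>harm_coeff\<close> times the factor that the assumption on the Laplacian produces when \<open>(\<Delta>/4)^j (G p q)\<close> is
  rewritten as a multiple of \<open>G (p-j) (q-j)\<close>.
\<close>
definition harm_part_coeff :: "nat \<Rightarrow> nat \<Rightarrow> nat \<Rightarrow> complex" where
  "harm_part_coeff p q j = harm_coeff (CARD('n) + p + q) j * (- 1 / 2) ^ j * (fact (k - p + j) / fact (k - p))"

definition harm_part :: "nat \<Rightarrow> nat \<Rightarrow> complex^'n \<Rightarrow> complex" where
  "harm_part p q z = (\<Sum>j\<le>min p q. harm_part_coeff p q j * (herm z z ^ j * G (p - j) (q - j) z))"

lemma bihom_harm_term:
  assumes "p \<le> k" "j \<le> min p q"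
  shows "\<exists>N. bihom p q (\<lambda>z. herm z z ^ j * G (p - j) (q - j) z) N"
proof -
  obtain M where M: "bihom (p - j) (q - j) (G (p - j) (q - j)) M"
    using hom[OF le_trans[OF diff_le_self assms(1)]] by blast
  have "bihom (1 * j + (p - j)) (1 * j + (q - j)) (\<lambda>z. herm z z ^ j * G (p - j) (q - j) z)
      (real CARD('n) ^ j * M)"
    by (intro bihom_kernel_mult bihom_kernel_power bihom_kernel_herm M)
  then show ?thesis using assms by auto
qed

lemma cpoly_harm_term: "p \<le> k \<Longrightarrow> j \<le> min p q \<Longrightarrow> cpoly (\<lambda>z. herm z z ^ j * G (p - j) (q - j) z)"
  using bihom_harm_term[of p j q] bihom_kernel_euler unfolding euler_hom_def by blast

lemma bihom_harm_part:
  assumes "p \<le> k"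
  shows "\<exists>N. bihom p q (\<lambda>z. c * harm_part p q z) N"
proof -
  have "\<forall>j\<in>{..min p q}. \<exists>N. bihom p q (\<lambda>z. herm z z ^ j * G (p - j) (q - j) z) N"
    using bihom_harm_term[OF assms] by blast
  from bchoice[OF this] obtain N
    where N: "\<And>j. j \<in> {..min p q} \<Longrightarrow> bihom p q (\<lambda>z. herm z z ^ j * G (p - j) (q - j) z) (N j)"
    by blast
  have "bihom p q (\<lambda>z. c * (\<Sum>j\<le>min p q. harm_part_coeff p q j * (herm z z ^ j * G (p - j) (q - j) z)))
     (norm c * (\<Sum>j\<le>min p q. norm (harm_part_coeff p q j) * N j))"
    by (intro bihom_kernel_cmult bihom_kernel_sum N) auto
  then show ?thesis unfolding harm_part_def by blast
qed

lemma harm_part_coeff_Suc: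
  assumes "p \<le> k" "j < min p q"
  shows "harm_part_coeff p q (Suc j) * (4 * of_nat (Suc j * (CARD('n) + p + q - j - 2)))
    = 2 * of_nat (Suc (k - p + j)) * harm_part_coeff p q j"
proof -
  have "CARD('n) > 0" by simp
  then have "j + 2 < CARD('n) + p + q" using assms(2) by linarith
  note step = harm_coeff_Suc[OF this]
  have "harm_part_coeff p q (Suc j) * (4 * of_nat (Suc j * (CARD('n) + p + q - j - 2)))
     = harm_coeff (CARD('n) + p + q) (Suc j) * of_nat (Suc j * (CARD('n) + p + q - j - 2))
       * (4 * (- 1 / 2) ^ Suc j * (fact (k - p + Suc j) / fact (k - p)))"
    unfolding harm_part_coeff_def by (simp only: mult_ac)
  also have "\<dots> = - harm_coeff (CARD('n) + p + q) j * (4 * (- 1 / 2) ^ Suc j * (fact (k - p + Suc j) / fact (k - p)))"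
    unfolding step ..
  also have "\<dots> = 2 * of_nat (Suc (k - p + j)) * harm_part_coeff p q j"
    unfolding harm_part_coeff_def by (simp add: field_simps del: of_nat_Suc)
  finally show ?thesis .
qed

text \<open>
  The Laplacian of the \<open>j\<close>-th summand has a term in \<open>\<rho>^(j-1) G (p-j) (q-j)\<close> and a term in
  \<open>\<rho>^j G (p-j-1) (q-j-1)\<close>. The second one cancels the first one of the next summand; at the two ends the
  uncancelled terms vanish.
\<close>
lemma laplacian_harm_part:
  assumes p: "p \<le> k"
  shows "laplacian (harm_part p q) z = 0"
proof -
  define m where "m = min p q"
  define s where "s = CARD('n) + p + q"
  define t1 where "t1 = (\<lambda>j. harm_part_coeff p q j * (4 * of_nat (j * (s - j - 1)) * herm z z ^ (j - 1) * G (p - j) (q - j) z))"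
  define t2 where "t2 = (\<lambda>j. harm_part_coeff p q j * (herm z z ^ j * laplacian (G (p - j) (q - j)) z))"
  have "laplacian (harm_part p q) z = (\<Sum>j\<le>m. harm_part_coeff p q j * laplacian (\<lambda>z. herm z z ^ j * G (p - j) (q - j) z) z)"
    unfolding harm_part_def m_def
    by (subst laplacian_sum) (auto intro!: sum.cong laplacian_cmult cpoly_mult cpoly_const cpoly_harm_term[OF p, unfolded] simp: p)
  also have "\<dots> = (\<Sum>j\<le>m. t1 j + t2 j)"
  proof (rule sum.cong[OF refl])
    fix j assume j: "j \<in> {..m}"
    obtain N where "bihom (p - j) (q - j) (G (p - j) (q - j)) N"
      using hom[OF le_trans[OF diff_le_self p]] by blast
    then have "euler_hom (p - j + (q - j)) (G (p - j) (q - j))"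
      by (rule bihom_kernel_euler)
    note L = laplacian_norm_power_mult[OF this, of j z]
    have "CARD('n) + (p - j + (q - j)) + j - 1 = s - j - 1" using j by (simp add: s_def m_def)
    with L
    have "laplacian (\<lambda>z. herm z z ^ j * G (p - j) (q - j) z) z
      = 4 * of_nat (j * (s - j - 1)) * herm z z ^ (j - 1) * G (p - j) (q - j) z
        + herm z z ^ j * laplacian (G (p - j) (q - j)) z"
      by (simp only:)
    then show "harm_part_coeff p q j * laplacian (\<lambda>z. herm z z ^ j * G (p - j) (q - j) z) z = t1 j + t2 j"
      by (simp add: t1_def t2_def distrib_left)
  qed
  also have "\<dots> = (\<Sum>j\<le>m. t1 j) + (\<Sum>j\<le>m. t2 j)" by (rule sum.distrib)
  also have "(\<Sum>j\<le>m. t1 j) = (\<Sum>j<m. t1 (Suc j))"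
    by (simp add: sum.atMost_shift t1_def)
  also have "(\<Sum>j\<le>m. t2 j) = (\<Sum>j<m. t2 j)"
  proof -
    have "p - m = 0 \<or> q - m = 0" by (auto simp: m_def)
    then have "t2 m = 0" unfolding t2_def using lap[of "p - m" "q - m" z] p by auto
    then show ?thesis by (simp add: lessThan_Suc_atMost[symmetric])
  qed
  also have "(\<Sum>j<m. t1 (Suc j)) = - (\<Sum>j<m. t2 j)"
    unfolding sum_negf[symmetric]
  proof (rule sum.cong[OF refl])
    fix j assume "j \<in> {..<m}"
    then have j: "j < min p q" by (simp add: m_def)
    have nz: "p - j \<noteq> 0" "q - j \<noteq> 0" using j by auto
    have "laplacian (G (p - j) (q - j)) z = - 2 * of_nat (Suc (k - p + j)) * G (p - Suc j) (q - Suc j) z"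
    proof -
      have "Suc k - (p - j) = Suc (k - p + j)" using j p by simp
      then show ?thesis using lap[of "p - j" "q - j" z] nz p by simp
    qed
    then have "- t2 j = (2 * of_nat (Suc (k - p + j)) * harm_part_coeff p q j) * (herm z z ^ j * G (p - Suc j) (q - Suc j) z)"
      by (simp add: t2_def del: of_nat_Suc)
    also have "\<dots> = t1 (Suc j)"
      unfolding harm_part_coeff_Suc[OF p j, symmetric] t1_def s_def by (simp add: diff_diff_left del: of_nat_Suc)
    finally show "t1 (Suc j) = - t2 j" ..
  qed
  finally show ?thesis by simp
qed

text \<open>
  The divisor is the constant term of the Laguerre polynomial that multiplies this function in the
  expansion: the terms of the expansion without a factor \<open>\<rho>\<close> then are exactly the harmonic projections.
\<close>
definition harmonic :: "nat \<Rightarrow> nat \<Rightarrow> complex^'n \<Rightarrow> complex" where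
  "harmonic p q z = 1 / of_nat ((CARD('n) + p + q - 1 + (k - p)) choose (k - p)) * harm_part p q z"

lemma harmonic_in: "p \<le> k \<Longrightarrow> harmonic p q \<in> bigraded_harmonics p q"
proof -
  assume p: "p \<le> k"
  let ?c = "1 / of_nat ((CARD('n) + p + q - 1 + (k - p)) choose (k - p)) :: complex"
  obtain N where N: "bihom p q (\<lambda>z. ?c * harm_part p q z) N"
    using bihom_harm_part[OF p] by blast
  have "cpoly (harm_part p q)"
    unfolding harm_part_def[abs_def]
    by (intro cpoly_sum cpoly_mult[OF cpoly_const] cpoly_harm_term p) auto
  then have "laplacian (\<lambda>z. ?c * harm_part p q z) z = 0" for z
    unfolding laplacian_cmult[OF \<open>cpoly (harm_part p q)\<close>] laplacian_harm_part[OF p] by simp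
  then have "(\<lambda>z. ?c * harm_part p q z) \<in> bigraded_harmonics p q"
    by (rule bihom_in_bigraded_harmonics[OF N])
  then show ?thesis unfolding harmonic_def[abs_def] .
qed

text \<open>
  The contribution of the harmonic polynomial of bidegree \<open>(a+j, b+j)\<close> to the multiple of
  \<open>\<rho>^m G a b\<close> in the expansion. The variable \<open>b\<close> of the infinite summation comes last.
\<close>
definition expansion_term :: "complex^'n \<Rightarrow> nat \<Rightarrow> nat \<Rightarrow> nat \<Rightarrow> nat \<Rightarrow> complex" where
  "expansion_term z a m j b = (- 1 / 2) ^ m * (fact (k - a) / fact (k - a - m)) * expansion_coeff (CARD('n) + a + b) j m
      * herm z z ^ m * G a b z"

lemma summable_expansion_term: "a \<le> k \<Longrightarrow> summable (\<lambda>b. expansion_term z a m j b)"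
proof (rule summable_comparison_test'[where N=0])
  assume a: "a \<le> k"
  define C where "C = norm ((- 1 / 2) ^ m * (fact (k - a) / fact (k - a - m)) * herm z z ^ m)"
  show "summable (\<lambda>b. C * norm (G a b z))"
    by (intro summable_mult smbl a)
  fix b
  have "norm (expansion_term z a m j b) = norm (expansion_coeff (CARD('n) + a + b) j m) * (C * norm (G a b z))"
    unfolding expansion_term_def C_def norm_mult by (simp only: mult_ac)
  also have "\<dots> \<le> 1 * (C * norm (G a b z))"
    by (intro mult_right_mono norm_expansion_coeff_le) (auto simp: C_def Suc_le_eq)
  finally show "norm (expansion_term z a m j b) \<le> C * norm (G a b z)" by simp
qed

lemma harmonic_mult_complex_laguerre:
  assumes p: "p \<le> k"
  shows "harmonic p q z * complex_laguerre (CARD('n) + p + q - 1) (k - p) (herm z z / 2)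
   = (\<Sum>j\<le>p. if j \<le> q then \<Sum>i\<le>k - p. expansion_term z (p - j) (j + i) j (q - j) else 0)"
proof -
  define s where "s = CARD('n) + p + q"
  have s1: "s \<ge> 1" by (simp add: s_def Suc_le_eq)
  have "harmonic p q z * complex_laguerre (s - 1) (k - p) (herm z z / 2)
     = (\<Sum>j\<le>min p q. \<Sum>i\<le>k - p. harm_part_coeff p q j * (herm z z ^ j * G (p - j) (q - j) z) *
        ((-1) ^ i * (of_nat ((s - 1 + (k - p)) choose (k - p - i)) / of_nat ((s - 1 + (k - p)) choose (k - p))) * (herm z z / 2) ^ i / fact i))"
    unfolding harmonic_def harm_part_def complex_laguerre_def s_def[symmetric] sum_product sum_distrib_left sum_distrib_right
    by (subst sum.swap) (intro sum.cong refl, simp only: divide_inverse mult_1_left mult_ac)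
  also have "\<dots> = (\<Sum>j\<le>min p q. \<Sum>i\<le>k - p. expansion_term z (p - j) (j + i) j (q - j))"
  proof (intro sum.cong refl)
    fix j i assume ji: "j \<in> {..min p q}" "i \<in> {..k - p}"
    have e: "CARD('n) + (p - j) + (q - j) + 2 * j = s" "k - (p - j) = k - p + j"
      "k - p + j - (j + i) = k - p - i" "j + i - j = i"
      using ji p by (auto simp: s_def)
    have ik: "i \<le> k - p" using ji by simp
    have po: "pochhammer (of_nat s) i \<noteq> (0::complex)"
      unfolding pochhammer_of_nat of_nat_eq_0_iff using s1 pochhammer_pos[of s i] by simp
    show "harm_part_coeff p q j * (herm z z ^ j * G (p - j) (q - j) z) *
        ((-1) ^ i * (of_nat ((s - 1 + (k - p)) choose (k - p - i)) / of_nat ((s - 1 + (k - p)) choose (k - p))) * (herm z z / 2) ^ i / fact i)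
      = expansion_term z (p - j) (j + i) j (q - j)"
      unfolding expansion_term_def expansion_coeff_def e harm_part_coeff_def s_def[symmetric]
        binomial_ratio_pochhammer[OF ik s1]
    proof -
      have "(-1) ^ i * (herm z z / 2) ^ i = (- 1 / 2) ^ i * herm z z ^ i"
        unfolding power_mult_distrib[symmetric] by simp
      moreover have "(-1) ^ i * x * (herm z z / 2) ^ i = x * ((-1) ^ i * (herm z z / 2) ^ i)" for x
        by (simp only: mult_ac)
      ultimately have A: "(-1) ^ i * x * (herm z z / 2) ^ i / fact i = x * ((- 1 / 2) ^ i * herm z z ^ i) / fact i" for x
        by (simp only:)
      show "harm_coeff s j * (- 1 / 2) ^ j * (fact (k - p + j) / fact (k - p)) * (herm z z ^ j * G (p - j) (q - j) z) *
         ((-1) ^ i * (fact (k - p) / (fact (k - p - i) * pochhammer (of_nat s) i)) * (herm z z / 2) ^ i / fact i)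
        = (- 1 / 2) ^ (j + i) * (fact (k - p + j) / fact (k - p - i)) * (harm_coeff s j / (fact i * pochhammer (of_nat s) i))
          * herm z z ^ (j + i) * G (p - j) (q - j) z"
        unfolding A power_add by (rule ratio_regroup) (simp_all add: po)
    qed
  qed
  also have "\<dots> = (\<Sum>j\<le>p. if j \<le> q then \<Sum>i\<le>k - p. expansion_term z (p - j) (j + i) j (q - j) else 0)"
    by (rule sum.mono_neutral_cong_left) auto
  finally show ?thesis unfolding s_def .
qed

lemma sums_harmonic_complex_laguerre:
  assumes p: "p \<le> k"
  shows "(\<lambda>q. harmonic p q z * complex_laguerre (CARD('n) + p + q - 1) (k - p) (herm z z / 2))
    sums (\<Sum>j\<le>p. \<Sum>i\<le>k - p. \<Sum>b. expansion_term z (p - j) (j + i) j b)"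
  unfolding harmonic_mult_complex_laguerre[OF p]
proof (intro sums_sum)
  fix j assume j: "j \<in> {..p}"
  have "(\<lambda>b. \<Sum>i\<le>k - p. expansion_term z (p - j) (j + i) j b) sums (\<Sum>i\<le>k - p. \<Sum>b. expansion_term z (p - j) (j + i) j b)"
    using p by (intro sums_sum summable_sums summable_expansion_term) auto
  then show "(\<lambda>q. if j \<le> q then \<Sum>i\<le>k - p. expansion_term z (p - j) (j + i) j (q - j) else 0)
      sums (\<Sum>i\<le>k - p. \<Sum>b. expansion_term z (p - j) (j + i) j b)"
    using sums_zero_iff_shift[of j "\<lambda>q. if j \<le> q then \<Sum>i\<le>k - p. expansion_term z (p - j) (j + i) j (q - j) else 0"]
    by simp
qed

text \<open>
  Sorting the contributions by the component \<open>G a b\<close> and the power \<open>\<rho>^m\<close> is a rearrangement of finitely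
  many convergent series. With \<open>p = a + j\<close>, the conditions \<open>p \<le> k\<close> and \<open>m - j \<le> k - p\<close> amount to
  \<open>m \<le> k - a\<close> for every \<open>j \<le> m\<close>, so the full sum over \<open>j\<close> appears and telescopes.
\<close>
lemma sum_harmonic_complex_laguerre:
  "(\<Sum>p\<le>k. \<Sum>q. harmonic p q z * complex_laguerre (CARD('n) + p + q - 1) (k - p) (herm z z / 2))
   = (\<Sum>p\<le>k. \<Sum>q. G p q z)"
proof -
  have "(\<Sum>p\<le>k. \<Sum>q. harmonic p q z * complex_laguerre (CARD('n) + p + q - 1) (k - p) (herm z z / 2))
     = (\<Sum>p\<le>k. \<Sum>j\<le>p. \<Sum>i\<le>k - p. \<Sum>b. expansion_term z (p - j) (j + i) j b)"
    by (intro sum.cong refl sums_unique[symmetric] sums_harmonic_complex_laguerre) auto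
  also have "\<dots> = (\<Sum>p\<le>k. \<Sum>a\<le>p. \<Sum>i\<le>k - p. \<Sum>b. expansion_term z a (p - a + i) (p - a) b)"
  proof (rule sum.cong[OF refl])
    fix p
    show "(\<Sum>j\<le>p. \<Sum>i\<le>k - p. \<Sum>b. expansion_term z (p - j) (j + i) j b) = (\<Sum>a\<le>p. \<Sum>i\<le>k - p. \<Sum>b. expansion_term z a (p - a + i) (p - a) b)"
      by (rule sum.reindex_bij_witness[where i="\<lambda>l. p - l" and j="\<lambda>l. p - l"]) auto
  qed
  also have "\<dots> = (\<Sum>a\<le>k. \<Sum>j\<le>k - a. \<Sum>i\<le>k - a - j. \<Sum>b. expansion_term z a (j + i) j b)"
    by (simp add: sum_triangle_flip)
  also have "\<dots> = (\<Sum>a\<le>k. \<Sum>m\<le>k - a. \<Sum>j\<le>m. \<Sum>b. expansion_term z a m j b)"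
    by (simp add: sum_triangle_flip)
  also have "\<dots> = (\<Sum>a\<le>k. \<Sum>b. G a b z)"
  proof (rule sum.cong[OF refl])
    fix a assume "a \<in> {..k}"
    then have a: "a \<le> k" by simp
    have "(\<Sum>m\<le>k - a. \<Sum>j\<le>m. \<Sum>b. expansion_term z a m j b) = (\<Sum>b. \<Sum>m\<le>k - a. \<Sum>j\<le>m. expansion_term z a m j b)"
      by (subst suminf_sum, intro summable_sum summable_expansion_term a)
         (intro sum.cong refl suminf_sum[symmetric] summable_expansion_term a)
    also have "\<dots> = (\<Sum>b. G a b z)"
    proof (rule arg_cong[of _ _ suminf], rule ext)
      fix b
      have "(\<Sum>j\<le>m. expansion_term z a m j b) = (if m = 0 then G a b z else 0)" for m
      proof -
        have "(\<Sum>j\<le>m. expansion_term z a m j b) = (- 1 / 2) ^ m * (fact (k - a) / fact (k - a - m)) *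
            (\<Sum>j\<le>m. expansion_coeff (CARD('n) + a + b) j m) * herm z z ^ m * G a b z"
          unfolding expansion_term_def sum_distrib_left sum_distrib_right ..
        then show ?thesis by (subst (asm) sum_expansion_coeff) (auto simp: Suc_le_eq)
      qed
      then show "(\<Sum>m\<le>k - a. \<Sum>j\<le>m. expansion_term z a m j b) = G a b z" by (simp add: sum.delta)
    qed
    finally show "(\<Sum>m\<le>k - a. \<Sum>j\<le>m. \<Sum>b. expansion_term z a m j b) = (\<Sum>b. G a b z)" .
  qed
  finally show ?thesis .
qed

end

section \<open>Bihomogeneous expansion of the Laguerre kernel\<close>

text \<open>
  With \<open>a = p - c\<close> and \<open>b = q - c\<close>, the coefficient of \<open>u^a v^b \<rho>^c\<close> in
  \<open>exp (v/2) L ((\<rho> + \<sigma> - u - v)/2)\<close>, where \<open>L\<close> has degree \<open>k\<close> and index \<open>n - 1\<close>. The factors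
  \<open>u^a \<rho>^c\<close> come from Taylor's formula in \<open>(\<rho> - u)/2\<close>, which raises the index by \<open>p\<close>, and \<open>v^b\<close> comes
  from the exponential, which raises it by \<open>b\<close>.
\<close>
definition kernel_coeff :: "nat \<Rightarrow> nat \<Rightarrow> nat \<Rightarrow> nat \<Rightarrow> complex^'n \<Rightarrow> complex" where
  "kernel_coeff k p q c w = (-1) ^ c / (2 ^ (p + (q - c)) * fact (p - c) * fact (q - c) * fact c)
     * complex_laguerre (CARD('n) - 1 + p + (q - c)) (k - p) (herm w w / 2)"

definition laguerre_kernel :: "nat \<Rightarrow> nat \<Rightarrow> nat \<Rightarrow> complex^'n \<Rightarrow> complex^'n \<Rightarrow> complex" where
  "laguerre_kernel k p q z w = (\<Sum>c\<le>min p q. kernel_coeff k p q c w *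
      (herm z z ^ c * (herm z w ^ (p - c) * herm w z ^ (q - c))))"

text \<open>
  The coefficient of \<open>u^(p-c) v^(q-c) \<rho>^c\<close> in the Laplacian of the kernel of bidegree \<open>(p+1, q+1)\<close>: one
  contribution differentiates \<open>\<rho>^(c+1)\<close>, the other one \<open>u^(p-c+1) v^(q-c+1)\<close>.
\<close>
lemma kernel_coeff_recurrence:
  fixes w :: "complex^'n"
  assumes "p < k" "c \<le> p" "c \<le> q"
  shows "4 * of_nat (Suc c * (CARD('n) + p + (q - c))) * kernel_coeff k (Suc p) (Suc q) (Suc c) w
      + 4 * of_nat (Suc (p - c) * Suc (q - c)) * herm w w * kernel_coeff k (Suc p) (Suc q) c w
      = - 2 * of_nat (k - p) * kernel_coeff k p q c w"
proof -
  define A where "A = CARD('n) - 1 + p + (q - c)"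
  define m where "m = k - Suc p"
  define x where "x = herm w w / 2"
  define a where "a = p - c"
  define b where "b = q - c"
  obtain n' where n': "CARD('n) = Suc n'" using gr0_implies_Suc[OF zero_less_card_finite] by blast
  have A: "A = n' + p + b" by (simp add: A_def b_def n')
  have e: "Suc p - Suc c = a" "Suc q - Suc c = b" "Suc p - c = Suc a" "Suc q - c = Suc b"
    "k - Suc p = m" "k - p = Suc m" "CARD('n) + p + b = Suc A"
    "CARD('n) - 1 + Suc p + b = Suc A" "CARD('n) - 1 + p + b = A" "CARD('n) - 1 + Suc p + Suc b = A + 2"
    using assms by (simp_all add: a_def b_def m_def Suc_diff_le) (simp_all add: A n' b_def)
  define C :: complex where "C = (-1) ^ c / (2 ^ (p + b) * fact a * fact b * fact c)"
  have k1: "kernel_coeff k (Suc p) (Suc q) (Suc c) w * of_nat (Suc c) = - C / 2 * complex_laguerre (Suc A) m x"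
    unfolding kernel_coeff_def e x_def[symmetric] C_def fact_Suc of_nat_mult
    by (simp add: field_simps del: of_nat_Suc)
  have k2: "kernel_coeff k (Suc p) (Suc q) c w * of_nat (Suc a * Suc b) = C / 4 * complex_laguerre (A + 2) m x"
    unfolding kernel_coeff_def e x_def[symmetric] C_def fact_Suc of_nat_mult
    by (simp add: field_simps del: of_nat_Suc)
  have k3: "kernel_coeff k p q c w = C * complex_laguerre A (Suc m) x"
    unfolding kernel_coeff_def e x_def[symmetric] C_def a_def[symmetric] b_def[symmetric] ..
  have "4 * of_nat (Suc c * (CARD('n) + p + (q - c))) * kernel_coeff k (Suc p) (Suc q) (Suc c) w
      + 4 * of_nat (Suc (p - c) * Suc (q - c)) * herm w w * kernel_coeff k (Suc p) (Suc q) c w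
     = 4 * of_nat (Suc A) * (kernel_coeff k (Suc p) (Suc q) (Suc c) w * of_nat (Suc c))
       + 8 * x * (kernel_coeff k (Suc p) (Suc q) c w * of_nat (Suc a * Suc b))"
    unfolding a_def[symmetric] b_def[symmetric] e of_nat_mult x_def by (simp add: mult_ac del: of_nat_Suc)
  also have "\<dots> = - 2 * C * (of_nat (Suc A) * complex_laguerre (Suc A) m x - x * complex_laguerre (A + 2) m x)"
    unfolding k1 k2 by (simp add: algebra_simps del: of_nat_Suc)
  also have "\<dots> = - 2 * of_nat (k - p) * kernel_coeff k p q c w"
    unfolding complex_laguerre_recurrence[symmetric] k3 e by (simp only: mult_ac)
  finally show ?thesis .
qed

lemma laplacian_laguerre_kernel:
  fixes z w :: "complex^'n"
  assumes "p \<le> k"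
  shows "laplacian (\<lambda>z. laguerre_kernel k p q z w) z
    = (if p = 0 \<or> q = 0 then 0 else - 2 * of_nat (Suc k - p) * laguerre_kernel k (p - 1) (q - 1) z w)"
proof -
  define m where "m = min p q"
  define u where "u = herm z w"
  define v where "v = herm w z"
  define r where "r = herm z z"
  define t1 where "t1 = (\<lambda>c. 4 * of_nat (c * (CARD('n) + p + (q - c) - 1)) * kernel_coeff k p q c w *
      (r ^ (c - 1) * (u ^ (p - c) * v ^ (q - c))))"
  define t2 where "t2 = (\<lambda>c. 4 * of_nat ((p - c) * (q - c)) * herm w w * kernel_coeff k p q c w *
      (r ^ c * (u ^ (p - c - 1) * v ^ (q - c - 1))))"
  have cp: "cpoly (\<lambda>z. herm z z ^ c * (herm z w ^ (p - c) * herm w z ^ (q - c)))" for c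
    by (intro cpoly_intros)
  have "laplacian (\<lambda>z. laguerre_kernel k p q z w) z
     = (\<Sum>c\<le>m. kernel_coeff k p q c w * laplacian (\<lambda>z. herm z z ^ c * (herm z w ^ (p - c) * herm w z ^ (q - c))) z)"
    unfolding laguerre_kernel_def m_def
    by (subst laplacian_sum) (simp_all add: laplacian_cmult[OF cp] cpoly_mult[OF cpoly_const cp])
  also have "\<dots> = (\<Sum>c\<le>m. t1 c + t2 c)"
  proof (rule sum.cong[OF refl])
    fix c assume c: "c \<in> {..m}"
    have "euler_hom ((p - c) * 1 + (q - c) * 1) (\<lambda>z. herm z w ^ (p - c) * herm w z ^ (q - c))"
      by (intro euler_hom_mult euler_hom_power euler_hom_herm)
    note L = laplacian_norm_power_mult[OF this, of c z]
    have n: "CARD('n) + ((p - c) * 1 + (q - c) * 1) + c - 1 = CARD('n) + p + (q - c) - 1"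
      using c by (simp add: m_def)
    show "kernel_coeff k p q c w * laplacian (\<lambda>z. herm z z ^ c * (herm z w ^ (p - c) * herm w z ^ (q - c))) z = t1 c + t2 c"
      unfolding L n laplacian_herm_powers t1_def t2_def u_def v_def r_def distrib_left
      by (simp only: mult_ac)
  qed
  also have "\<dots> = (\<Sum>c\<le>m. t1 c) + (\<Sum>c\<le>m. t2 c)" by (rule sum.distrib)
  also have "(\<Sum>c\<le>m. t1 c) = (\<Sum>c<m. t1 (Suc c))"
    by (simp add: sum.atMost_shift t1_def)
  also have "(\<Sum>c\<le>m. t2 c) = (\<Sum>c<m. t2 c)"
  proof -
    have "(p - m) * (q - m) = 0" by (auto simp: m_def)
    then have "t2 m = 0" unfolding t2_def by (simp only: of_nat_0 mult_zero_left mult_zero_right)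
    then show ?thesis by (simp add: lessThan_Suc_atMost[symmetric])
  qed
  also have "(\<Sum>c<m. t1 (Suc c)) + (\<Sum>c<m. t2 c) = (\<Sum>c<m. t1 (Suc c) + t2 c)"
    by (rule sum.distrib[symmetric])
  also have "\<dots> = (if p = 0 \<or> q = 0 then 0 else - 2 * of_nat (Suc k - p) * laguerre_kernel k (p - 1) (q - 1) z w)"
  proof (cases "p = 0 \<or> q = 0")
    case True
    then have "m = 0" by (auto simp: m_def)
    then show ?thesis using True by simp
  next
    case False
    then obtain p' q' where pq: "p = Suc p'" "q = Suc q'" by (metis not0_implies_Suc)
    have "t1 (Suc c) + t2 c = - 2 * of_nat (k - p') * (kernel_coeff k p' q' c w * (r ^ c * (u ^ (p' - c) * v ^ (q' - c))))"
      if "c \<le> min p' q'" for c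
    proof -
      have e: "Suc p' - Suc c = p' - c" "Suc q' - Suc c = q' - c" "Suc p' - c - 1 = p' - c" "Suc q' - c - 1 = q' - c"
        "Suc p' - c = Suc (p' - c)" "Suc q' - c = Suc (q' - c)" "Suc c - 1 = c"
        "CARD('n) + Suc p' + (q' - c) - 1 = CARD('n) + p' + (q' - c)"
        using that by auto
      have "t1 (Suc c) + t2 c = (4 * of_nat (Suc c * (CARD('n) + p' + (q' - c))) * kernel_coeff k (Suc p') (Suc q') (Suc c) w
        + 4 * of_nat (Suc (p' - c) * Suc (q' - c)) * herm w w * kernel_coeff k (Suc p') (Suc q') c w)
          * (r ^ c * (u ^ (p' - c) * v ^ (q' - c)))"
        unfolding t1_def t2_def pq e distrib_right by (simp only: e diff_Suc_1)
      moreover have "p' < k" "c \<le> p'" "c \<le> q'" using assms that by (auto simp: pq)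
      ultimately show ?thesis
        by (simp only: kernel_coeff_recurrence) (simp only: mult.assoc)
    qed
    moreover have "{..<m} = {..min p' q'}" by (auto simp: m_def pq)
    ultimately have "(\<Sum>c<m. t1 (Suc c) + t2 c)
       = (\<Sum>c\<le>min p' q'. - 2 * of_nat (k - p') * (kernel_coeff k p' q' c w * (r ^ c * (u ^ (p' - c) * v ^ (q' - c)))))"
      by simp
    also have "\<dots> = - 2 * of_nat (k - p') * laguerre_kernel k p' q' z w"
      unfolding laguerre_kernel_def u_def v_def r_def sum_distrib_left ..
    finally show ?thesis by (simp add: pq)
  qed
  finally show ?thesis .
qed

text \<open>
  For fixed \<open>p\<close>, Taylor's formula gives the powers of \<open>u - \<rho>\<close>, and the sum over \<open>q\<close> is the
  exponential identity shifted by the exponent of \<open>\<rho>\<close>.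
\<close>
lemma laguerre_kernel_sums:
  fixes z w :: "complex^'n"
  assumes p: "p \<le> k"
  shows "(\<lambda>q. laguerre_kernel k p q z w) sums
    (((herm z w - herm z z) / 2) ^ p / fact p *
       (exp (herm w z / 2) * complex_laguerre (CARD('n) - 1 + p) (k - p) (herm w w / 2 - herm w z / 2)))"
proof -
  define u where "u = herm z w"
  define v where "v = herm w z"
  define r where "r = herm z z"
  define S where "S = exp (v / 2) * complex_laguerre (CARD('n) - 1 + p) (k - p) (herm w w / 2 - v / 2)"
  define C where "C = (\<lambda>c. (-1) ^ c * r ^ c * u ^ (p - c) / (2 ^ p * fact c * fact (p - c)))"
  define T where "T = (\<lambda>b. (v / 2) ^ b / fact b * complex_laguerre (CARD('n) - 1 + p + b) (k - p) (herm w w / 2))"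
  have bin: "((u - r) / 2) ^ p / fact p = (\<Sum>c\<le>p. C c)"
  proof -
    have "(u - r) ^ p = (\<Sum>c\<le>p. of_nat (p choose c) * (- r) ^ c * u ^ (p - c))"
      using binomial_ring[of "- r" u p] by simp
    then have "((u - r) / 2) ^ p / fact p = (\<Sum>c\<le>p. of_nat (p choose c) * (- r) ^ c * u ^ (p - c) / (2 ^ p * fact p))"
      by (simp add: power_divide sum_divide_distrib)
    also have "\<dots> = (\<Sum>c\<le>p. C c)"
      by (intro sum.cong refl) (simp add: C_def binomial_fact power_minus[of r] mult_ac)
    finally show ?thesis .
  qed
  have T: "T sums S" unfolding T_def S_def by (rule complex_laguerre_exp_sums)
  have "(\<lambda>q. if c \<le> q then C c * T (q - c) else 0) sums (C c * S)" for c
    using sums_zero_iff_shift[of c "\<lambda>q. if c \<le> q then C c * T (q - c) else 0"] sums_mult[OF T, of "C c"]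
    by simp
  then have "(\<lambda>q. \<Sum>c\<le>p. if c \<le> q then C c * T (q - c) else 0) sums (\<Sum>c\<le>p. C c * S)"
    by (intro sums_sum)
  moreover have "(\<Sum>c\<le>p. if c \<le> q then C c * T (q - c) else 0) = laguerre_kernel k p q z w" for q
  proof -
    have "laguerre_kernel k p q z w = (\<Sum>c\<le>min p q. C c * T (q - c))"
      unfolding laguerre_kernel_def u_def[symmetric] v_def[symmetric] r_def[symmetric]
    proof (intro sum.cong refl)
      fix c
      show "kernel_coeff k p q c w * (r ^ c * (u ^ (p - c) * v ^ (q - c))) = C c * T (q - c)"
        unfolding kernel_coeff_def C_def T_def power_add power_divide
        by (simp add: field_simps)
    qed
    also have "\<dots> = (\<Sum>c\<le>p. if c \<le> q then C c * T (q - c) else 0)"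
      by (rule sum.mono_neutral_cong_left) auto
    finally show ?thesis ..
  qed
  ultimately have "(\<lambda>q. laguerre_kernel k p q z w) sums (\<Sum>c\<le>p. C c * S)" by simp
  then show ?thesis
    unfolding u_def[symmetric] v_def[symmetric] r_def[symmetric] bin S_def[symmetric] sum_distrib_right .
qed

lemma sum_laguerre_kernel:
  fixes z w :: "complex^'n"
  shows "(\<Sum>p\<le>k. \<Sum>q. laguerre_kernel k p q z w)
    = exp (herm w z / 2) * complex_laguerre (CARD('n) - 1) k ((herm z z + herm w w - herm z w - herm w z) / 2)"
proof -
  have e: "(herm z z + herm w w - herm z w - herm w z) / 2
    = (herm w w / 2 - herm w z / 2) + (herm z z - herm z w) / 2" by (simp add: field_simps)
  have m: "- ((herm z z - herm z w) / 2) = (herm z w - herm z z) / 2" by (simp add: field_simps)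
  have "(\<Sum>p\<le>k. \<Sum>q. laguerre_kernel k p q z w) = (\<Sum>p\<le>k. ((herm z w - herm z z) / 2) ^ p / fact p *
       (exp (herm w z / 2) * complex_laguerre (CARD('n) - 1 + p) (k - p) (herm w w / 2 - herm w z / 2)))"
    by (intro sum.cong refl sums_unique[symmetric] laguerre_kernel_sums) auto
  also have "\<dots> = exp (herm w z / 2) * (\<Sum>p\<le>k. ((herm z w - herm z z) / 2) ^ p / fact p *
       complex_laguerre (CARD('n) - 1 + p) (k - p) (herm w w / 2 - herm w z / 2))"
    unfolding sum_distrib_left by (intro sum.cong refl) (simp only: mult_ac)
  finally show ?thesis
    unfolding e complex_laguerre_add[of "CARD('n) - 1" k "herm w w / 2 - herm w z / 2"] m .
qed

lemma power_div_fact_le_exp: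
  fixes x :: real
  assumes "x \<ge> 0"
  shows "x ^ n / fact n \<le> exp x"
proof -
  have s: "(\<lambda>i. x ^ i / fact i) sums exp x"
    using exp_converges[of x] by (simp add: field_simps)
  have "(\<Sum>i\<in>{n}. x ^ i / fact i) \<le> (\<Sum>i. x ^ i / fact i)"
    using assms by (intro sum_le_suminf sums_summable[OF s]) auto
  then show ?thesis using sums_unique[OF s] by simp
qed

lemma borel_measurable_kernel_coeff: "kernel_coeff k p q c \<in> borel_measurable borel"
proof -
  have "continuous_on UNIV (kernel_coeff k p q c :: complex^'a \<Rightarrow> complex)"
    unfolding kernel_coeff_def[abs_def] complex_laguerre_def herm_def by (intro continuous_intros) auto
  then show ?thesis by (rule borel_measurable_continuous_onI)
qed

text \<open>
  The power \<open>2^(q-c)\<close> in the bound for the Laguerre polynomial cancels the one in the denominator, so that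
  \<open>1 / fact (q - c)\<close> is left for the summation over \<open>q\<close>.
\<close>
lemma norm_kernel_coeff_le:
  fixes w :: "complex^'n"
  assumes "p \<le> k" "c \<le> p" "c \<le> q"
  shows "norm (kernel_coeff k p q c w) \<le> 2 ^ (CARD('n) + k) * exp (2 * real k * norm w) / fact (q - c)"
proof -
  define t where "t = norm w"
  have t: "t \<ge> 0" by (simp add: t_def)
  have nz: "norm (herm w w / 2) = t\<^sup>2 / 2" by (simp add: herm_self t_def norm_divide norm_power)
  have "1 + t\<^sup>2 / 2 \<le> (1 + t) ^ 2" using t by (simp add: power2_eq_square algebra_simps)
  also have "\<dots> \<le> exp t ^ 2" using t by (intro power_mono exp_ge_add_one_self) auto
  also have "\<dots> = exp (2 * t)" by (simp add: exp_double)
  finally have "(1 + t\<^sup>2 / 2) ^ (k - p) \<le> exp (2 * t) ^ (k - p)" using t by (intro power_mono) auto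
  also have "\<dots> \<le> exp (2 * t) ^ k" using t by (intro power_increasing) auto
  also have "\<dots> = exp (2 * real k * t)" by (simp add: exp_of_nat_mult[symmetric] mult_ac)
  finally have pw: "(1 + t\<^sup>2 / 2) ^ (k - p) \<le> exp (2 * real k * t)" .
  define F :: real where "F = fact (p - c) * fact c"
  have F: "F \<ge> 1" unfolding F_def using mult_mono[OF fact_ge_1 fact_ge_1, of "p - c" c] by simp
  have CN: "CARD('n) - 1 + p + (q - c) + (k - p) \<le> (CARD('n) + k) + (q - c)" using assms by simp
  have "norm (complex_laguerre (CARD('n) - 1 + p + (q - c)) (k - p) (herm w w / 2))
      \<le> 2 ^ (CARD('n) - 1 + p + (q - c) + (k - p)) * (1 + t\<^sup>2 / 2) ^ (k - p)"
    using norm_complex_laguerre_le[of "CARD('n) - 1 + p + (q - c)" "k - p" "herm w w / 2"] unfolding nz .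
  also have "\<dots> \<le> 2 ^ ((CARD('n) + k) + (q - c)) * exp (2 * real k * t)"
    by (intro mult_mono pw power_increasing CN) auto
  finally have cl: "norm (complex_laguerre (CARD('n) - 1 + p + (q - c)) (k - p) (herm w w / 2))
      \<le> 2 ^ (CARD('n) + k) * exp (2 * real k * t) * 2 ^ (q - c)" by (simp add: power_add mult_ac)
  have "norm (kernel_coeff k p q c w) = norm (complex_laguerre (CARD('n) - 1 + p + (q - c)) (k - p) (herm w w / 2))
      / (2 ^ (q - c) * (2 ^ p * F) * fact (q - c))"
    unfolding kernel_coeff_def F_def by (simp add: norm_mult norm_divide norm_power power_add mult_ac)
  also have "\<dots> \<le> (2 ^ (CARD('n) + k) * exp (2 * real k * t) * 2 ^ (q - c)) / (2 ^ (q - c) * (2 ^ p * F) * fact (q - c))"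
    using F by (intro divide_right_mono cl) auto
  also have "\<dots> = (2 ^ (CARD('n) + k) * exp (2 * real k * t)) / (2 ^ p * F) / fact (q - c)"
    by simp
  also have "\<dots> \<le> (2 ^ (CARD('n) + k) * exp (2 * real k * t)) / 1 / fact (q - c)"
  proof (intro divide_right_mono divide_left_mono)
    have "(1::real) * 1 \<le> 2 ^ p * F" using F by (intro mult_mono) auto
    then show "1 \<le> 2 ^ p * F" "0 < 2 ^ p * F * 1" using F by auto
  qed auto
  finally show ?thesis by (simp add: t_def)
qed

text \<open>
  Given \<open>R\<close>, the estimate \<open>y^b / b! \<le> exp (2Ry) / (2R)^b\<close> trades the factorial for the weight \<open>R\<close>, the
  convergence factor \<open>(1/2)^q\<close> and an exponential of \<open>norm w\<close>, which the Gaussian can absorb. Powers of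
  \<open>norm w\<close> are estimated by exponentials as well, so that a single constant \<open>c\<close> serves all \<open>p \<le> k\<close> and
  all \<open>q\<close>.
\<close>
lemma bihom_laguerre_kernel:
  fixes R :: real
  assumes R: "R \<ge> 1"
  shows "\<exists>C c. C \<ge> 0 \<and> (\<forall>p q. p \<le> k \<longrightarrow>
     bihom_kernel p q (laguerre_kernel k p q) (\<lambda>w::complex^'n. C * (1 / 2) ^ q / R ^ (p + q) * exp (c * norm w)))"
proof -
  let ?n = "real CARD('n)"
  define C where "C = real (Suc k) * (2 ^ (CARD('n) + k) * (?n * R) ^ k * (2 * R) ^ k)"
  \<comment> \<open>\<open>2k\<close> for the Laguerre polynomial, \<open>k\<close> for powers of \<open>norm w\<close>, \<open>2nR\<close> for the factorial\<close>
  define e where "e = 3 * real k + 2 * ?n * R"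
  have n1: "?n \<ge> 1" by (simp add: Suc_le_eq)
  have bound: "bihom_kernel p q (laguerre_kernel k p q) (\<lambda>w::complex^'n. C * (1 / 2) ^ q / R ^ (p + q) * exp (e * norm w))"
    if p: "p \<le> k" for p q
  proof -
    define N where "N = (\<lambda>c (w::complex^'n). norm (kernel_coeff k p q c w) * (?n ^ c * ((?n * norm w) ^ (p - c) * (?n * norm w) ^ (q - c))))"
    have "bihom_kernel p q (\<lambda>z w. kernel_coeff k p q c w * (herm z z ^ c * (herm z w ^ (p - c) * herm w z ^ (q - c)))) (N c)"
      if "c \<in> {..min p q}" for c
    proof -
      have "bihom_kernel (1 * c + (1 * (p - c) + 0 * (q - c))) (1 * c + (0 * (p - c) + 1 * (q - c)))
        (\<lambda>z w. kernel_coeff k p q c w * (herm z z ^ c * (herm z w ^ (p - c) * herm w z ^ (q - c)))) (N c)"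
        unfolding N_def
        by (intro bihom_kernel_cmult bihom_kernel_mult bihom_kernel_power bihom_kernel_herm borel_measurable_kernel_coeff)
      then show ?thesis using that by simp
    qed
    then have "bihom_kernel p q (laguerre_kernel k p q) (\<lambda>w. \<Sum>c\<le>min p q. N c w)"
      unfolding laguerre_kernel_def[abs_def] by (rule bihom_kernel_sum)
    then show ?thesis
    proof (rule bihom_kernel_mono)
      fix w :: "complex^'n"
      define t where "t = norm w"
      have t: "t \<ge> 0" by (simp add: t_def)
      define B where "B = 2 ^ (CARD('n) + k) * (?n * R) ^ k * (2 * R) ^ k * (1 / 2) ^ q / R ^ (p + q) * exp (e * t)"
      have B0: "B \<ge> 0" using R by (simp add: B_def)
      have "N c w \<le> B" if c: "c \<le> min p q" for c
      proof -
        define b where "b = q - c"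
        have qb: "q = b + c" using c by (simp add: b_def)
        have "norm (kernel_coeff k p q c w) \<le> 2 ^ (CARD('n) + k) * exp (2 * real k * t) / fact b"
          using norm_kernel_coeff_le[of p k c q w] p c by (simp add: t_def b_def)
        moreover have "?n ^ c * (?n * t) ^ (p - c) \<le> ?n ^ k * exp (real k * t)"
        proof -
          have "?n ^ c * (?n * t) ^ (p - c) = ?n ^ p * t ^ (p - c)"
            using c by (simp add: power_mult_distrib flip: power_add)
          also have "\<dots> \<le> ?n ^ k * (1 + t) ^ k"
          proof (intro mult_mono power_increasing p n1)
            have "t ^ (p - c) \<le> (1 + t) ^ (p - c)" using t by (intro power_mono) auto
            also have "\<dots> \<le> (1 + t) ^ k" using t p by (intro power_increasing) auto
            finally show "t ^ (p - c) \<le> (1 + t) ^ k" .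
          qed (use t in auto)
          also have "\<dots> \<le> ?n ^ k * exp t ^ k"
            using t by (intro mult_left_mono power_mono exp_ge_add_one_self) auto
          finally show ?thesis by (simp add: exp_of_nat_mult[symmetric])
        qed
        moreover have "(?n * t) ^ b / fact b \<le> exp (2 * ?n * R * t) / (2 * R) ^ b"
        proof -
          have "(2 * ?n * R * t) ^ b / fact b \<le> exp (2 * ?n * R * t)"
            using t R by (intro power_div_fact_le_exp) auto
          then show ?thesis using R
            by (simp add: field_simps power_mult_distrib)
        qed
        moreover have "x * y * z \<le> X * Y * W" if "x \<le> X / f" "y \<le> Y" "z / f \<le> W"
          "0 \<le> x" "0 \<le> y" "0 \<le> z" "0 < f" for x y z X Y W f :: real
        proof -
          have "x * y * z \<le> (X / f) * Y * z"
            using that by (intro mult_mono mult_nonneg_nonneg) (auto intro: order_trans)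
          also have "\<dots> = X * Y * (z / f)" by simp
          also have "\<dots> \<le> X * Y * W"
          proof (rule mult_left_mono)
            have "0 \<le> X / f" using that by linarith
            then have "0 \<le> X" using \<open>0 < f\<close> by (simp add: zero_le_divide_iff)
            then show "0 \<le> X * Y" using that by auto
          qed fact
          finally show ?thesis .
        qed
        ultimately have "norm (kernel_coeff k p q c w) * (?n ^ c * (?n * t) ^ (p - c)) * (?n * t) ^ b
           \<le> (2 ^ (CARD('n) + k) * exp (2 * real k * t)) * (?n ^ k * exp (real k * t)) * (exp (2 * ?n * R * t) / (2 * R) ^ b)"
          using t n1 by (meson fact_gt_zero mult_nonneg_nonneg norm_ge_zero of_nat_0_le_iff zero_le_power)
        also have "\<dots> = 2 ^ (CARD('n) + k) * ?n ^ k * exp (e * t) * (1 / (2 * R) ^ b)"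
          by (simp add: e_def exp_add[symmetric] algebra_simps)
        also have "\<dots> \<le> 2 ^ (CARD('n) + k) * ?n ^ k * exp (e * t) * (R ^ k * (2 * R) ^ k * (1 / 2) ^ q / R ^ (p + q))"
        proof (rule mult_left_mono)
          have "(2 * R) ^ c * R ^ p \<le> (2 * R) ^ k * R ^ k"
            using R p c by (intro mult_mono power_increasing) auto
          then have "(2 * R) ^ c * R ^ p / (2 * R) ^ q / R ^ p \<le> (2 * R) ^ k * R ^ k / (2 * R) ^ q / R ^ p"
            using R by (intro divide_right_mono) auto
          moreover have "(2 * R) ^ c * R ^ p / (2 * R) ^ q / R ^ p = 1 / (2 * R) ^ b"
            using R by (simp add: qb power_add)
          moreover have "(2 * R) ^ k * R ^ k / (2 * R) ^ q / R ^ p = R ^ k * (2 * R) ^ k * (1 / 2) ^ q / R ^ (p + q)"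
            using R by (simp add: power_add power_mult_distrib power_divide field_simps)
          ultimately show "1 / (2 * R) ^ b \<le> R ^ k * (2 * R) ^ k * (1 / 2) ^ q / R ^ (p + q)" by simp
        qed simp
        also have "\<dots> = B" by (simp add: B_def power_mult_distrib)
        finally show "N c w \<le> B" by (simp add: N_def t_def b_def mult_ac)
      qed
      then have "(\<Sum>c\<le>min p q. N c w) \<le> real (card {..min p q}) * B"
        by (intro sum_bounded_above) auto
      also have "\<dots> \<le> real (Suc k) * B"
        using p B0 by (intro mult_right_mono) auto
      also have "\<dots> = C * (1 / 2) ^ q / R ^ (p + q) * exp (e * norm w)"
        by (simp add: B_def C_def t_def)
      finally show "(\<Sum>c\<le>min p q. N c w) \<le> C * (1 / 2) ^ q / R ^ (p + q) * exp (e * norm w)" .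
    qed
  qed
  show ?thesis
  proof (intro exI conjI allI impI)
    show "C \<ge> 0" using R by (simp add: C_def)
  qed (rule bound)
qed

section \<open>Gaussian integrals and the twisted convolution\<close>

text \<open>
  Comparison with a sum over concentric balls, whose volumes grow only polynomially.
\<close>
lemma integrable_exp_neg_norm: "integrable lebesgue (\<lambda>w::'a::euclidean_space. exp (- norm w))"
proof -
  define V where "V = unit_ball_vol (real DIM('a))"
  define d where "d = DIM('a)"
  have V: "V \<ge> 0" by (simp add: V_def)
  define a where "a = (\<lambda>m::nat. exp (- real m) * (V * real (Suc m) ^ d))"
  have "summable a"
  proof (rule summable_comparison_test'[where N=0])
    show "summable (\<lambda>m. (V * fact d * 2 ^ d * exp (1/2)) * exp (- 1 / 2) ^ m)"
      by (intro summable_mult summable_geometric) auto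
    fix m
    have "(real (Suc m) / 2) ^ d / fact d \<le> exp (real (Suc m) / 2)"
      by (intro power_div_fact_le_exp) auto
    then have "real (Suc m) ^ d \<le> fact d * 2 ^ d * exp (real (Suc m) / 2)"
      by (simp add: field_simps power_divide)
    then have "a m \<le> exp (- real m) * (V * (fact d * 2 ^ d * exp (real (Suc m) / 2)))"
      unfolding a_def using V by (intro mult_left_mono) auto
    also have "\<dots> = V * fact d * 2 ^ d * exp (- real m + real (Suc m) / 2)"
      by (simp only: exp_add mult_ac)
    also have "- real m + real (Suc m) / 2 = 1 / 2 + real m * (- 1 / 2)" by (simp add: field_simps)
    also have "exp (1 / 2 + real m * (- 1 / 2)) = exp (1 / 2) * exp (- 1 / 2) ^ m"
      by (simp only: exp_add exp_of_nat_mult)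
    finally show "norm (a m) \<le> (V * fact d * 2 ^ d * exp (1/2)) * exp (- 1 / 2) ^ m"
      using V by (simp add: a_def)
  qed
  have "(\<integral>\<^sup>+ w. ennreal (exp (- norm (w::'a))) \<partial>lebesgue)
     \<le> (\<integral>\<^sup>+ w. (\<Sum>m. ennreal (exp (- real m)) * indicator (ball (0::'a) (real (Suc m))) w) \<partial>lebesgue)"
  proof (rule nn_integral_mono)
    fix w :: 'a
    define m where "m = nat \<lfloor>norm w\<rfloor>"
    have "real m = of_int \<lfloor>norm w\<rfloor>" by (simp add: m_def)
    then have m: "real m \<le> norm w" "norm w < real (Suc m)" by (simp_all, linarith+)
    have "ennreal (exp (- norm w)) \<le> ennreal (exp (- real m)) * indicator (ball 0 (real (Suc m))) w"
      using m by (auto simp: dist_norm indicator_def)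
    also have "\<dots> = (\<Sum>i\<in>{m}. ennreal (exp (- real i)) * indicator (ball 0 (real (Suc i))) w)"
      by (subst sum.insert) auto
    also have "\<dots> \<le> (\<Sum>m. ennreal (exp (- real m)) * indicator (ball 0 (real (Suc m))) w)"
      by (intro sum_le_suminf) auto
    finally show "ennreal (exp (- norm w)) \<le> (\<Sum>m. ennreal (exp (- real m)) * indicator (ball 0 (real (Suc m))) w)" .
  qed
  also have "\<dots> = (\<Sum>m. \<integral>\<^sup>+ w. ennreal (exp (- real m)) * indicator (ball (0::'a) (real (Suc m))) w \<partial>lebesgue)"
  proof (rule nn_integral_suminf)
    fix m
    have [measurable]: "ball (0::'a) (real (Suc m)) \<in> sets lebesgue" by (intro sets_completionI_sets) simp
    show "(\<lambda>w. ennreal (exp (- real m)) * indicator (ball (0::'a) (real (Suc m))) w) \<in> borel_measurable lebesgue"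
      by measurable
  qed
  also have "\<dots> = (\<Sum>m. ennreal (a m))"
  proof (rule arg_cong[of _ _ suminf], rule ext)
    fix m
    show "(\<integral>\<^sup>+ w. ennreal (exp (- real m)) * indicator (ball (0::'a) (real (Suc m))) w \<partial>lebesgue) = ennreal (a m)"
      by (simp add: nn_integral_cmult_indicator emeasure_ball a_def V_def d_def ennreal_mult' del: of_nat_Suc)
  qed
  also have "\<dots> = ennreal (suminf a)"
    using V by (intro suminf_ennreal2 \<open>summable a\<close>) (auto simp: a_def)
  also have "\<dots> < \<infinity>" by simp
  finally show ?thesis
    by (intro integrableI_bounded) (auto intro!: measurable_completion borel_measurable_continuous_onI continuous_intros)
qed

lemma integrable_gaussian_exp_norm:
  "integrable lebesgue (\<lambda>w::'a::euclidean_space. exp (- (norm w)\<^sup>2 / 2 + c * norm w))"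
proof (rule Bochner_Integration.integrable_bound)
  show "integrable lebesgue (\<lambda>w::'a. exp ((c + 1)\<^sup>2 / 2) * exp (- norm w))"
    by (intro integrable_mult_right integrable_exp_neg_norm)
  show "(\<lambda>w::'a. exp (- (norm w)\<^sup>2 / 2 + c * norm w)) \<in> borel_measurable lebesgue"
    by (auto intro!: measurable_completion borel_measurable_continuous_onI continuous_intros)
  have "- t\<^sup>2 / 2 + c * t \<le> (c + 1)\<^sup>2 / 2 + - t" for t :: real
    using zero_le_power2[of "t - (c + 1)"] by (simp add: power2_eq_square algebra_simps)
  then show "AE w::'a in lebesgue. norm (exp (- (norm w)\<^sup>2 / 2 + c * norm w)) \<le> norm (exp ((c + 1)\<^sup>2 / 2) * exp (- norm w))"
    by (intro always_eventually allI) (simp only: exp_add[symmetric] norm_exp real_norm_def abs_exp_cancel exp_le_cancel_iff)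
qed

lemma integrable_L2_gaussian:
  fixes f :: "'a::euclidean_space \<Rightarrow> complex"
  assumes [measurable]: "f \<in> borel_measurable lebesgue"
    and "integrable lebesgue (\<lambda>z. (norm (f z))\<^sup>2)"
  shows "integrable lebesgue (\<lambda>w. norm (f w * of_real (exp (- (norm w)\<^sup>2 / 4))) * exp (c * norm w))"
proof (rule Bochner_Integration.integrable_bound)
  show "integrable lebesgue (\<lambda>w::'a. (norm (f w))\<^sup>2 + exp (- (norm w)\<^sup>2 / 2 + (2 * c) * norm w))"
    by (intro Bochner_Integration.integrable_add assms integrable_gaussian_exp_norm)
  have [measurable]: "(\<lambda>w::'a. exp (c * norm w)) \<in> borel_measurable lebesgue"
    "(\<lambda>w::'a. complex_of_real (exp (- (norm w)\<^sup>2 / 4))) \<in> borel_measurable lebesgue"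
    by (auto intro!: measurable_completion borel_measurable_continuous_onI continuous_intros)
  show "(\<lambda>w::'a. norm (f w * of_real (exp (- (norm w)\<^sup>2 / 4))) * exp (c * norm w)) \<in> borel_measurable lebesgue"
    by measurable
  have "norm (f w * of_real (exp (- (norm w)\<^sup>2 / 4))) * exp (c * norm w)
     \<le> (norm (f w))\<^sup>2 + exp (- (norm w)\<^sup>2 / 2 + (2 * c) * norm w)" for w :: 'a
  proof -
    \<comment> \<open>Cauchy's inequality \<open>2 |f| g \<le> |f|\<^sup>2 + g\<^sup>2\<close>, in place of an argument with \<open>L\<^sup>2\<close> norms\<close>
    define g where "g = exp (- (norm w)\<^sup>2 / 4 + c * norm w)"
    have g2: "exp (- (norm w)\<^sup>2 / 2 + (2 * c) * norm w) = g\<^sup>2"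
      unfolding g_def by (simp add: exp_double[symmetric] algebra_simps)
    have "norm (f w * of_real (exp (- (norm w)\<^sup>2 / 4))) * exp (c * norm w) = norm (f w) * g"
      unfolding g_def exp_add by (simp add: norm_mult)
    also have "\<dots> \<le> (norm (f w))\<^sup>2 + g\<^sup>2"
    proof -
      have "0 \<le> norm (f w) * g" by (simp add: g_def)
      then show ?thesis
        using zero_le_power2[of "norm (f w) - g"] unfolding power2_diff by linarith
    qed
    finally show ?thesis unfolding g2 .
  qed
  then show "AE w::'a in lebesgue. norm (norm (f w * of_real (exp (- (norm w)\<^sup>2 / 4))) * exp (c * norm w))
     \<le> norm ((norm (f w))\<^sup>2 + exp (- (norm w)\<^sup>2 / 2 + (2 * c) * norm w))"
    by (intro always_eventually allI) (simp add: abs_of_nonneg)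
qed

lemma integral_lebesgue_reflect:
  fixes h :: "'a::euclidean_space \<Rightarrow> complex"
  assumes [measurable]: "h \<in> borel_measurable lebesgue"
  shows "(LINT w|lebesgue. h (z - w)) = (LINT w|lebesgue. h w)"
proof -
  have T: "(\<lambda>x. z + (\<Sum>j\<in>Basis. (- 1 * (x \<bullet> j)) *\<^sub>R j)) = (\<lambda>x::'a. z - x)"
    by (simp add: sum_negf euclidean_representation)
  have m: "(\<lambda>x::'a. z - x) \<in> lebesgue \<rightarrow>\<^sub>M lebesgue"
    using lebesgue_affine_measurable[of "\<lambda>_. - 1" z] unfolding T by simp
  have "lebesgue = density (distr lebesgue lebesgue (\<lambda>x::'a. z - x)) (\<lambda>_. 1)"
    using lebesgue_affine_euclidean[of "\<lambda>_. - 1" z] unfolding T by simp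
  then have "(LINT w|lebesgue. h w) = (LINT w|distr lebesgue lebesgue (\<lambda>x::'a. z - x). h w)"
    by (simp add: density_1)
  also have "\<dots> = (LINT w|lebesgue. h (z - w))"
    by (rule integral_distr[OF m]) measurable
  finally show ?thesis ..
qed

text \<open>
  After the reflection the exponent is \<open>-(\<rho> + \<sigma> - u - v)/4 + (v - u)/4\<close>, in which \<open>u\<close> cancels.
\<close>
lemma twisted_conv_laguerre:
  fixes f :: "complex^'n \<Rightarrow> complex"
  assumes [measurable]: "f \<in> borel_measurable lebesgue"
  shows "twisted_conv f (laguerre_fun a k) z = exp (- herm z z / 4) *
    (LINT w|lebesgue. (f w * of_real (exp (- (norm w)\<^sup>2 / 4))) *
       (exp (herm w z / 2) * complex_laguerre a k ((herm z z + herm w w - herm z w - herm w z) / 2)))"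
proof -
  define h where "h = (\<lambda>y. f y * laguerre_fun a k (z - y) * exp (\<i> / 2 * of_real (Im (herm z (z - y)))))"
  have c: "continuous_on UNIV (\<lambda>y. laguerre_fun a k (z - y) * exp (\<i> / 2 * of_real (Im (herm z (z - y)))))"
    unfolding laguerre_fun_def laguerre_def herm_def by (intro continuous_intros) auto
  have [measurable]: "(\<lambda>y. laguerre_fun a k (z - y) * exp (\<i> / 2 * of_real (Im (herm z (z - y))))) \<in> borel_measurable lebesgue"
    using borel_measurable_continuous_onI[OF c] by (intro measurable_completion) simp
  have hm: "h \<in> borel_measurable lebesgue"
    unfolding h_def mult.assoc by measurable
  have h: "h y = exp (- herm z z / 4) * ((f y * of_real (exp (- (norm y)\<^sup>2 / 4))) *
       (exp (herm y z / 2) * complex_laguerre a k ((herm z z + herm y y - herm z y - herm y z) / 2)))" for y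
  proof -
    define X where "X = herm z z + herm y y - herm z y - herm y z"
    have m: "herm x (- y) = - herm x y" "herm (- y) x = - herm y x" for x
      by (simp_all add: herm_def sum_negf)
    have X: "of_real ((norm (z - y))\<^sup>2) = X"
      unfolding herm_self[symmetric] X_def diff_conv_add_uminus herm_add_left herm_add_right m by simp
    have "of_real (laguerre a k ((norm (z - y))\<^sup>2 / 2)) = complex_laguerre a k (X / 2)"
      unfolding complex_laguerre_of_real[symmetric] X[symmetric] by simp
    moreover have "of_real (exp (- (norm (z - y))\<^sup>2 / 4)) = exp (- X / 4)"
      unfolding X[symmetric] by (simp add: exp_of_real[symmetric])
    ultimately have 1: "laguerre_fun a k (z - y) = complex_laguerre a k (X / 2) * exp (- X / 4)"
      unfolding laguerre_fun_def by simp
    have "\<i> * of_real (Im (herm z (z - y))) = (herm y z - herm z y) / 2"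
    proof -
      have "Im (herm z (z - y)) = - Im (herm z y)"
        unfolding diff_conv_add_uminus herm_add_right m using herm_self[of z] by simp
      moreover have "herm y z = cnj (herm z y)" by (simp add: cnj_herm)
      ultimately show ?thesis by (simp add: complex_eq_iff)
    qed
    then have 2: "\<i> / 2 * of_real (Im (herm z (z - y))) = (herm y z - herm z y) / 4" by (simp add: mult.commute)
    have 3: "of_real (exp (- (norm y)\<^sup>2 / 4)) = exp (- herm y y / 4)"
      unfolding herm_self by (simp add: exp_of_real[symmetric])
    have 4: "exp (- X / 4) * exp ((herm y z - herm z y) / 4) = exp (- herm z z / 4) * exp (- herm y y / 4) * exp (herm y z / 2)"
      unfolding exp_add[symmetric] by (rule arg_cong[of _ _ exp]) (simp add: X_def field_simps)
    have 5: "f y * (c * E) * E' = f y * c * (E * E')" for c E E' by (simp only: mult_ac)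
    show ?thesis
      unfolding h_def 1 2 3 X_def[symmetric] 5 4 by (simp only: mult_ac)
  qed
  have "twisted_conv f (laguerre_fun a k) z = (LINT w|lebesgue. h (z - w))"
    unfolding twisted_conv_def h_def by simp
  also have "\<dots> = (LINT w|lebesgue. h w)" by (rule integral_lebesgue_reflect[OF hm])
  finally show ?thesis unfolding h by simp
qed

section \<open>Functions with a majorised power series\<close>

definition monomial_degree :: "('a::euclidean_space \<Rightarrow> nat) \<Rightarrow> nat" where
  "monomial_degree \<alpha> = (\<Sum>b\<in>Basis. \<alpha> b)"

definition real_monomial :: "('a::euclidean_space \<Rightarrow> nat) \<Rightarrow> 'a \<Rightarrow> complex" where
  "real_monomial \<alpha> h = of_real (\<Prod>b\<in>Basis. (h \<bullet> b) ^ \<alpha> b)"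

lemma norm_real_monomial_le:
  assumes "norm h \<le> r"
  shows "norm (real_monomial \<alpha> h) \<le> r ^ monomial_degree \<alpha>"
proof -
  have "norm (real_monomial \<alpha> h) = (\<Prod>b\<in>Basis. \<bar>h \<bullet> b\<bar> ^ \<alpha> b)"
    by (simp add: real_monomial_def prod_norm[symmetric] norm_power)
  also have "\<dots> \<le> (\<Prod>b\<in>Basis. r ^ \<alpha> b)"
  proof (intro prod_mono conjI power_mono)
    fix b :: 'a assume "b \<in> Basis"
    then show "\<bar>h \<bullet> b\<bar> \<le> r" using Basis_le_norm[of b h] assms by simp
  qed auto
  finally show ?thesis by (simp add: monomial_degree_def power_sum)
qed

text \<open>
  \<open>F\<close> has a power series at \<open>x\<close> whose coefficients, weighted by powers of \<open>r\<close>, have absolute sum at most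
  \<open>M\<close>. Keeping track of \<open>M\<close> makes it possible to sum infinitely many such functions.
\<close>
definition majorized :: "'a::euclidean_space \<Rightarrow> real \<Rightarrow> ('a \<Rightarrow> complex) \<Rightarrow> real \<Rightarrow> bool" where
  "majorized x r F M \<longleftrightarrow> (\<exists>c.
     (\<lambda>\<alpha>. norm (c \<alpha>) * r ^ monomial_degree \<alpha>) summable_on multi_indices
     \<and> (\<Sum>\<^sub>\<infinity>\<alpha>\<in>multi_indices. norm (c \<alpha>) * r ^ monomial_degree \<alpha>) \<le> M
     \<and> (\<forall>y\<in>ball x r. ((\<lambda>\<alpha>. c \<alpha> * real_monomial \<alpha> (y - x)) has_sum F y) multi_indices))"

lemma real_analytic_majorizedI:
  assumes "\<And>x. \<exists>r>0. \<exists>M. majorized x r F M"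
  shows "real_analytic F"
  using assms unfolding real_analytic_def majorized_def real_monomial_def by meson

lemma majorizedE:
  assumes "majorized x r F M"
  obtains c where "(\<lambda>\<alpha>. norm (c \<alpha>) * r ^ monomial_degree \<alpha>) summable_on multi_indices"
    and "(\<Sum>\<^sub>\<infinity>\<alpha>\<in>multi_indices. norm (c \<alpha>) * r ^ monomial_degree \<alpha>) \<le> M"
    and "\<And>y. y \<in> ball x r \<Longrightarrow> ((\<lambda>\<alpha>. c \<alpha> * real_monomial \<alpha> (y - x)) has_sum F y) multi_indices"
  using assms unfolding majorized_def by blast

lemma majorized_mono: "majorized x r F M \<Longrightarrow> M \<le> M' \<Longrightarrow> majorized x r F M'"
  unfolding majorized_def by (blast intro: order_trans)

lemma majorized_cong: "majorized x r F M \<Longrightarrow> (\<And>y. F y = F' y) \<Longrightarrow> majorized x r F' M"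
  by (simp add: majorized_def)

lemma majorized_nonneg: "r \<ge> 0 \<Longrightarrow> majorized x r F M \<Longrightarrow> M \<ge> 0"
  by (erule majorizedE, rule order_trans[OF infsum_nonneg]) auto

lemma majorized_add:
  assumes r: "r \<ge> 0" and F: "majorized x r F M" and F': "majorized x r F' M'"
  shows "majorized x r (\<lambda>y. F y + F' y) (M + M')"
proof -
  obtain c where c: "(\<lambda>\<alpha>. norm (c \<alpha>) * r ^ monomial_degree \<alpha>) summable_on multi_indices"
    "(\<Sum>\<^sub>\<infinity>\<alpha>\<in>multi_indices. norm (c \<alpha>) * r ^ monomial_degree \<alpha>) \<le> M"
    "\<And>y. y \<in> ball x r \<Longrightarrow> ((\<lambda>\<alpha>. c \<alpha> * real_monomial \<alpha> (y - x)) has_sum F y) multi_indices"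
    by (rule majorizedE[OF F]) blast
  obtain d where d: "(\<lambda>\<alpha>. norm (d \<alpha>) * r ^ monomial_degree \<alpha>) summable_on multi_indices"
    "(\<Sum>\<^sub>\<infinity>\<alpha>\<in>multi_indices. norm (d \<alpha>) * r ^ monomial_degree \<alpha>) \<le> M'"
    "\<And>y. y \<in> ball x r \<Longrightarrow> ((\<lambda>\<alpha>. d \<alpha> * real_monomial \<alpha> (y - x)) has_sum F' y) multi_indices"
    by (rule majorizedE[OF F']) blast
  note s = summable_on_add[OF c(1) d(1)]
  have le: "norm (c \<alpha> + d \<alpha>) * r ^ monomial_degree \<alpha>
      \<le> norm (c \<alpha>) * r ^ monomial_degree \<alpha> + norm (d \<alpha>) * r ^ monomial_degree \<alpha>" for \<alpha>
    using r unfolding distrib_right[symmetric] by (intro mult_right_mono norm_triangle_ineq) auto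
  have s': "(\<lambda>\<alpha>. norm (c \<alpha> + d \<alpha>) * r ^ monomial_degree \<alpha>) summable_on multi_indices"
    by (rule summable_on_comparison_test[OF s]) (use le r in auto)
  show ?thesis
    unfolding majorized_def
  proof (intro exI[of _ "\<lambda>\<alpha>. c \<alpha> + d \<alpha>"] conjI ballI s')
    have "(\<Sum>\<^sub>\<infinity>\<alpha>\<in>multi_indices. norm (c \<alpha> + d \<alpha>) * r ^ monomial_degree \<alpha>)
       \<le> (\<Sum>\<^sub>\<infinity>\<alpha>\<in>multi_indices. norm (c \<alpha>) * r ^ monomial_degree \<alpha> + norm (d \<alpha>) * r ^ monomial_degree \<alpha>)"
      by (intro infsum_mono s s' le)
    also have "\<dots> \<le> M + M'"
      using infsum_add[OF c(1) d(1)] c(2) d(2) by simp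
    finally show "(\<Sum>\<^sub>\<infinity>\<alpha>\<in>multi_indices. norm (c \<alpha> + d \<alpha>) * r ^ monomial_degree \<alpha>) \<le> M + M'" .
    fix y assume y: "y \<in> ball x r"
    show "((\<lambda>\<alpha>. (c \<alpha> + d \<alpha>) * real_monomial \<alpha> (y - x)) has_sum F y + F' y) multi_indices"
      unfolding distrib_right by (intro has_sum_add c(3) d(3) y)
  qed
qed

lemma majorized_cmult:
  assumes F: "majorized x r F M"
  shows "majorized x r (\<lambda>y. k * F y) (norm k * M)"
proof -
  obtain c where c: "(\<lambda>\<alpha>. norm (c \<alpha>) * r ^ monomial_degree \<alpha>) summable_on multi_indices"
    "(\<Sum>\<^sub>\<infinity>\<alpha>\<in>multi_indices. norm (c \<alpha>) * r ^ monomial_degree \<alpha>) \<le> M"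
    "\<And>y. y \<in> ball x r \<Longrightarrow> ((\<lambda>\<alpha>. c \<alpha> * real_monomial \<alpha> (y - x)) has_sum F y) multi_indices"
    by (rule majorizedE[OF F]) blast
  show ?thesis
    unfolding majorized_def
  proof (intro exI[of _ "\<lambda>\<alpha>. k * c \<alpha>"] conjI ballI)
    show "(\<lambda>\<alpha>. norm (k * c \<alpha>) * r ^ monomial_degree \<alpha>) summable_on multi_indices"
      unfolding norm_mult mult.assoc by (intro summable_on_cmult_right c)
    show "(\<Sum>\<^sub>\<infinity>\<alpha>\<in>multi_indices. norm (k * c \<alpha>) * r ^ monomial_degree \<alpha>) \<le> norm k * M"
      unfolding norm_mult mult.assoc using c(2) by (simp add: infsum_cmult_right' mult_left_mono)
    fix y assume y: "y \<in> ball x r"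
    show "((\<lambda>\<alpha>. k * c \<alpha> * real_monomial \<alpha> (y - x)) has_sum k * F y) multi_indices"
      unfolding mult.assoc by (intro has_sum_cmult_right c(3) y)
  qed
qed

lemma majorized_const: "majorized x r (\<lambda>y. k) (norm k)"
proof -
  define c where "c = (\<lambda>\<alpha>::'a \<Rightarrow> nat. if \<alpha> = (\<lambda>_. 0) then k else 0)"
  have z: "(\<lambda>_. 0) \<in> (multi_indices :: ('a \<Rightarrow> nat) set)" by (simp add: multi_indices_def)
  have n: "((\<lambda>\<alpha>. norm (c \<alpha>) * r ^ monomial_degree \<alpha>) has_sum norm k) multi_indices"
    by (rule has_sum_finite_neutralI[of "{\<lambda>_. 0}"]) (auto simp: c_def monomial_degree_def z)
  show ?thesis
    unfolding majorized_def
  proof (intro exI[of _ c] conjI ballI)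
    show "((\<lambda>\<alpha>. c \<alpha> * real_monomial \<alpha> (y - x)) has_sum k) multi_indices" for y
      by (rule has_sum_finite_neutralI[of "{\<lambda>_. 0}"]) (auto simp: c_def real_monomial_def z)
  qed (use n in \<open>auto simp: has_sum_imp_summable infsumI\<close>)
qed

lemma majorized_sum:
  assumes r: "r \<ge> 0" and "\<And>i. i \<in> I \<Longrightarrow> majorized x r (F i) (M i)"
  shows "majorized x r (\<lambda>y. \<Sum>i\<in>I. F i y) (\<Sum>i\<in>I. M i)"
  using assms(2)
proof (induction I rule: infinite_finite_induct)
  case (insert i I)
  then show ?case using majorized_add[OF r, of x "F i" "M i"] by simp
qed (use majorized_const[of x r 0] in auto)

text \<open>
  Multiplication by a coordinate of \<open>y - x\<close> shifts the multi-indices. Products of coordinates are the only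
  products that are needed, so Cauchy products of general power series can be avoided.
\<close>
lemma majorized_shift_coordinate:
  fixes x b :: "'a::euclidean_space"
  assumes r: "r \<ge> 0" and b: "b \<in> Basis" and F: "majorized x r F M"
  shows "majorized x r (\<lambda>y. of_real ((y - x) \<bullet> b) * F y) (r * M)"
proof -
  obtain c where c: "(\<lambda>\<alpha>. norm (c \<alpha>) * r ^ monomial_degree \<alpha>) summable_on multi_indices"
    "(\<Sum>\<^sub>\<infinity>\<alpha>\<in>multi_indices. norm (c \<alpha>) * r ^ monomial_degree \<alpha>) \<le> M"
    "\<And>y. y \<in> ball x r \<Longrightarrow> ((\<lambda>\<alpha>. c \<alpha> * real_monomial \<alpha> (y - x)) has_sum F y) multi_indices"
    by (rule majorizedE[OF F]) blast
  define up where "up = (\<lambda>\<alpha>::'a \<Rightarrow> nat. \<alpha>(b := Suc (\<alpha> b)))"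
  define dn where "dn = (\<lambda>\<alpha>::'a \<Rightarrow> nat. \<alpha>(b := \<alpha> b - 1))"
  define A where "A = {\<alpha>\<in>multi_indices. \<alpha> b > 0}"
  define d where "d = (\<lambda>\<alpha>. if \<alpha> b > 0 then c (dn \<alpha>) else 0)"
  have bij: "bij_betw up multi_indices A"
    by (rule bij_betwI[of _ _ _ dn]) (use b in \<open>auto simp: up_def dn_def A_def multi_indices_def\<close>)
  have du: "d (up \<alpha>) = c \<alpha>" for \<alpha> by (simp add: d_def up_def dn_def)
  have deg: "monomial_degree (up \<alpha>) = Suc (monomial_degree \<alpha>)" for \<alpha>
    unfolding monomial_degree_def up_def using b by (simp add: sum.remove[of _ b])
  have rm: "real_monomial (up \<alpha>) h = of_real (h \<bullet> b) * real_monomial \<alpha> h" for \<alpha> h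
    unfolding real_monomial_def up_def using b by (simp add: prod.remove[of _ b])
  have reindex: "(g has_sum S) multi_indices" if "((\<lambda>\<alpha>. g (up \<alpha>)) has_sum S) multi_indices" "\<And>\<alpha>. \<alpha> b = 0 \<Longrightarrow> g \<alpha> = 0"
    for g :: "_ \<Rightarrow> 'c::{topological_comm_monoid_add,t2_space}" and S
  proof -
    have "(g has_sum S) A" using that(1) unfolding has_sum_reindex_bij_betw[OF bij] .
    then show ?thesis
      by (rule has_sum_cong_neutral[THEN iffD1, rotated -1]) (auto simp: A_def that(2))
  qed
  have n: "((\<lambda>\<alpha>. norm (d \<alpha>) * r ^ monomial_degree \<alpha>) has_sum
      (r * (\<Sum>\<^sub>\<infinity>\<alpha>\<in>multi_indices. norm (c \<alpha>) * r ^ monomial_degree \<alpha>))) multi_indices"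
  proof (rule reindex)
    have "((\<lambda>\<alpha>. r * (norm (c \<alpha>) * r ^ monomial_degree \<alpha>)) has_sum
      (r * (\<Sum>\<^sub>\<infinity>\<alpha>\<in>multi_indices. norm (c \<alpha>) * r ^ monomial_degree \<alpha>))) multi_indices"
      by (intro has_sum_cmult_right has_sum_infsum c)
    then show "((\<lambda>\<alpha>. norm (d (up \<alpha>)) * r ^ monomial_degree (up \<alpha>)) has_sum
      (r * (\<Sum>\<^sub>\<infinity>\<alpha>\<in>multi_indices. norm (c \<alpha>) * r ^ monomial_degree \<alpha>))) multi_indices"
      unfolding du deg power_Suc by (simp only: mult_ac)
  qed (simp add: d_def)
  show ?thesis
    unfolding majorized_def
  proof (intro exI[of _ d] conjI ballI)
    show "(\<lambda>\<alpha>. norm (d \<alpha>) * r ^ monomial_degree \<alpha>) summable_on multi_indices"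
      by (rule has_sum_imp_summable[OF n])
    show "(\<Sum>\<^sub>\<infinity>\<alpha>\<in>multi_indices. norm (d \<alpha>) * r ^ monomial_degree \<alpha>) \<le> r * M"
      unfolding infsumI[OF n] using c(2) r by (intro mult_left_mono)
    fix y assume y: "y \<in> ball x r"
    show "((\<lambda>\<alpha>. d \<alpha> * real_monomial \<alpha> (y - x)) has_sum of_real ((y - x) \<bullet> b) * F y) multi_indices"
    proof (rule reindex)
      have "((\<lambda>\<alpha>. of_real ((y - x) \<bullet> b) * (c \<alpha> * real_monomial \<alpha> (y - x))) has_sum of_real ((y - x) \<bullet> b) * F y) multi_indices"
        by (intro has_sum_cmult_right c(3) y)
      then show "((\<lambda>\<alpha>. d (up \<alpha>) * real_monomial (up \<alpha>) (y - x)) has_sum of_real ((y - x) \<bullet> b) * F y) multi_indices"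
        unfolding du rm by (simp only: mult_ac)
    qed (simp add: d_def)
  qed
qed

lemma majorized_coordinate:
  assumes r: "r \<ge> 0" and b: "b \<in> Basis" and F: "majorized x r F M"
  shows "majorized x r (\<lambda>y. of_real (y \<bullet> b) * F y) ((norm x + r) * M)"
proof -
  have "majorized x r (\<lambda>y. of_real (x \<bullet> b) * F y + of_real ((y - x) \<bullet> b) * F y)
      (norm (of_real (x \<bullet> b) :: complex) * M + r * M)"
    by (intro majorized_add r majorized_cmult majorized_shift_coordinate b F)
  moreover have "norm (of_real (x \<bullet> b) :: complex) * M + r * M \<le> (norm x + r) * M"
    using Basis_le_norm[OF b, of x] majorized_nonneg[OF r F] by (simp add: distrib_right mult_right_mono)
  moreover have "of_real (x \<bullet> b) * F y + of_real ((y - x) \<bullet> b) * F y = of_real (y \<bullet> b) * F y" for y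
    by (simp add: inner_diff_left algebra_simps)
  ultimately show ?thesis by (metis (no_types, lifting) majorized_cong majorized_mono)
qed

text \<open>
  Completeness of the weighted sum norm: the double family of coefficients is absolutely summable, so the
  order of summation can be exchanged.
\<close>
lemma majorized_suminf:
  assumes r: "r > 0" and F: "\<And>i::nat. majorized x r (F i) (M i)" and M: "summable M"
    and S: "\<And>y. y \<in> ball x r \<Longrightarrow> (\<lambda>i. F i y) sums S y"
  shows "majorized x r S (suminf M)"
proof -
  have "\<forall>i. \<exists>c. (\<lambda>\<alpha>. norm (c \<alpha>) * r ^ monomial_degree \<alpha>) summable_on multi_indices
     \<and> (\<Sum>\<^sub>\<infinity>\<alpha>\<in>multi_indices. norm (c \<alpha>) * r ^ monomial_degree \<alpha>) \<le> M i
     \<and> (\<forall>y\<in>ball x r. ((\<lambda>\<alpha>. c \<alpha> * real_monomial \<alpha> (y - x)) has_sum F i y) multi_indices)"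
    using F unfolding majorized_def by blast
  from choice[OF this] obtain c
    where c1: "\<And>i. (\<lambda>\<alpha>. norm (c i \<alpha>) * r ^ monomial_degree \<alpha>) summable_on multi_indices"
      and c2: "\<And>i. (\<Sum>\<^sub>\<infinity>\<alpha>\<in>multi_indices. norm (c i \<alpha>) * r ^ monomial_degree \<alpha>) \<le> M i"
      and c3: "\<And>i y. y \<in> ball x r \<Longrightarrow> ((\<lambda>\<alpha>. c i \<alpha> * real_monomial \<alpha> (y - x)) has_sum F i y) multi_indices"
    by blast
  define I where "I = (multi_indices :: ('a \<Rightarrow> nat) set)"
  define f where "f = (\<lambda>(i, \<alpha>). norm (c i \<alpha>) * r ^ monomial_degree \<alpha>)"
  define s where "s = (\<lambda>i. \<Sum>\<^sub>\<infinity>\<alpha>\<in>I. f (i, \<alpha>))"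
  have f0: "f p \<ge> 0" for p using r by (auto simp: f_def split: prod.split)
  have s0: "s i \<ge> 0" for i unfolding s_def by (intro infsum_nonneg f0)
  have sM: "s i \<le> M i" for i using c2[of i] by (simp add: s_def f_def I_def)
  have s_summable: "summable s"
    by (rule summable_comparison_test'[OF M]) (use s0 sM in auto)
  have s_has: "(s has_sum suminf s) UNIV"
    using s_summable s0 by (simp add: norm_summable_imp_has_sum summable_sums)
  have f_abs: "(\<lambda>p. norm (f p)) summable_on UNIV \<times> I"
    unfolding Infinite_Sum.abs_summable_on_Sigma_iff
  proof (intro conjI ballI)
    show "(\<lambda>\<alpha>. norm (f (i, \<alpha>))) summable_on I" for i
      using c1[of i] r by (simp add: f_def I_def abs_mult)
    have "(\<Sum>\<^sub>\<infinity>\<alpha>\<in>I. norm (f (i, \<alpha>))) = s i" for i using f0 by (simp add: s_def)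
    then show "(\<lambda>i. norm (\<Sum>\<^sub>\<infinity>\<alpha>\<in>I. norm (f (i, \<alpha>)))) summable_on UNIV"
      using has_sum_imp_summable[OF s_has] s0 by simp
  qed
  then have f_sum: "f summable_on UNIV \<times> I" by (rule abs_summable_summable)
  have f_has: "(f has_sum suminf s) (UNIV \<times> I)"
  proof (rule has_sum_SigmaI[OF _ s_has f_sum])
    show "((\<lambda>\<alpha>. f (i, \<alpha>)) has_sum s i) I" for i
      unfolding s_def using c1[of i] by (intro has_sum_infsum) (simp add: f_def I_def)
  qed
  define h where "h = (\<lambda>\<alpha>. \<Sum>\<^sub>\<infinity>i\<in>UNIV. f (i, \<alpha>))"
  have f_swap: "((\<lambda>(\<alpha>, i). f (i, \<alpha>)) has_sum suminf s) (I \<times> UNIV)"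
    using f_has by (simp only: has_sum_swap[of f])
  have f_col: "(\<lambda>i. f (i, \<alpha>)) summable_on UNIV" if "\<alpha> \<in> I" for \<alpha>
    using summable_on_SigmaD1[of "\<lambda>\<alpha> i. f (i, \<alpha>)" I "\<lambda>_. UNIV" \<alpha>] has_sum_imp_summable[OF f_swap] that by simp
  have h_has: "(h has_sum suminf s) I"
    using f_swap by (rule has_sum_SigmaD) (auto simp: h_def intro!: has_sum_infsum f_col)
  define d where "d = (\<lambda>\<alpha>. \<Sum>\<^sub>\<infinity>i\<in>UNIV. c i \<alpha>)"
  have c_abs: "(\<lambda>i. norm (c i \<alpha>)) summable_on UNIV" if "\<alpha> \<in> I" for \<alpha>
  proof -
    have "(\<lambda>i. f (i, \<alpha>) * (1 / r ^ monomial_degree \<alpha>)) summable_on UNIV"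
      by (intro summable_on_cmult_left f_col that)
    then show ?thesis using r by (simp add: f_def)
  qed
  have d_has: "((\<lambda>i. c i \<alpha>) has_sum d \<alpha>) UNIV" if "\<alpha> \<in> I" for \<alpha>
    unfolding d_def by (rule has_sum_infsum[OF abs_summable_summable[OF c_abs[OF that]]])
  have dh: "norm (d \<alpha>) * r ^ monomial_degree \<alpha> \<le> h \<alpha>" if "\<alpha> \<in> I" for \<alpha>
  proof -
    have "norm (d \<alpha>) \<le> (\<Sum>\<^sub>\<infinity>i\<in>UNIV. norm (c i \<alpha>))"
      unfolding d_def by (rule norm_infsum_bound[OF c_abs[OF that]])
    then have "norm (d \<alpha>) * r ^ monomial_degree \<alpha> \<le> (\<Sum>\<^sub>\<infinity>i\<in>UNIV. norm (c i \<alpha>)) * r ^ monomial_degree \<alpha>"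
      using r by (intro mult_right_mono) auto
    also have "\<dots> = h \<alpha>" by (simp add: h_def f_def infsum_cmult_left')
    finally show ?thesis .
  qed
  have d_sum: "(\<lambda>\<alpha>. norm (d \<alpha>) * r ^ monomial_degree \<alpha>) summable_on I"
    by (rule summable_on_comparison_test[OF has_sum_imp_summable[OF h_has]]) (use dh r in auto)
  show ?thesis
    unfolding majorized_def I_def[symmetric]
  proof (intro exI[of _ d] conjI ballI d_sum)
    have "(\<Sum>\<^sub>\<infinity>\<alpha>\<in>I. norm (d \<alpha>) * r ^ monomial_degree \<alpha>) \<le> (\<Sum>\<^sub>\<infinity>\<alpha>\<in>I. h \<alpha>)"
      by (intro infsum_mono d_sum has_sum_imp_summable[OF h_has] dh)
    also have "\<dots> = suminf s" by (rule infsumI[OF h_has])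
    also have "\<dots> \<le> suminf M" by (intro suminf_le sM s_summable M)
    finally show "(\<Sum>\<^sub>\<infinity>\<alpha>\<in>I. norm (d \<alpha>) * r ^ monomial_degree \<alpha>) \<le> suminf M" .
    fix y assume y: "y \<in> ball x r"
    define g where "g = (\<lambda>(i, \<alpha>). c i \<alpha> * real_monomial \<alpha> (y - x))"
    have gf: "norm (g p) \<le> norm (f p)" for p
    proof -
      obtain i \<alpha> where p: "p = (i, \<alpha>)" by (cases p)
      have "norm (y - x) \<le> r" using y by (simp add: dist_norm norm_minus_commute)
      then have "norm (g p) \<le> f p"
        unfolding p g_def f_def by (simp add: norm_mult mult_left_mono norm_real_monomial_le)
      then show ?thesis by simp
    qed
    have "(\<lambda>p. norm (g p)) summable_on UNIV \<times> I"
      by (rule Infinite_Sum.abs_summable_on_comparison_test[OF f_abs gf])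
    then have "g summable_on UNIV \<times> I" by (rule abs_summable_summable)
    then have g_has: "(g has_sum infsum g (UNIV \<times> I)) (UNIV \<times> I)" by (rule has_sum_infsum)
    have "((\<lambda>i. F i y) has_sum infsum g (UNIV \<times> I)) UNIV"
      using g_has by (rule has_sum_SigmaD) (use c3[OF y] in \<open>simp add: g_def I_def\<close>)
    then have "(\<lambda>i. F i y) sums infsum g (UNIV \<times> I)" by (rule has_sum_imp_sums)
    then have gS: "infsum g (UNIV \<times> I) = S y" using S[OF y] sums_unique2 by blast
    have "((\<lambda>(\<alpha>, i). g (i, \<alpha>)) has_sum S y) (I \<times> UNIV)"
      using g_has unfolding gS by (simp only: has_sum_swap[of g])
    then show "((\<lambda>\<alpha>. d \<alpha> * real_monomial \<alpha> (y - x)) has_sum S y) I"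
      by (rule has_sum_SigmaD) (auto simp: g_def intro!: has_sum_cmult_left d_has)
  qed
qed

lemma majorized_vec_coordinate:
  fixes F :: "complex^'n \<Rightarrow> complex"
  assumes r: "r \<ge> 0" and F: "majorized x r F M"
  shows "majorized x r (\<lambda>z. z $ j * F z) (2 * (norm x + r) * M)"
    and "majorized x r (\<lambda>z. cnj (z $ j) * F z) (2 * (norm x + r) * M)"
proof -
  have re: "z \<bullet> axis j 1 = Re (z $ j)" and im: "z \<bullet> axis j \<i> = Im (z $ j)" for z :: "complex^'n"
    by (simp_all add: inner_axis inner_complex_def)
  have B: "axis j 1 \<in> (Basis :: (complex^'n) set)" "axis j \<i> \<in> (Basis :: (complex^'n) set)"
    by (simp_all add: Basis_complex_def)
  have *: "majorized x r (\<lambda>z. of_real (z \<bullet> axis j 1) * F z + k * (of_real (z \<bullet> axis j \<i>) * F z)) (2 * (norm x + r) * M)"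
    if "norm k = 1" for k
  proof -
    have "majorized x r (\<lambda>z. of_real (z \<bullet> axis j 1) * F z + k * (of_real (z \<bullet> axis j \<i>) * F z))
       ((norm x + r) * M + norm k * ((norm x + r) * M))"
      by (intro majorized_add majorized_cmult majorized_coordinate r B F)
    moreover have "(norm x + r) * M + norm k * ((norm x + r) * M) = 2 * (norm x + r) * M"
      unfolding that by simp
    ultimately show ?thesis by (simp only:)
  qed
  show "majorized x r (\<lambda>z. z $ j * F z) (2 * (norm x + r) * M)"
    by (rule majorized_cong[OF *[of \<i>]]) (simp_all add: re im complex_eq[symmetric] mult.assoc[symmetric] distrib_right[symmetric])
  show "majorized x r (\<lambda>z. cnj (z $ j) * F z) (2 * (norm x + r) * M)"
    by (rule majorized_cong[OF *[of "-\<i>"]])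
       (simp_all add: re im mult.assoc[symmetric] left_diff_distrib[symmetric], simp add: complex_eq_iff)
qed

lemma majorized_mult_prod:
  assumes "\<And>j F M. majorized x r F M \<Longrightarrow> majorized x r (\<lambda>z. g j z * F z) (R * M)"
    and "finite J" and "majorized x r F M"
  shows "majorized x r (\<lambda>z. (\<Prod>j\<in>J. g j z ^ e j) * F z) (R ^ (\<Sum>j\<in>J. e j) * M)"
  using assms(2)
proof (induction J rule: finite_induct)
  case empty
  then show ?case using assms(3) by simp
next
  case (insert i J)
  have "majorized x r (\<lambda>z. g i z ^ k * ((\<Prod>j\<in>J. g j z ^ e j) * F z)) (R ^ k * (R ^ (\<Sum>j\<in>J. e j) * M))" for k
  proof (induction k)
    case (Suc k)
    from assms(1)[OF this, of i] show ?case by (simp add: mult.assoc)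
  qed (use insert.IH in simp)
  from this[of "e i"] show ?case
    using insert.hyps by (simp add: power_add mult.assoc)
qed

lemma majorized_bihom:
  fixes P :: "complex^'n \<Rightarrow> complex"
  assumes r: "r \<ge> 0" and P: "bihom p q P M"
  shows "majorized x r P (M * (2 * (norm x + r)) ^ (p + q))"
proof -
  let ?E = "bi_exponents p q :: (('n \<Rightarrow> nat) \<times> ('n \<Rightarrow> nat)) set"
  define R where "R = 2 * (norm x + r)"
  obtain c where "\<And>y. c y \<in> borel_measurable borel"
    and n: "\<And>w::real. (\<Sum>y\<in>?E. norm (c y w)) \<le> M"
    and e: "\<And>z w::real. P z = (\<Sum>y\<in>?E. c y w * bi_monomial y z)"
    by (rule bihom_kernelE[OF P]) blast
  have zm: "majorized x r (bi_monomial y) (R ^ (p + q))" if "y \<in> ?E" for y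
  proof -
    have y: "(\<Sum>j\<in>UNIV. fst y j) = p" "(\<Sum>j\<in>UNIV. snd y j) = q"
      using that by (auto simp: bi_exponents_def exponents_of_degree_def)
    have "majorized x r (\<lambda>z. (\<Prod>j\<in>UNIV. (z $ j) ^ fst y j) * ((\<Prod>j\<in>UNIV. cnj (z $ j) ^ snd y j) * 1))
      (R ^ (\<Sum>j\<in>UNIV. fst y j) * (R ^ (\<Sum>j\<in>UNIV. snd y j) * norm (1::complex)))"
      unfolding R_def
      by (intro majorized_mult_prod[where g="\<lambda>j z. z $ j"] majorized_mult_prod[where g="\<lambda>j z. cnj (z $ j)"]
          majorized_vec_coordinate r majorized_const finite)
    then show ?thesis unfolding y by (simp add: bi_monomial_def[abs_def] power_add)
  qed
  have "majorized x r (\<lambda>z. \<Sum>y\<in>?E. c y 0 * bi_monomial y z) (\<Sum>y\<in>?E. norm (c y 0) * R ^ (p + q))"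
    by (intro majorized_sum r majorized_cmult zm)
  then have "majorized x r P (\<Sum>y\<in>?E. norm (c y 0) * R ^ (p + q))"
    by (rule majorized_cong) (simp add: e[of _ 0])
  then show ?thesis
    unfolding R_def[symmetric]
  proof (rule majorized_mono)
    show "(\<Sum>y\<in>?E. norm (c y 0) * R ^ (p + q)) \<le> M * R ^ (p + q)"
      unfolding sum_distrib_right[symmetric] using n[of 0] r by (intro mult_right_mono) (auto simp: R_def)
  qed
qed

text \<open>
  The Gaussian is expanded in powers of \<open>\<rho>\<close>, and \<open>\<rho>\<close> is a sum of products of coordinates.
\<close>
lemma majorized_gaussian_mult:
  fixes F :: "complex^'n \<Rightarrow> complex"
  assumes r: "r > 0" and F: "majorized x r F M"
  shows "\<exists>M'. majorized x r (\<lambda>z. exp (- herm z z / 4) * F z) M'"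
proof -
  define R where "R = real CARD('n) * ((2 * (norm x + r)) * (2 * (norm x + r)))"
  have r0: "r \<ge> 0" using r by simp
  have step: "majorized x r (\<lambda>z. herm z z * H z) (R * N)" if "majorized x r H N" for H N
  proof -
    have "majorized x r (\<lambda>z. \<Sum>j\<in>UNIV. z $ j * (cnj (z $ j) * H z)) (\<Sum>j\<in>(UNIV::'n set). 2 * (norm x + r) * (2 * (norm x + r) * N))"
      by (intro majorized_sum r0 majorized_vec_coordinate that)
    moreover have "(\<Sum>j\<in>UNIV. z $ j * (cnj (z $ j) * H z)) = herm z z * H z" for z
      by (simp add: herm_def sum_distrib_right mult.assoc)
    moreover have "(\<Sum>j\<in>(UNIV::'n set). 2 * (norm x + r) * (2 * (norm x + r) * N)) = R * N"
      by (simp add: R_def)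
    ultimately show ?thesis by (simp only:)
  qed
  have pw: "majorized x r (\<lambda>z. herm z z ^ m * F z) (R ^ m * M)" for m
  proof (induction m)
    case (Suc m)
    from step[OF this] show ?case by (simp add: mult.assoc)
  qed (use F in simp)
  have "majorized x r (\<lambda>z. exp (- herm z z / 4) * F z) (\<Sum>m. norm ((- 1 / 4) ^ m / fact m :: complex) * (R ^ m * M))"
  proof (rule majorized_suminf[OF r])
    show "majorized x r (\<lambda>z. (- 1 / 4) ^ m / fact m * (herm z z ^ m * F z)) (norm ((- 1 / 4) ^ m / fact m :: complex) * (R ^ m * M))" for m
      by (intro majorized_cmult pw)
    have "summable (\<lambda>m. (R / 4) ^ m / fact m * M)"
      using exp_converges[of "R / 4"] by (intro summable_mult2 sums_summable) (simp add: field_simps)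
    then show "summable (\<lambda>m. norm ((- 1 / 4) ^ m / fact m :: complex) * (R ^ m * M))"
      by (simp add: norm_divide norm_power power_divide field_simps)
    fix z :: "complex^'n"
    have "(\<lambda>m. (- herm z z / 4) ^ m / fact m) sums exp (- herm z z / 4)"
      using exp_converges[of "- herm z z / 4"] by (simp add: scaleR_conv_of_real field_simps)
    then have "(\<lambda>m. (- herm z z / 4) ^ m / fact m * F z) sums (exp (- herm z z / 4) * F z)"
      by (rule sums_mult2)
    moreover have "(- herm z z / 4) ^ m / fact m * F z = (- 1 / 4) ^ m / fact m * (herm z z ^ m * F z)" for m
    proof -
      have "(- herm z z / 4) ^ m = (- 1 / 4) ^ m * herm z z ^ m"
        unfolding power_mult_distrib[symmetric] by simp
      then show ?thesis by simp
    qed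
    ultimately show "(\<lambda>m. (- 1 / 4) ^ m / fact m * (herm z z ^ m * F z)) sums (exp (- herm z z / 4) * F z)"
      by (simp only:)
  qed
  then show ?thesis by blast
qed

section \<open>The expansion of the twisted convolution\<close>

lemma laguerre_fun_complex_laguerre: "laguerre_fun a k z = complex_laguerre a k (herm z z / 2) * exp (- herm z z / 4)"
proof -
  have "of_real (laguerre a k ((norm z)\<^sup>2 / 2)) = complex_laguerre a k (herm z z / 2)"
    unfolding complex_laguerre_of_real[symmetric] herm_self by simp
  moreover have "of_real (exp (- (norm z)\<^sup>2 / 4)) = exp (- herm z z / 4)"
    unfolding herm_self by (simp add: exp_of_real[symmetric])
  ultimately show ?thesis unfolding laguerre_fun_def by simp
qed

locale square_integrable =
  fixes f :: "complex^'n \<Rightarrow> complex" and k :: nat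
  assumes f_measurable [measurable]: "f \<in> borel_measurable lebesgue"
    and f_square_integrable: "integrable lebesgue (\<lambda>z. (norm (f z))\<^sup>2)"
begin

definition weighted :: "complex^'n \<Rightarrow> complex" where
  "weighted w = f w * of_real (exp (- (norm w)\<^sup>2 / 4))"

text \<open>
  The part of bidegree \<open>(p, q)\<close> of \<open>exp (\<rho>/4) Q\<close>.
\<close>
definition component :: "nat \<Rightarrow> nat \<Rightarrow> complex^'n \<Rightarrow> complex" where
  "component p q z = (LINT w|lebesgue. weighted w * laguerre_kernel k p q z w)"

lemma weighted_measurable [measurable]: "weighted \<in> borel_measurable lebesgue"
proof -
  have [measurable]: "(\<lambda>w::complex^'n. complex_of_real (exp (- (norm w)\<^sup>2 / 4))) \<in> borel_measurable lebesgue"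
    by (auto intro!: measurable_completion borel_measurable_continuous_onI continuous_intros)
  show ?thesis unfolding weighted_def[abs_def] by measurable
qed

lemma weighted_integrable: "integrable lebesgue (\<lambda>w. norm (weighted w) * (a * exp (c * norm w)))"
proof -
  have "integrable lebesgue (\<lambda>w. a * (norm (weighted w) * exp (c * norm w)))"
    unfolding weighted_def by (intro integrable_mult_right integrable_L2_gaussian f_measurable f_square_integrable)
  then show ?thesis by (simp only: mult_ac)
qed

lemma component_bihom:
  assumes R: "R \<ge> 1"
  shows "\<exists>B. \<forall>p q. p \<le> k \<longrightarrow> bihom p q (component p q) (B * (1 / 2) ^ q / R ^ (p + q))"
proof -
  obtain C c where "C \<ge> 0" and K0: "\<forall>p q. p \<le> k \<longrightarrow>
     bihom_kernel p q (laguerre_kernel k p q) (\<lambda>w::complex^'n. C * (1 / 2) ^ q / R ^ (p + q) * exp (c * norm w))"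
    using bihom_laguerre_kernel[where 'n='n and k=k, OF R] by (elim exE conjE) (rule that)
  note K = K0[rule_format]
  define J where "J = (LINT w|lebesgue. norm (weighted w) * (1 * exp (c * norm w)))"
  have "bihom p q (component p q) (C * J * (1 / 2) ^ q / R ^ (p + q))" if p: "p \<le> k" for p q
  proof -
    let ?a = "C * (1 / 2) ^ q / R ^ (p + q)"
    have "(LINT w|lebesgue. norm (weighted w) * (?a * exp (c * norm w))) = (LINT w|lebesgue. ?a * (norm (weighted w) * (1 * exp (c * norm w))))"
      by (simp only: mult_ac mult_1_left)
    also have "\<dots> = ?a * J" unfolding J_def by (rule integral_mult_right_zero)
    also have "\<dots> = C * J * (1 / 2) ^ q / R ^ (p + q)" by simp
    finally show ?thesis
      using bihom_kernel_integral(1)[OF K[OF p] weighted_measurable weighted_integrable, of q]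
      unfolding component_def[abs_def] by (simp only:)
  qed
  then show ?thesis by (intro exI allI impI)
qed

lemma component_norm_le:
  "\<exists>B. \<forall>p q. p \<le> k \<longrightarrow> norm (component p q z) \<le> B * (1 / 2) ^ q"
proof -
  define R where "R = max 1 (norm z)"
  have R: "R \<ge> 1" "\<And>j. norm (z $ j) \<le> R"
    using Finite_Cartesian_Product.norm_nth_le[of z] by (auto simp: R_def le_max_iff_disj)
  obtain B where bi: "\<forall>p q. p \<le> k \<longrightarrow> bihom p q (component p q) (B * (1 / 2) ^ q / R ^ (p + q))"
    using component_bihom[OF R(1)] by (elim exE) (rule that)
  have "norm (component p q z) \<le> B * (1 / 2) ^ q" if "p \<le> k" for p q
    using bihom_kernel_norm_le[OF bi[rule_format, OF that] R(2)] R(1) by simp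
  then show ?thesis by (intro exI allI impI)
qed

lemma summable_geometric_half: "summable (\<lambda>q. B * (1 / 2) ^ q :: real)"
  by (intro summable_mult summable_geometric) simp

sublocale bigraded_eigenfunction k component
proof
  fix p q assume p: "p \<le> k"
  obtain B where B: "\<forall>p q. p \<le> k \<longrightarrow> bihom p q (component p q) (B * (1 / 2) ^ q / 1 ^ (p + q))"
    using component_bihom[OF order_refl] by (elim exE) (rule that)
  show "\<exists>M. bihom p q (component p q) M"
    by (rule exI) (rule B[rule_format, OF p])
next
  fix p q z assume p: "p \<le> k"
  obtain C c where "C \<ge> 0" and K0: "\<forall>p q. p \<le> k \<longrightarrow>
     bihom_kernel p q (laguerre_kernel k p q) (\<lambda>w::complex^'n. C * (1 / 2) ^ q / 1 ^ (p + q) * exp (c * norm w))"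
    using bihom_laguerre_kernel[where 'n='n and k=k, OF order_refl] by (elim exE conjE) (rule that)
  note K = K0[rule_format]
  have "laplacian (component p q) z = (LINT w|lebesgue. weighted w * laplacian (\<lambda>z. laguerre_kernel k p q z w) z)"
    unfolding component_def[abs_def] by (rule bihom_kernel_integral(2)[OF K[OF p] weighted_measurable weighted_integrable])
  also have "\<dots> = (LINT w|lebesgue. (if p = 0 \<or> q = 0 then 0 else - 2 * of_nat (Suc k - p)) * (weighted w * laguerre_kernel k (p - 1) (q - 1) z w))"
    unfolding laplacian_laguerre_kernel[OF p] by (intro Bochner_Integration.integral_cong refl) simp
  also have "\<dots> = (if p = 0 \<or> q = 0 then 0 else - 2 * of_nat (Suc k - p)) * component (p - 1) (q - 1) z"
    unfolding component_def by (rule integral_mult_right_zero)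
  finally show "laplacian (component p q) z
      = (if p = 0 \<or> q = 0 then 0 else - 2 * of_nat (Suc k - p) * component (p - 1) (q - 1) z)" by simp
next
  fix p z assume p: "p \<le> k"
  obtain B where "\<forall>p q. p \<le> k \<longrightarrow> norm (component p q z) \<le> B * (1 / 2) ^ q"
    using component_norm_le[of z] by (elim exE) (rule that)
  then show "summable (\<lambda>q. norm (component p q z))"
    using p by (intro summable_comparison_test'[OF summable_geometric_half[of B]]) auto
qed

text \<open>
  The sum over \<open>q\<close> and the integral may be exchanged because, for \<open>R\<close> at least \<open>1\<close> and \<open>norm z\<close>, the kernels
  are dominated by \<open>(1/2)^q\<close> times one integrable function.
\<close>
lemma sum_component: "(\<Sum>p\<le>k. \<Sum>q. component p q z) = (LINT w|lebesgue. weighted w *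
       (exp (herm w z / 2) * complex_laguerre (CARD('n) - 1) k ((herm z z + herm w w - herm z w - herm w z) / 2)))"
proof -
  define R where "R = max 1 (norm z)"
  have R: "R \<ge> 1" "\<And>j. norm (z $ j) \<le> R"
    using Finite_Cartesian_Product.norm_nth_le[of z] by (auto simp: R_def le_max_iff_disj)
  obtain C c where C: "C \<ge> 0" and K0: "\<forall>p q. p \<le> k \<longrightarrow>
     bihom_kernel p q (laguerre_kernel k p q) (\<lambda>w::complex^'n. C * (1 / 2) ^ q / R ^ (p + q) * exp (c * norm w))"
    using bihom_laguerre_kernel[where 'n='n and k=k, OF R(1)] by (elim exE conjE) (rule that)
  note K = K0[rule_format]
  define g where "g = (\<lambda>p q w. weighted w * laguerre_kernel k p q z w)"
  define J where "J = (LINT w|lebesgue. norm (weighted w) * (C * exp (c * norm w)))"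
  have component_eq: "component p q z = (LINT w|lebesgue. g p q w)" for p q
    by (simp add: component_def g_def)
  have bound: "norm (g p q w) \<le> (norm (weighted w) * (C * exp (c * norm w))) * (1 / 2) ^ q" if "p \<le> k" for p q w
  proof -
    have "norm (laguerre_kernel k p q z w) \<le> C * (1 / 2) ^ q / R ^ (p + q) * exp (c * norm w) * R ^ (p + q)"
      by (rule bihom_kernel_norm_le[OF K[OF that] R(2)])
    also have "\<dots> = C * exp (c * norm w) * (1 / 2) ^ q" using R(1) by simp
    finally have "norm (weighted w) * norm (laguerre_kernel k p q z w) \<le> norm (weighted w) * (C * exp (c * norm w) * (1 / 2) ^ q)"
      by (intro mult_left_mono) auto
    then show ?thesis by (simp add: g_def norm_mult mult_ac)
  qed
  have g_measurable [measurable]: "g p q \<in> borel_measurable lebesgue" if "p \<le> k" for p q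
  proof -
    have [measurable]: "laguerre_kernel k p q z \<in> borel_measurable lebesgue"
      using bihom_kernel_measurable[OF K[OF that]] by (intro measurable_completion) simp
    show ?thesis unfolding g_def by measurable
  qed
  have g_integrable: "integrable lebesgue (g p q)" if "p \<le> k" for p q
  proof (rule Bochner_Integration.integrable_bound)
    show "integrable lebesgue (\<lambda>w. (norm (weighted w) * (C * exp (c * norm w))) * (1 / 2) ^ q)"
      by (intro integrable_mult_left weighted_integrable)
    show "AE w in lebesgue. norm (g p q w) \<le> norm ((norm (weighted w) * (C * exp (c * norm w))) * (1 / 2) ^ q)"
      using bound[OF that] C by (intro always_eventually allI) (simp add: abs_mult)
  qed (rule g_measurable[OF that])
  have s: "AE w in lebesgue. summable (\<lambda>q. norm (g p q w))" if "p \<le> k" for p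
    using bound[OF that]
    by (intro always_eventually allI summable_comparison_test'[OF summable_geometric_half]) auto
  have i: "summable (\<lambda>q. LINT w|lebesgue. norm (g p q w))" if "p \<le> k" for p
  proof (rule summable_comparison_test'[OF summable_geometric_half[of J], of 0])
    fix q
    have "(LINT w|lebesgue. norm (g p q w)) \<le> (LINT w|lebesgue. (norm (weighted w) * (C * exp (c * norm w))) * (1 / 2) ^ q)"
      by (intro integral_mono integrable_norm g_integrable that bound integrable_mult_left weighted_integrable)
    also have "\<dots> = J * (1 / 2) ^ q" unfolding J_def by (rule integral_mult_left_zero)
    finally show "norm (LINT w|lebesgue. norm (g p q w)) \<le> J * (1 / 2) ^ q"
      by (simp add: integral_nonneg_AE)
  qed
  have "(\<Sum>p\<le>k. \<Sum>q. component p q z) = (\<Sum>p\<le>k. LINT w|lebesgue. (\<Sum>q. g p q w))"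
    unfolding component_eq
    by (intro sum.cong refl integral_suminf[symmetric] g_integrable s i) auto
  also have "\<dots> = (LINT w|lebesgue. (\<Sum>p\<le>k. \<Sum>q. g p q w))"
    by (intro Bochner_Integration.integral_sum[symmetric] integrable_suminf g_integrable s i) auto
  also have "\<dots> = (LINT w|lebesgue. weighted w * (\<Sum>p\<le>k. \<Sum>q. laguerre_kernel k p q z w))"
    unfolding g_def sum_distrib_left
    by (intro Bochner_Integration.integral_cong refl sum.cong suminf_mult sums_summable[OF laguerre_kernel_sums]) auto
  finally show ?thesis unfolding sum_laguerre_kernel .
qed

lemma twisted_conv_eq_sum_component:
  "twisted_conv f (laguerre_fun (CARD('n) - 1) k) z = exp (- herm z z / 4) * (\<Sum>p\<le>k. \<Sum>q. component p q z)"
  unfolding sum_component twisted_conv_laguerre[OF f_measurable] weighted_def ..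

text \<open>
  At a point \<open>x\<close> the radius \<open>r = 1\<close> suffices. The weight \<open>R = 2 (norm x + 1)\<close> is the factor by which
  re-expansion at \<open>x\<close> can increase the coefficients per degree, so the bounds for the re-expanded
  components form a geometric series.
\<close>
lemma real_analytic_twisted_conv: "real_analytic (twisted_conv f (laguerre_fun (CARD('n) - 1) k))"
proof (rule real_analytic_majorizedI)
  fix x :: "complex^'n"
  define R where "R = 2 * (norm x + 1)"
  have R: "R \<ge> 1" unfolding R_def using mult_mono[of 1 2 1 "norm x + 1"] by simp
  obtain B where bi: "\<forall>p q. p \<le> k \<longrightarrow> bihom p q (component p q) (B * (1 / 2) ^ q / R ^ (p + q))"
    using component_bihom[OF R] by (elim exE) (rule that)
  have "majorized x 1 (component p q) (B * (1 / 2) ^ q)" if "p \<le> k" for p q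
  proof -
    have "majorized x 1 (component p q) (B * (1 / 2) ^ q / R ^ (p + q) * R ^ (p + q))"
      unfolding R_def by (rule majorized_bihom[OF zero_le_one bi[rule_format, OF that, unfolded R_def]])
    then show ?thesis using R by simp
  qed
  then have "majorized x 1 (\<lambda>z. \<Sum>q. component p q z) (\<Sum>q. B * (1 / 2) ^ q)" if p: "p \<le> k" for p
  proof (intro majorized_suminf summable_geometric_half zero_less_one)
    show "(\<lambda>q. component p q y) sums (\<Sum>q. component p q y)" for y
      by (rule summable_sums[OF summable_norm_cancel[OF smbl[OF p]]])
  qed (use p in auto)
  then have total: "majorized x 1 (\<lambda>z. \<Sum>p\<le>k. \<Sum>q. component p q z) (\<Sum>p\<le>k. \<Sum>q. B * (1 / 2) ^ q)"
    by (intro majorized_sum) auto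
  obtain M where "majorized x 1 (\<lambda>z. exp (- herm z z / 4) * (\<Sum>p\<le>k. \<Sum>q. component p q z)) M"
    using majorized_gaussian_mult[OF zero_less_one total] by blast
  then have "majorized x 1 (twisted_conv f (laguerre_fun (CARD('n) - 1) k)) M"
    by (rule majorized_cong) (rule twisted_conv_eq_sum_component[symmetric])
  then show "\<exists>r>0. \<exists>M. majorized x r (twisted_conv f (laguerre_fun (CARD('n) - 1) k)) M"
    by (intro exI[of _ 1] exI[of _ M] conjI) auto
qed

lemma harmonic_expansion:
  shows "p \<le> k \<Longrightarrow> summable (\<lambda>q. harmonic p q z * laguerre_fun (CARD('n) + p + q - 1) (k - p) z)"
    and "twisted_conv f (laguerre_fun (CARD('n) - 1) k) z
      = (\<Sum>p\<le>k. \<Sum>q. harmonic p q z * laguerre_fun (CARD('n) + p + q - 1) (k - p) z)"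
proof -
  have e: "harmonic p q z * laguerre_fun a m z = exp (- herm z z / 4) * (harmonic p q z * complex_laguerre a m (herm z z / 2))"
    for p q a m unfolding laguerre_fun_complex_laguerre by simp
  have s: "summable (\<lambda>q. harmonic p q z * complex_laguerre (CARD('n) + p + q - 1) (k - p) (herm z z / 2))" if "p \<le> k" for p
    by (rule sums_summable[OF sums_harmonic_complex_laguerre[OF that]])
  show "p \<le> k \<Longrightarrow> summable (\<lambda>q. harmonic p q z * laguerre_fun (CARD('n) + p + q - 1) (k - p) z)"
    unfolding e by (intro summable_mult s)
  show "twisted_conv f (laguerre_fun (CARD('n) - 1) k) z
      = (\<Sum>p\<le>k. \<Sum>q. harmonic p q z * laguerre_fun (CARD('n) + p + q - 1) (k - p) z)"
    unfolding twisted_conv_eq_sum_component sum_harmonic_complex_laguerre[symmetric] e sum_distrib_left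
    by (intro sum.cong refl suminf_mult[symmetric] s) auto
qed

end

theorem theorem4p2:
  fixes f :: "complex^'n \<Rightarrow> complex" and k :: nat
  assumes "f \<in> borel_measurable lebesgue"
    and "integrable lebesgue (\<lambda>z. (norm (f z))\<^sup>2)"
  shows "real_analytic (twisted_conv f (laguerre_fun (CARD('n) - 1) k)) \<and>
    (\<exists>P :: nat \<Rightarrow> nat \<Rightarrow> complex^'n \<Rightarrow> complex.
       (\<forall>p\<le>k. \<forall>q. P p q \<in> bigraded_harmonics p q) \<and>
       (\<forall>z. (\<forall>p\<le>k. summable (\<lambda>q. P p q z * laguerre_fun (CARD('n) + p + q - 1) (k - p) z)) \<and>
            twisted_conv f (laguerre_fun (CARD('n) - 1) k) z =
              (\<Sum>p\<le>k. \<Sum>q. P p q z * laguerre_fun (CARD('n) + p + q - 1) (k - p) z)))"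
proof -
  interpret square_integrable f k using assms by unfold_locales
  show ?thesis
    using real_analytic_twisted_conv harmonic_in harmonic_expansion
    by (intro conjI exI[of _ harmonic]) auto
qed

end
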